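(* Let $N\ge1$. There exist constants $\sigma=\sigma(N,s)>0$ and $\mathcal{C}=\mathcal{C}(N,s,\gamma)>0$, defined for $0<s<1$ and $0<\gamma<1$, such that for every $0<s<1$, every $0<\gamma<1$ and every open set $\Omega\subseteq\mathbb{R}^N$ $$\sigma\,\gamma\left(\frac{1}{R^s_{1,\gamma}(\Omega)}\right)^s\le h_s(\Omega)\le\mathcal{C}\left(\frac{1}{R^s_{1,\gamma}(\Omega)}\right)^s.$$ Here $\sigma(N,s)\sim\frac1s$ as $s\searrow0$ and $\sigma(N,s)\sim\frac1{1-s}$ as $s\nearrow1$, the constant $\mathcal{C}(N,s,\gamma)$ diverges to $+\infty$ as $\gamma\to1$, and $$0<\lim_{s\to0}s\,\mathcal{C}(N,s,\gamma)<\infty,\qquad 0<\lim_{s\to1}(1-s)\,\mathcal{C}(N,s,\gamma)<\infty.$$ In particular, $$h_s(\Omega)>0\quad\Longleftrightarrow\quad R^s_{1,\gamma}(\Omega)<\infty,$$ and the last condition does not depend on $0<\gamma<1$.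
   Context: For a Borel set $A\subseteq\mathbb{R}^N$, the fractional $s$-perimeter is $P_s(A)=\iint_{\mathbb{R}^N\times\mathbb{R}^N}\frac{|1_A(x)-1_A(y)|}{|x-y|^{N+s}}\,dx\,dy$. The fractional Cheeger constant of an open set $\Omega$ is $$h_s(\Omega)=\inf\left\{\frac{P_s(E)}{|E|}:\ E\Subset\Omega\text{ (nonempty) open set with smooth boundary}\right\},$$ where $E\Subset\Omega$ means that $\overline{E}$ is a compact subset of $\Omega$. For an open set $E$ and a compact set $\Sigma\subseteq E$, $$\widetilde{\mathrm{cap}}_{s,1}(\Sigma;E)=\inf_{\varphi\in C^\infty_0(E)}\left\{\iint_{\mathbb{R}^N\times\mathbb{R}^N}\frac{|\varphi(x)-\varphi(y)|}{|x-y|^{N+s}}\,dx\,dy:\ \varphi\ge1\text{ on }\Sigma\right\}.$$ For $0<\gamma<1$, a compact set $\Sigma\subseteq\overline{B_r(x_0)}$ is $(s,1,\gamma)$-negligible if $\widetilde{\mathrm{cap}}_{s,1}(\Sigma;B_{2r}(x_0))\le\gamma\,\widetilde{\mathrm{cap}}_{s,1}(\overline{B_r(x_0)};B_{2r}(x_0))$, and $$R^s_{1,\gamma}(\Omega)=\sup\{r>0:\ \exists\,B_r(x_0)\text{ such that }\overline{B_r(x_0)}\setminus\Omega\text{ is }(s,1,\gamma)\text{-negligible}\}\in(0,+\infty],$$ with $1/(+\infty)=0$. The notation $u\sim v$ for $x\to x_0$ means $0<\liminf_{x\to x_0}u(x)/v(x)\le\limsup_{x\to x_0}u(x)/v(x)<\infty$.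 *)

theory Defs
  imports "HOL-Analysis.Analysis"
begin

text \<open>Throughout, the ambient space \<open>\<real>\<^sup>N\<close> is a type \<open>'a::euclidean_space\<close> with \<open>N = DIM('a) \<ge> 1\<close>.\<close>

text \<open>Only meaningful for open \<open>S\<close>: all iterated directional derivatives up to order \<open>k\<close> exist
  and are continuous on \<open>S\<close>.\<close>
primrec Ck_on :: "nat \<Rightarrow> 'a::euclidean_space set \<Rightarrow> ('a \<Rightarrow> real) \<Rightarrow> bool" where
  "Ck_on 0 S f \<longleftrightarrow> continuous_on S f"
| "Ck_on (Suc k) S f \<longleftrightarrow>
     (\<forall>x\<in>S. f differentiable (at x)) \<and> (\<forall>v. Ck_on k S (\<lambda>x. frechet_derivative f (at x) v))"

definition smooth_on :: "'a::euclidean_space set \<Rightarrow> ('a \<Rightarrow> real) \<Rightarrow> bool" where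
  "smooth_on S f \<longleftrightarrow> (\<forall>k. Ck_on k S f)"

definition test_functions :: "'a::euclidean_space set \<Rightarrow> ('a \<Rightarrow> real) set" where
  "test_functions E =
     {\<phi>. smooth_on UNIV \<phi> \<and> compact (closure {x. \<phi> x \<noteq> 0}) \<and> closure {x. \<phi> x \<noteq> 0} \<subseteq> E}"

text \<open>Near each boundary point, \<open>E\<close> is the strict sublevel set of a smooth function without
  critical points; in particular \<open>E\<close> lies locally on one side of its boundary.\<close>
definition smooth_boundary :: "'a::euclidean_space set \<Rightarrow> bool" where
  "smooth_boundary E \<longleftrightarrow>
     (\<forall>p\<in>frontier E. \<exists>U g. open U \<and> p \<in> U \<and> smooth_on U g \<and>
        (\<forall>x\<in>U. frechet_derivative g (at x) \<noteq> (\<lambda>v. 0)) \<and> E \<inter> U = {x\<in>U. g x < 0})"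

text \<open>On the diagonal the integrand is \<open>0 / 0 = 0\<close>; the diagonal is a null set anyway.\<close>
definition gagliardo :: "real \<Rightarrow> ('a::euclidean_space \<Rightarrow> real) \<Rightarrow> ennreal" where
  "gagliardo s f =
     (\<integral>\<^sup>+y. (\<integral>\<^sup>+x. ennreal (\<bar>f x - f y\<bar> / norm (x - y) powr (real DIM('a) + s)) \<partial>lborel) \<partial>lborel)"

definition frac_perimeter :: "real \<Rightarrow> 'a::euclidean_space set \<Rightarrow> ennreal" where
  "frac_perimeter s A = gagliardo s (indicat_real A)"

text \<open>The infimum over no competitors (\<open>\<Omega> = {}\<close>) is \<open>\<infinity>\<close>. For the competitors,
  \<open>0 < |E| < \<infinity>\<close>.\<close>
definition cheeger :: "real \<Rightarrow> 'a::euclidean_space set \<Rightarrow> ennreal" where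
  "cheeger s \<Omega> =
     Inf {frac_perimeter s E / emeasure lborel E | E.
            E \<noteq> {} \<and> open E \<and> smooth_boundary E \<and> compact (closure E) \<and> closure E \<subseteq> \<Omega>}"

definition frac_cap :: "real \<Rightarrow> 'a::euclidean_space set \<Rightarrow> 'a set \<Rightarrow> ennreal" where
  "frac_cap s \<Sigma> E = Inf {gagliardo s \<phi> | \<phi>. \<phi> \<in> test_functions E \<and> (\<forall>x\<in>\<Sigma>. 1 \<le> \<phi> x)}"

definition negligible_cap ::
    "real \<Rightarrow> real \<Rightarrow> 'a::euclidean_space \<Rightarrow> real \<Rightarrow> 'a set \<Rightarrow> bool" where
  "negligible_cap s \<gamma> x0 r \<Sigma> \<longleftrightarrow> compact \<Sigma> \<and> \<Sigma> \<subseteq> cball x0 r \<and>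
     frac_cap s \<Sigma> (ball x0 (2 * r)) \<le> ennreal \<gamma> * frac_cap s (cball x0 r) (ball x0 (2 * r))"

definition cap_inradius :: "real \<Rightarrow> real \<Rightarrow> 'a::euclidean_space set \<Rightarrow> ennreal" where
  "cap_inradius s \<gamma> \<Omega> =
     Sup {ennreal r | r. 0 < r \<and> (\<exists>x0. negligible_cap s \<gamma> x0 r (cball x0 r - \<Omega>))}"

text \<open>Real powers on \<open>[0,\<infinity>]\<close>, for exponents \<open>p > 0\<close>.\<close>
definition ennreal_powr :: "ennreal \<Rightarrow> real \<Rightarrow> ennreal" where
  "ennreal_powr a p = (if a = \<infinity> then \<infinity> else ennreal (enn2real a powr p))"

definition comparable :: "real filter \<Rightarrow> (real \<Rightarrow> real) \<Rightarrow> (real \<Rightarrow> real) \<Rightarrow> bool" where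
  "comparable F u v \<longleftrightarrow>
     0 < Liminf F (\<lambda>x. ereal (u x / v x)) \<and>
     Liminf F (\<lambda>x. ereal (u x / v x)) \<le> Limsup F (\<lambda>x. ereal (u x / v x)) \<and>
     Limsup F (\<lambda>x. ereal (u x / v x)) < \<infinity>"

end

theory Submission
  imports Defs
begin

text \<open>Write \<open>D f h\<close> for the \<open>L\<^sup>1\<close> norm of \<open>f(\<cdot> + h) - f\<close> and \<open>[f]\<close> for the Gagliardo seminorm, which is the
  integral of \<open>D f h\<close> against the kernel \<open>|h| powr -(N + s)\<close>. The modulus \<open>D f\<close> is even and
  subadditive, and this alone gives \<open>D f h \<le> C s (1 - s) |h| powr s [f]\<close> with \<open>C\<close> depending only on
  \<open>N\<close> (\<open>l1_modulus_le_gagliardo\<close>): the dyadic annuli outside the sphere of radius \<open>|h|\<close> contribute a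
  geometric series of ratio \<open>4 powr -s\<close>, those inside one of ratio \<open>4 powr -(1 - s)\<close>. Conversely a
  cutoff function between concentric balls of radii comparable to \<open>r\<close> has seminorm at most
  \<open>C r powr (N - s) / (s (1 - s))\<close>. Hence the capacity of a closed ball in its double is comparable to
  \<open>r powr (N - s) / (s (1 - s))\<close>, uniformly in \<open>s\<close>, and one may take
  \<open>\<sigma> s = c / (s (1 - s))\<close> and \<open>\<C> s \<gamma> = C(\<gamma>) / (s (1 - s))\<close>; the asymptotic claims are then immediate.

  Lower bound (\<open>cheeger_lower_at_radius\<close>). Suppose that no closed ball of radius \<open>r\<close> has negligible
  trace outside \<open>\<Omega>\<close>, and let \<open>E\<close> be a competitor. If \<open>\<eta>\<close> is a cutoff function for a ball \<open>B\<close> of radius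
  \<open>r\<close>, then \<open>\<eta> (1 - 1\<^sub>E)\<close> is admissible for the capacity of \<open>B - \<Omega>\<close>, so its seminorm is at least
  \<open>\<gamma>\<close> times the capacity of \<open>B\<close>. By the product rule that seminorm is bounded by the volume of the part
  of the doubled ball outside \<open>E\<close> and by the part of the perimeter integral with one point in the
  doubled ball. Integrating over all centres of \<open>B\<close> that lie in \<open>E\<close> turns the volume into an integral of
  \<open>D 1\<^sub>E h\<close> over \<open>|h| \<le> 2 r\<close>, and the modulus estimate leaves
  \<open>c \<gamma> r powr -s / (s (1 - s)) |E| \<le> P\<^sub>s(E)\<close>.

  Upper bound (\<open>cheeger_upper_at_radius\<close>). Let \<open>B - \<Omega>\<close> be negligible for a ball \<open>B\<close> of radius \<open>r\<close>,
  let \<open>\<phi>\<close> be an almost optimal test function and \<open>p\<close> its truncation to \<open>[0, 1]\<close>. For small \<open>\<tau>\<close> the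
  product \<open>u\<close> of a cutoff function of \<open>B\<close> with \<open>max 0 (1 - \<tau> - p)\<close> is supported in a compact subset of
  \<open>\<Omega>\<close>, and \<open>[u] \<le> C r powr (N - s) / (s (1 - s))\<close>. That the integral of \<open>u\<close> is at least \<open>\<delta>(\<gamma>) r^N\<close>
  means that \<open>\<phi>\<close> cannot be close to 1 on most of \<open>B\<close> (\<open>uncovered_mass_lower\<close>). To see this, fill up
  \<open>p\<close> to the value 1 on a slightly smaller concentric ball. The seminorm grows by a multiple of the
  integral of \<open>1 - p\<close> over \<open>B\<close>. Composition with a bi-Lipschitz map that contracts \<open>B\<close> into the smaller
  ball and is the identity off the doubled ball makes the filled function admissible for \<open>B\<close> itself and
  costs only a factor close to 1 (\<open>gagliardo_shrink\<close>). As \<open>\<gamma> < 1\<close>, the integral of \<open>1 - p\<close> has to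
  compensate for the gap between \<open>\<gamma>\<close> times the capacity of \<open>B\<close> and the full capacity of \<open>B\<close>.

  Passing from functions to smooth sets (\<open>cheeger_le_function\<close>). For a function \<open>u\<close> supported in a compact
  subset of \<open>\<Omega>\<close> the coarea formula bounds the Cheeger constant by \<open>[u]\<close> divided by the integral of
  \<open>u\<close>, once almost all superlevel sets are smooth. Mollify \<open>u\<close> to a smooth \<open>f\<close>, and subtract a small
  linear function \<open>a \<bullet> x\<close>. The pairs \<open>(a, t)\<close> for which \<open>t\<close> is a critical value of
  \<open>x \<mapsto> f x - a \<bullet> x\<close> form the image of the \<open>N\<close>-dimensional space under the \<open>C\<^sup>1\<close> map
  \<open>x \<mapsto> (\<nabla>f x, f x - \<nabla>f x \<bullet> x)\<close> into a space of dimension \<open>N + 1\<close>, which is a null set. So almost every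
  \<open>a\<close> makes almost every level regular, and \<open>a\<close> may be chosen as small as one likes.\<close>

section \<open>The fractional seminorm and the L1 modulus of translation\<close>

text \<open>Since \<open>0 powr x = 0\<close>, the kernel vanishes at the origin, in agreement with the value \<open>0 / 0 = 0\<close> of the
  Gagliardo integrand on the diagonal.\<close>
definition frac_kernel :: "real \<Rightarrow> 'a::euclidean_space \<Rightarrow> ennreal" where
  "frac_kernel s h = ennreal (norm h powr - (real DIM('a) + s))"

definition l1_modulus :: "('a::euclidean_space \<Rightarrow> real) \<Rightarrow> 'a \<Rightarrow> ennreal" where
  "l1_modulus f h = (\<integral>\<^sup>+y. ennreal \<bar>f (y + h) - f y\<bar> \<partial>lborel)"

abbreviation variation_at :: "real \<Rightarrow> ('a::euclidean_space \<Rightarrow> real) \<Rightarrow> 'a \<Rightarrow> ennreal" where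
  "variation_at s f x \<equiv> (\<integral>\<^sup>+y. ennreal \<bar>f x - f y\<bar> * frac_kernel s (x - y) \<partial>lborel)"

lemma frac_kernel_measurable [measurable]: "frac_kernel s \<in> borel_measurable borel"
  unfolding frac_kernel_def by measurable

lemma frac_kernel_minus: "frac_kernel s (x - y) = frac_kernel s (y - x)"
  by (simp add: frac_kernel_def norm_minus_commute)

lemma l1_modulus_measurable [measurable]:
  assumes [measurable]: "f \<in> borel_measurable borel"
  shows "l1_modulus f \<in> borel_measurable borel"
proof -
  have "(\<lambda>h. \<integral>\<^sup>+y. ennreal \<bar>f (y + h) - f y\<bar> \<partial>lborel) \<in> borel_measurable lborel"
    by measurable
  then show ?thesis by (simp add: l1_modulus_def[abs_def])
qed

lemma nn_integral_translate:
  fixes c :: "'a::euclidean_space"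
  assumes [measurable]: "f \<in> borel_measurable borel"
  shows "(\<integral>\<^sup>+x. f (x + c) \<partial>lborel) = (\<integral>\<^sup>+x. f x \<partial>lborel)"
proof -
  have "(\<integral>\<^sup>+x. f x \<partial>lborel) = (\<integral>\<^sup>+x. f x \<partial>distr lborel borel ((+) c))"
    by (simp add: lborel_distr_plus)
  also have "\<dots> = (\<integral>\<^sup>+x. f (x + c) \<partial>lborel)"
    by (subst nn_integral_distr) (simp_all add: add.commute)
  finally show ?thesis by simp
qed

lemma nn_integral_reflect:
  fixes c :: "'a::euclidean_space"
  assumes [measurable]: "f \<in> borel_measurable borel"
  shows "(\<integral>\<^sup>+x. f (c - x) \<partial>lborel) = (\<integral>\<^sup>+x. f x \<partial>lborel)"
proof -
  have "(\<integral>\<^sup>+x. f x \<partial>lborel) = (\<integral>\<^sup>+x. f x \<partial>density (distr lborel borel (\<lambda>x::'a. c + (-1) *\<^sub>R x)) (\<lambda>_. \<bar>- 1 :: real\<bar> ^ DIM('a)))"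
    by (subst lborel_affine[of "-1" c]) simp_all
  also have "\<dots> = (\<integral>\<^sup>+x. f (c - x) \<partial>lborel)"
    by (simp add: density_1 nn_integral_distr)
  finally show ?thesis by simp
qed

lemma nn_integral_swap:
  fixes f :: "'a::euclidean_space \<Rightarrow> 'b::euclidean_space \<Rightarrow> ennreal"
  assumes "case_prod f \<in> borel_measurable (lborel \<Otimes>\<^sub>M lborel)"
  shows "(\<integral>\<^sup>+x. (\<integral>\<^sup>+y. f x y \<partial>lborel) \<partial>lborel) = (\<integral>\<^sup>+y. (\<integral>\<^sup>+x. f x y \<partial>lborel) \<partial>lborel)"
  using lborel_pair.Fubini'[OF assms] by simp

lemma ennreal_divide_powr:
  assumes "0 \<le> a"
  shows "ennreal (a / norm h powr (real DIM('a) + s)) = ennreal a * frac_kernel s (h::'a::euclidean_space)"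
  unfolding frac_kernel_def powr_minus divide_inverse using assms by (simp add: ennreal_mult)

lemma gagliardo_frac_kernel:
  fixes f :: "'a::euclidean_space \<Rightarrow> real"
  shows "gagliardo s f = (\<integral>\<^sup>+y. (\<integral>\<^sup>+x. ennreal \<bar>f x - f y\<bar> * frac_kernel s (x - y) \<partial>lborel) \<partial>lborel)"
  unfolding gagliardo_def by (simp add: ennreal_divide_powr)

text \<open>The substitution \<open>x = y + h\<close> reduces the double integral to the modulus of translation; all lower bounds
  for the seminorm are obtained through this formula.\<close>
lemma gagliardo_l1_modulus:
  fixes f :: "'a::euclidean_space \<Rightarrow> real"
  assumes [measurable]: "f \<in> borel_measurable borel"
  shows "gagliardo s f = (\<integral>\<^sup>+h. l1_modulus f h * frac_kernel s h \<partial>lborel)"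
proof -
  have "gagliardo s f = (\<integral>\<^sup>+y. (\<integral>\<^sup>+x. ennreal \<bar>f x - f y\<bar> * frac_kernel s (x - y) \<partial>lborel) \<partial>lborel)"
    by (rule gagliardo_frac_kernel)
  also have "\<dots> = (\<integral>\<^sup>+y. (\<integral>\<^sup>+h. ennreal \<bar>f (h + y) - f y\<bar> * frac_kernel s h \<partial>lborel) \<partial>lborel)"
  proof (rule nn_integral_cong)
    fix y :: 'a
    have "(\<lambda>x. ennreal \<bar>f x - f y\<bar> * frac_kernel s (x - y)) \<in> borel_measurable borel" by measurable
    from nn_integral_translate[OF this, of y]
    show "(\<integral>\<^sup>+x. ennreal \<bar>f x - f y\<bar> * frac_kernel s (x - y) \<partial>lborel) = (\<integral>\<^sup>+h. ennreal \<bar>f (h + y) - f y\<bar> * frac_kernel s h \<partial>lborel)"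
      by simp
  qed
  also have "\<dots> = (\<integral>\<^sup>+h. (\<integral>\<^sup>+y. ennreal \<bar>f (h + y) - f y\<bar> * frac_kernel s h \<partial>lborel) \<partial>lborel)"
    by (rule nn_integral_swap) measurable
  also have "\<dots> = (\<integral>\<^sup>+h. l1_modulus f h * frac_kernel s h \<partial>lborel)"
    by (simp add: l1_modulus_def nn_integral_multc add.commute)
  finally show ?thesis .
qed

lemma l1_modulus_minus:
  assumes [measurable]: "f \<in> borel_measurable borel"
  shows "l1_modulus f (- h) = l1_modulus f h"
proof -
  have "(\<lambda>y. ennreal \<bar>f (y - h) - f y\<bar>) \<in> borel_measurable borel" by measurable
  from nn_integral_translate[OF this, of h] show ?thesis
    by (simp add: l1_modulus_def abs_minus_commute)
qed

lemma l1_modulus_add: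
  assumes [measurable]: "f \<in> borel_measurable borel"
  shows "l1_modulus f (h + k) \<le> l1_modulus f h + l1_modulus f k"
proof -
  have m: "(\<lambda>y. ennreal \<bar>f (y + h) - f y\<bar>) \<in> borel_measurable borel" by measurable
  have "l1_modulus f (h + k) \<le> (\<integral>\<^sup>+y. ennreal \<bar>f (y + k + h) - f (y + k)\<bar> + ennreal \<bar>f (y + k) - f y\<bar> \<partial>lborel)"
    unfolding l1_modulus_def
    by (intro nn_integral_mono) (simp add: ennreal_plus[symmetric] add_ac del: ennreal_plus)
  also have "\<dots> = (\<integral>\<^sup>+y. ennreal \<bar>f (y + k + h) - f (y + k)\<bar> \<partial>lborel) + l1_modulus f k"
    unfolding l1_modulus_def by (rule nn_integral_add) measurable
  also have "(\<integral>\<^sup>+y. ennreal \<bar>f (y + k + h) - f (y + k)\<bar> \<partial>lborel) = l1_modulus f h"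
    using nn_integral_translate[OF m, of k] by (simp add: l1_modulus_def)
  finally show ?thesis .
qed

lemma l1_modulus_multiple:
  assumes [measurable]: "f \<in> borel_measurable borel"
  shows "l1_modulus f (real n *\<^sub>R h) \<le> ennreal (real n) * l1_modulus f h"
proof (induction n)
  case 0
  show ?case by (simp add: l1_modulus_def)
next
  case (Suc n)
  have "l1_modulus f (real (Suc n) *\<^sub>R h) = l1_modulus f (real n *\<^sub>R h + h)"
    by (simp add: algebra_simps)
  also have "\<dots> \<le> ennreal (real n) * l1_modulus f h + l1_modulus f h"
    using l1_modulus_add[OF assms, of "real n *\<^sub>R h" h] Suc by (meson add_right_mono order_trans)
  also have "\<dots> = ennreal (real (Suc n)) * l1_modulus f h"
    by (simp add: distrib_right add.commute ennreal_plus[symmetric] del: ennreal_plus)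
       (simp add: ennreal_plus distrib_right)
  finally show ?case .
qed

lemma gagliardo_mono:
  assumes "\<And>x y. \<bar>f x - f y\<bar> \<le> \<bar>g x - g y\<bar>"
  shows "gagliardo s f \<le> gagliardo s g"
  unfolding gagliardo_frac_kernel
  by (intro nn_integral_mono mult_right_mono ennreal_leI assms) simp_all

lemma gagliardo_add:
  fixes f :: "'a::euclidean_space \<Rightarrow> real"
  assumes [measurable]: "f \<in> borel_measurable borel" "g \<in> borel_measurable borel" "h \<in> borel_measurable borel"
    and le: "\<And>x y. \<bar>f x - f y\<bar> \<le> \<bar>g x - g y\<bar> + \<bar>h x - h y\<bar>"
  shows "gagliardo s f \<le> gagliardo s g + gagliardo s h"
proof -
  have "gagliardo s f \<le> (\<integral>\<^sup>+y. (\<integral>\<^sup>+x. ennreal \<bar>g x - g y\<bar> * frac_kernel s (x - y) + ennreal \<bar>h x - h y\<bar> * frac_kernel s (x - y) \<partial>lborel) \<partial>lborel)"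
    unfolding gagliardo_frac_kernel distrib_right[symmetric]
    by (intro nn_integral_mono mult_right_mono) (simp_all add: ennreal_plus[symmetric] le del: ennreal_plus)
  also have "\<dots> = (\<integral>\<^sup>+y. (\<integral>\<^sup>+x. ennreal \<bar>g x - g y\<bar> * frac_kernel s (x - y) \<partial>lborel) + (\<integral>\<^sup>+x. ennreal \<bar>h x - h y\<bar> * frac_kernel s (x - y) \<partial>lborel) \<partial>lborel)"
    by (intro nn_integral_cong nn_integral_add) measurable
  also have "\<dots> = gagliardo s g + gagliardo s h"
    unfolding gagliardo_frac_kernel by (intro nn_integral_add) measurable
  finally show ?thesis .
qed

text \<open>The sums \<open>1 / (1 - 4 powr -t)\<close> of the geometric series over dyadic annuli are comparable to \<open>1 / t\<close>. With
  \<open>t = s\<close> and \<open>t = 1 - s\<close> this is the source of the factors \<open>1 / s\<close> and \<open>1 / (1 - s)\<close>.\<close>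
lemma four_powr_bounds:
  assumes "0 < (t::real)" "t < 1"
  shows "t / 2 \<le> 1 - 4 powr - t" "1 - 4 powr - t \<le> 3 * t"
proof -
  have l4: "1 \<le> ln (4::real)" "ln (4::real) \<le> 3"
  proof -
    have "exp 1 \<le> (4::real)" using exp_le by simp
    then show "1 \<le> ln (4::real)" by (simp add: ln_ge_iff)
    show "ln (4::real) \<le> 3" using ln_le_minus_one[of "4::real"] by simp
  qed
  have "1 + t * ln 4 \<le> 4 powr t"
    using exp_ge_add_one_self[of "t * ln 4"] by (simp add: powr_def)
  moreover have "t \<le> t * ln 4" using l4 assms by simp
  ultimately have a: "1 + t \<le> 4 powr t" by linarith
  have "4 powr - t \<le> 1 / (1 + t)"
    using a assms by (simp add: powr_minus divide_inverse le_imp_inverse_le)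
  moreover have "1 / (1 + t) \<le> 1 - t / 2"
    using assms by (simp add: field_simps power2_eq_square)
  ultimately show "t / 2 \<le> 1 - 4 powr - t" by linarith
  have "1 - t * ln 4 \<le> 4 powr - t"
    using exp_ge_add_one_self[of "- t * ln 4"] by (simp add: powr_def)
  moreover have "t * ln 4 \<le> t * 3" using l4 assms by (intro mult_left_mono) auto
  ultimately show "1 - 4 powr - t \<le> 3 * t" by linarith
qed

lemma suminf_geometric_powr:
  assumes "0 < (t::real)" "t < 1" "0 \<le> c"
  shows "(\<Sum>j. ennreal (c * (4 powr - t) ^ j)) = ennreal (c / (1 - 4 powr - t))"
proof (rule suminf_ennreal_eq)
  have "norm (4 powr - t) < 1" using four_powr_bounds[OF assms(1,2)] assms by (simp)
  from sums_mult[OF geometric_sums[OF this], of c]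
  show "(\<lambda>j. c * (4 powr - t) ^ j) sums (c / (1 - 4 powr - t))" by simp
qed (use assms in simp)

lemma suminf_set_integral_le:
  fixes A :: "nat \<Rightarrow> 'a::euclidean_space set"
  assumes [measurable]: "\<And>j. A j \<in> sets borel" "F \<in> borel_measurable borel" and d: "disjoint_family A"
  shows "(\<Sum>j. \<integral>\<^sup>+x. F x * indicator (A j) x \<partial>lborel) \<le> (\<integral>\<^sup>+x. F x \<partial>lborel)"
proof -
  have "(\<Sum>j. \<integral>\<^sup>+x. F x * indicator (A j) x \<partial>lborel) = (\<Sum>j. emeasure (density lborel F) (A j))"
    by (simp add: emeasure_density)
  also have "\<dots> = emeasure (density lborel F) (\<Union>j. A j)"
    by (rule suminf_emeasure) (use d in auto)
  also have "\<dots> \<le> emeasure (density lborel F) UNIV"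
    by (rule emeasure_mono) auto
  also have "\<dots> = (\<integral>\<^sup>+x. F x \<partial>lborel)"
    by (simp add: emeasure_density)
  finally show ?thesis .
qed

section \<open>The modulus is controlled by the seminorm\<close>

text \<open>The ratio 4 of the radii leaves room for a ball of radius \<open>\<rho> / 2\<close> whose translates by vectors of length
  at most \<open>\<rho>\<close> stay inside.\<close>
definition annulus :: "real \<Rightarrow> 'a::euclidean_space set" where
  "annulus \<rho> = {k. \<rho> < norm k \<and> norm k \<le> 4 * \<rho>}"

lemma annulus_measurable [measurable]: "annulus \<rho> \<in> sets borel"
  unfolding annulus_def by measurable

lemma emeasure_ball_dim:
  fixes c :: "'a::euclidean_space"
  assumes "0 \<le> r"
  shows "emeasure lborel (ball c r) = ennreal (unit_ball_vol (real DIM('a)) * r ^ DIM('a))"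
    "emeasure lborel (cball c r) = ennreal (unit_ball_vol (real DIM('a)) * r ^ DIM('a))"
  using assms by (simp_all add: emeasure_ball emeasure_cball)

lemma disjoint_annuli_aux:
  assumes "0 < (t::real)" "i < j" "4 ^ i * t < x" "x \<le> 4 * (4 ^ i * t)" "4 ^ j * t < x" "x \<le> 4 * (4 ^ j * t)"
  shows False
proof -
  have "(4::real) ^ Suc i \<le> 4 ^ j" using assms(2) by (intro power_increasing) auto
  then have "4 ^ Suc i * t \<le> 4 ^ j * t" using assms(1) by (intro mult_right_mono) auto
  moreover have "4 ^ Suc i * t = 4 * (4 ^ i * t)" by (simp only: power_Suc mult.assoc)
  ultimately show False using assms(4,5) by linarith
qed

lemma disjoint_annuli_up:
  assumes "0 < (t::real)"
  shows "disjoint_family (\<lambda>j. annulus (4 ^ j * t) :: 'a::euclidean_space set)"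
  unfolding disjoint_family_on_def
proof (intro ballI impI)
  fix i j :: nat assume ij: "i \<noteq> j"
  have False if "x \<in> annulus (4 ^ i * t)" "x \<in> annulus (4 ^ j * t)" for x :: 'a
  proof (cases "i < j")
    case True
    show ?thesis
      by (rule disjoint_annuli_aux[OF assms True, of "norm x"]) (use that in \<open>simp_all add: annulus_def\<close>)
  next
    case False
    then have "j < i" using ij by simp
    show ?thesis
      by (rule disjoint_annuli_aux[OF assms \<open>j < i\<close>, of "norm x"]) (use that in \<open>simp_all add: annulus_def\<close>)
  qed
  then show "annulus (4 ^ i * t) \<inter> (annulus (4 ^ j * t) :: 'a set) = {}" by blast
qed

lemma disjoint_annuli_down_aux:
  assumes "0 < (t::real)" "i < j" "t / 4 ^ i < x" "x \<le> 4 * (t / 4 ^ i)" "t / 4 ^ j < x" "x \<le> 4 * (t / 4 ^ j)"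
  shows False
proof -
  have "(4::real) ^ Suc i \<le> 4 ^ j" using assms(2) by (intro power_increasing) auto
  then have "t / 4 ^ j \<le> t / 4 ^ Suc i" using assms(1) by (intro divide_left_mono) auto
  moreover have "4 * (t / 4 ^ Suc i) = t / 4 ^ i" by simp
  moreover have "0 < t / 4 ^ j" using assms(1) by simp
  ultimately show False using assms(3,6) by linarith
qed

lemma disjoint_annuli_down:
  assumes "0 < (t::real)"
  shows "disjoint_family (\<lambda>j. annulus (t / 4 ^ j) :: 'a::euclidean_space set)"
  unfolding disjoint_family_on_def
proof (intro ballI impI)
  fix i j :: nat assume ij: "i \<noteq> j"
  have False if "x \<in> annulus (t / 4 ^ i)" "x \<in> annulus (t / 4 ^ j)" for x :: 'a
  proof (cases "i < j")
    case True
    show ?thesis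
      by (rule disjoint_annuli_down_aux[OF assms True, of "norm x"]) (use that in \<open>simp_all add: annulus_def\<close>)
  next
    case False
    then have "j < i" using ij by simp
    show ?thesis
      by (rule disjoint_annuli_down_aux[OF assms \<open>j < i\<close>, of "norm x"]) (use that in \<open>simp_all add: annulus_def\<close>)
  qed
  then show "annulus (t / 4 ^ i) \<inter> (annulus (t / 4 ^ j) :: 'a set) = {}" by blast
qed

lemma frac_kernel_lower:
  fixes k :: "'a::euclidean_space"
  assumes "0 < s" "0 < norm k" "norm k \<le> R"
  shows "1 \<le> ennreal (R powr (real DIM('a) + s)) * frac_kernel s k"
proof -
  have "norm k powr (real DIM('a) + s) \<le> R powr (real DIM('a) + s)"
    using assms by (intro powr_mono2) auto
  then have "1 \<le> R powr (real DIM('a) + s) * norm k powr - (real DIM('a) + s)"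
    unfolding powr_minus using assms by (simp add: field_simps)
  then show ?thesis
    unfolding frac_kernel_def by (simp add: ennreal_mult[symmetric] ennreal_1[symmetric] del: ennreal_1)
qed

lemma frac_kernel_upper:
  fixes k :: "'a::euclidean_space"
  assumes "0 < s" "0 < r" "r \<le> norm k"
  shows "frac_kernel s k \<le> ennreal (r powr - (real DIM('a) + s))"
  unfolding frac_kernel_def using assms by (intro ennreal_leI powr_mono2') auto

lemma four_pow_powr: "(4 ^ j) powr r = ((4::real) powr r) ^ j"
  by (subst powr_realpow[symmetric], simp, simp add: powr_powr powr_power mult.commute)

text \<open>Average \<open>D f h \<le> D f (k + h) + D f k\<close> over all \<open>k\<close> in a ball \<open>Q\<close> of radius \<open>\<rho> / 2\<close> centred at distance
  \<open>5/2 \<rho>\<close> from the origin: both \<open>Q\<close> and \<open>Q + h\<close> lie in the annulus, where the kernel is at least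
  \<open>(4 \<rho>) powr -(N + s)\<close>.\<close>
lemma l1_modulus_annulus:
  assumes [measurable]: "f \<in> borel_measurable borel"
    and s: "0 < s" "s < 1" and \<rho>: "0 < \<rho>" and h: "norm (h::'a::euclidean_space) \<le> \<rho>"
  shows "ennreal (unit_ball_vol (real DIM('a)) / (8 * 8 ^ DIM('a)) * \<rho> powr - s) * l1_modulus f h
     \<le> (\<integral>\<^sup>+k. l1_modulus f k * frac_kernel s k * indicator (annulus \<rho>) k \<partial>lborel)" (is "_ \<le> ?\<Phi>")
proof -
  let ?N = "DIM('a)"
  define \<omega> where "\<omega> = unit_ball_vol (real ?N)"
  have \<omega>: "0 < \<omega>" by (simp add: \<omega>_def)
  define c where "c = (4 * \<rho>) powr (real ?N + s)"
  have c: "0 < c" using \<rho> by (simp add: c_def)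
  obtain b :: 'a where b: "b \<in> Basis" using nonempty_Basis by blast
  define p where "p = (5 / 2 * \<rho>) *\<^sub>R b"
  have np: "norm p = 5 / 2 * \<rho>" using b \<rho> by (simp add: p_def)
  have in1: "k \<in> annulus \<rho>" "k + h \<in> annulus \<rho>" if "k \<in> ball p (\<rho> / 2)" for k
  proof -
    have "norm (p - k) < \<rho> / 2" using that by (simp add: dist_norm)
    then have "2 * \<rho> < norm k" "norm k < 3 * \<rho>"
      using np norm_triangle_ineq2[of p k] norm_triangle_ineq3[of p k] by linarith+
    then show "k \<in> annulus \<rho>" "k + h \<in> annulus \<rho>"
      using h norm_triangle_ineq[of k h] norm_diff_ineq[of k h] by (auto simp: annulus_def)
  qed
  have ptw: "l1_modulus f k \<le> ennreal c * (l1_modulus f k * frac_kernel s k)" if "k \<in> annulus \<rho>" for k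
  proof -
    have "1 * l1_modulus f k \<le> (ennreal c * frac_kernel s k) * l1_modulus f k"
      unfolding c_def using that \<rho> s by (intro mult_right_mono frac_kernel_lower) (auto simp: annulus_def)
    then show ?thesis by (simp add: mult_ac)
  qed
  have "l1_modulus f h * emeasure lborel (ball p (\<rho> / 2)) = (\<integral>\<^sup>+k. l1_modulus f h * indicator (ball p (\<rho> / 2)) k \<partial>lborel)"
    by (subst nn_integral_cmult_indicator) simp_all
  also have "\<dots> \<le> (\<integral>\<^sup>+k. ennreal c * (l1_modulus f (k + h) * frac_kernel s (k + h) * indicator (annulus \<rho>) (k + h))
       + ennreal c * (l1_modulus f k * frac_kernel s k * indicator (annulus \<rho>) k) \<partial>lborel)"
  proof (rule nn_integral_mono)
    fix k :: 'a
    show "l1_modulus f h * indicator (ball p (\<rho> / 2)) k \<le> ennreal c * (l1_modulus f (k + h) * frac_kernel s (k + h) * indicator (annulus \<rho>) (k + h))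
       + ennreal c * (l1_modulus f k * frac_kernel s k * indicator (annulus \<rho>) k)"
    proof (cases "k \<in> ball p (\<rho> / 2)")
      case True
      have "l1_modulus f h = l1_modulus f ((k + h) + (- k))" by simp
      also have "\<dots> \<le> l1_modulus f (k + h) + l1_modulus f k"
        using l1_modulus_add[OF assms(1), of "k + h" "- k"] l1_modulus_minus[OF assms(1), of k] by simp
      also have "\<dots> \<le> ennreal c * (l1_modulus f (k + h) * frac_kernel s (k + h)) + ennreal c * (l1_modulus f k * frac_kernel s k)"
        using in1[OF True] by (intro add_mono ptw) auto
      finally show ?thesis using True in1[OF True] by simp
    qed simp
  qed
  also have "\<dots> = ennreal c * (\<integral>\<^sup>+k. l1_modulus f (k + h) * frac_kernel s (k + h) * indicator (annulus \<rho>) (k + h) \<partial>lborel) + ennreal c * ?\<Phi>"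
    by (subst nn_integral_add) (auto simp: nn_integral_cmult)
  also have "(\<integral>\<^sup>+k. l1_modulus f (k + h) * frac_kernel s (k + h) * indicator (annulus \<rho>) (k + h) \<partial>lborel) = ?\<Phi>"
    by (rule nn_integral_translate) measurable
  also have "ennreal c * ?\<Phi> + ennreal c * ?\<Phi> = ennreal (2 * c) * ?\<Phi>"
    using c by (simp add: distrib_right[symmetric] ennreal_plus[symmetric] del: ennreal_plus)
  finally have main: "l1_modulus f h * ennreal (\<omega> * (\<rho> / 2) ^ ?N) \<le> ennreal (2 * c) * ?\<Phi>"
    using \<rho> by (simp add: emeasure_ball_dim \<omega>_def)
  have "ennreal (\<omega> / (8 * 8 ^ ?N) * \<rho> powr - s) * l1_modulus f h
     \<le> ennreal (1 / (2 * c)) * (l1_modulus f h * ennreal (\<omega> * (\<rho> / 2) ^ ?N))"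
  proof -
    have "2 * c = 2 * 4 powr s * 4 ^ ?N * \<rho> ^ ?N * \<rho> powr s"
      using \<rho> by (simp add: c_def powr_mult powr_add powr_realpow)
    moreover have "4 powr s \<le> (4::real)" using s powr_mono[of s 1 "4::real"] by simp
    ultimately have "2 * c \<le> 8 * 4 ^ ?N * \<rho> ^ ?N * \<rho> powr s"
      using \<rho> by (simp add: mult_right_mono)
    then have "\<omega> / (8 * 8 ^ ?N) * \<rho> powr - s * (2 * c) \<le> \<omega> / (8 * 8 ^ ?N) * \<rho> powr - s * (8 * 4 ^ ?N * \<rho> ^ ?N * \<rho> powr s)"
      using \<omega> \<rho> by (intro mult_left_mono) auto
    also have "\<dots> = \<omega> * (\<rho> / 2) ^ ?N"
    proof -
      have e: "(8::real) ^ ?N = 4 ^ ?N * 2 ^ ?N" by (simp add: power_mult_distrib[symmetric])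
      show ?thesis using \<rho> by (simp add: e powr_minus field_simps)
    qed
    finally have "\<omega> / (8 * 8 ^ ?N) * \<rho> powr - s \<le> 1 / (2 * c) * (\<omega> * (\<rho> / 2) ^ ?N)"
      using c by (simp add: field_simps)
    then have "ennreal (\<omega> / (8 * 8 ^ ?N) * \<rho> powr - s) * l1_modulus f h \<le> ennreal (1 / (2 * c) * (\<omega> * (\<rho> / 2) ^ ?N)) * l1_modulus f h"
      by (intro mult_right_mono ennreal_leI) auto
    also have "\<dots> = ennreal (1 / (2 * c)) * (l1_modulus f h * ennreal (\<omega> * (\<rho> / 2) ^ ?N))"
      using c \<omega> \<rho> by (subst ennreal_mult) (simp_all add: mult_ac)
    finally show ?thesis .
  qed
  also have "\<dots> \<le> ennreal (1 / (2 * c)) * (ennreal (2 * c) * ?\<Phi>)"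
    by (intro mult_left_mono main) simp
  also have "\<dots> = ?\<Phi>"
    using c by (simp add: mult.assoc[symmetric] ennreal_mult[symmetric])
  finally show ?thesis by (simp add: \<omega>_def)
qed

text \<open>Both estimates sum the one-scale estimate over disjoint annuli. In the first the annuli grow and \<open>h\<close> is
  fixed, so the terms decay like \<open>4 powr -s\<close> per step. In the second the annuli shrink; there
  \<open>D f (h / 4^j) \<ge> D f h / 4^j\<close> by subadditivity, and the terms decay like \<open>4 powr -(1 - s)\<close>.\<close>
lemma l1_modulus_le_gagliardo_aux:
  assumes [measurable]: "f \<in> borel_measurable borel"
    and s: "0 < s" "s < 1" and h: "(h::'a::euclidean_space) \<noteq> 0"
  defines "a \<equiv> unit_ball_vol (real DIM('a)) / (8 * 8 ^ DIM('a))"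
  shows "ennreal (a * norm h powr - s / (3 * s)) * l1_modulus f h \<le> gagliardo s f"
    and "ennreal (a * norm h powr - s / (3 * (1 - s))) * l1_modulus f h \<le> gagliardo s f"
proof -
  define t where "t = norm h"
  have t: "0 < t" using h by (simp add: t_def)
  have a: "0 < a" by (simp add: a_def)
  have c0: "0 \<le> a * t powr - s" using a by simp
  let ?I = "\<lambda>A. \<integral>\<^sup>+k. l1_modulus f k * frac_kernel s k * indicator A k \<partial>lborel"
  have "ennreal (a * t powr - s / (3 * s)) * l1_modulus f h \<le> ennreal (a * t powr - s / (1 - 4 powr - s)) * l1_modulus f h"
    using four_powr_bounds[OF s] s a t by (intro mult_right_mono ennreal_leI divide_left_mono) auto
  also have "\<dots> = (\<Sum>j. ennreal (a * t powr - s * (4 powr - s) ^ j) * l1_modulus f h)"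
    unfolding ennreal_suminf_multc suminf_geometric_powr[OF s c0] ..
  also have "\<dots> \<le> (\<Sum>j. ?I (annulus (4 ^ j * t)))"
  proof (rule suminf_le)
    fix j :: nat
    have r: "0 < 4 ^ j * t" "norm h \<le> 4 ^ j * t" using t by (simp_all add: t_def)
    have "(4 ^ j * t) powr - s = t powr - s * (4 powr - s) ^ j"
      using t by (simp add: powr_mult four_pow_powr mult.commute)
    with l1_modulus_annulus[OF assms(1) s r]
    show "ennreal (a * t powr - s * (4 powr - s) ^ j) * l1_modulus f h \<le> ?I (annulus (4 ^ j * t))"
      by (simp add: a_def mult_ac)
  qed auto
  also have "\<dots> \<le> gagliardo s f"
    unfolding gagliardo_l1_modulus[OF assms(1)]
    using t by (intro suminf_set_integral_le disjoint_annuli_up) auto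
  finally show "ennreal (a * norm h powr - s / (3 * s)) * l1_modulus f h \<le> gagliardo s f"
    by (simp add: t_def)
  have s': "0 < 1 - s" "1 - s < 1" using s by auto
  have "ennreal (a * t powr - s / (3 * (1 - s))) * l1_modulus f h \<le> ennreal (a * t powr - s / (1 - 4 powr - (1 - s))) * l1_modulus f h"
    using four_powr_bounds[OF s'] s a t by (intro mult_right_mono ennreal_leI divide_left_mono) auto
  also have "\<dots> = (\<Sum>j. ennreal (a * t powr - s * (4 powr - (1 - s)) ^ j) * l1_modulus f h)"
    unfolding ennreal_suminf_multc suminf_geometric_powr[OF s' c0] ..
  also have "\<dots> \<le> (\<Sum>j. ?I (annulus (t / 4 ^ j)))"
  proof (rule suminf_le)
    fix j :: nat
    define k where "k = (1 / 4 ^ j) *\<^sub>R h"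
    have r: "0 < t / 4 ^ j" "norm k \<le> t / 4 ^ j" using t by (simp_all add: t_def k_def)
    have hk: "l1_modulus f h \<le> ennreal (4 ^ j) * l1_modulus f k"
      using l1_modulus_multiple[OF assms(1), of "4 ^ j" k] by (simp add: k_def)
    have e: "t powr - s * (4 powr - (1 - s)) ^ j * 4 ^ j = (t / 4 ^ j) powr - s"
    proof -
      have "(4 powr - (1 - s)) ^ j * 4 ^ j = (4 powr s :: real) ^ j"
      proof -
        have "4 powr - (1 - s) * 4 = (4 powr s :: real)" by (simp add: powr_diff)
        then show ?thesis by (simp only: power_mult_distrib[symmetric])
      qed
      moreover have "(t / 4 ^ j) powr - s = t powr - s * (4 powr s) ^ j"
      proof -
        have "(t / 4 ^ j) powr - s = t powr - s / (4 ^ j) powr - s"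
          by (rule powr_divide)
        also have "(4 ^ j) powr - s = inverse (4 powr s) ^ j"
          by (simp only: four_pow_powr powr_minus power_inverse)
        finally show ?thesis by (simp only: power_inverse divide_inverse inverse_inverse_eq)
      qed
      ultimately show ?thesis by (simp add: mult.assoc)
    qed
    have "ennreal (a * t powr - s * (4 powr - (1 - s)) ^ j) * l1_modulus f h
       \<le> ennreal (a * t powr - s * (4 powr - (1 - s)) ^ j) * (ennreal (4 ^ j) * l1_modulus f k)"
      by (intro mult_left_mono hk) simp
    also have "\<dots> = ennreal (a * t powr - s * (4 powr - (1 - s)) ^ j * 4 ^ j) * l1_modulus f k"
      using a by (subst mult.assoc[symmetric], subst ennreal_mult[symmetric]) simp_all
    also have "\<dots> = ennreal (a * (t / 4 ^ j) powr - s) * l1_modulus f k"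
      using e by (simp add: mult.assoc)
    also have "\<dots> \<le> ?I (annulus (t / 4 ^ j))"
      using l1_modulus_annulus[OF assms(1) s r] by (simp add: a_def)
    finally show "ennreal (a * t powr - s * (4 powr - (1 - s)) ^ j) * l1_modulus f h \<le> ?I (annulus (t / 4 ^ j))" .
  qed auto
  also have "\<dots> \<le> gagliardo s f"
    unfolding gagliardo_l1_modulus[OF assms(1)]
    using t by (intro suminf_set_integral_le disjoint_annuli_down) auto
  finally show "ennreal (a * norm h powr - s / (3 * (1 - s))) * l1_modulus f h \<le> gagliardo s f"
    by (simp add: t_def)
qed

text \<open>The minimum of \<open>s\<close> and \<open>1 - s\<close> is at most \<open>2 s (1 - s)\<close>, so the two estimates combine into one whose
  constant has the right behaviour at both ends of the range of \<open>s\<close>.\<close>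
lemma l1_modulus_le_gagliardo:
  "\<exists>C>0. \<forall>s\<in>{0<..<1}. \<forall>f\<in>borel_measurable borel. \<forall>h::'a::euclidean_space.
     l1_modulus f h \<le> ennreal (C * (s * (1 - s)) * norm h powr s) * gagliardo s f"
proof -
  define a where "a = unit_ball_vol (real DIM('a)) / (8 * 8 ^ DIM('a))"
  have a: "0 < a" by (simp add: a_def)
  have *: "l1_modulus f h \<le> ennreal (6 / a * (s * (1 - s)) * norm h powr s) * gagliardo s f"
    if s: "0 < s" "s < 1" and f: "f \<in> borel_measurable borel" for s f and h :: 'a
  proof (cases "h = 0")
    case True
    then show ?thesis by (simp add: l1_modulus_def)
  next
    case False
    \<comment> \<open>The two estimates of the auxiliary lemma carry the factors s and 1 - s; the better one applies.\<close>
    define m where "m = min s (1 - s)"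
    have m: "0 < m" using s by (simp add: m_def)
    have "m \<le> 2 * (s * (1 - s))"
    proof (cases "s \<le> 1 / 2")
      case True
      then have "s * (1 / 2) \<le> s * (1 - s)" using s by (intro mult_left_mono) auto
      then show ?thesis by (simp add: m_def)
    next
      case False
      then have "(1 / 2) * (1 - s) \<le> s * (1 - s)" using s by (intro mult_right_mono) auto
      then show ?thesis by (simp add: m_def)
    qed
    define d where "d = 3 * m / a * norm h powr s"
    have d: "0 < d" using m a False by (simp add: d_def)
    have e: "1 / d = a * norm h powr - s / (3 * m)"
      unfolding d_def powr_minus by (simp add: divide_simps)
    have "ennreal (1 / d) * l1_modulus f h \<le> gagliardo s f"
    proof (cases "s \<le> 1 - s")
      case True
      then have "m = s" by (simp add: m_def)
      then show ?thesis using l1_modulus_le_gagliardo_aux(1)[OF f s False]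
        unfolding e a_def by simp
    next
      case False': False
      then have "m = 1 - s" by (simp add: m_def)
      then show ?thesis using l1_modulus_le_gagliardo_aux(2)[OF f s False]
        unfolding e a_def by simp
    qed
    then have "ennreal d * (ennreal (1 / d) * l1_modulus f h) \<le> ennreal d * gagliardo s f"
      by (intro mult_left_mono) auto
    then have "l1_modulus f h \<le> ennreal d * gagliardo s f"
      using d by (simp add: mult.assoc[symmetric] ennreal_mult[symmetric])
    also have "\<dots> \<le> ennreal (6 / a * (s * (1 - s)) * norm h powr s) * gagliardo s f"
    proof (intro mult_right_mono ennreal_leI)
      show "d \<le> 6 / a * (s * (1 - s)) * norm h powr s"
      proof -
        have "d = m * (3 / a * norm h powr s)" by (simp add: d_def)
        also have "\<dots> \<le> 2 * (s * (1 - s)) * (3 / a * norm h powr s)"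
          using \<open>m \<le> 2 * (s * (1 - s))\<close> a by (intro mult_right_mono) auto
        also have "\<dots> = 6 / a * (s * (1 - s)) * norm h powr s" by (simp only: mult_ac times_divide_eq_left times_divide_eq_right)
        finally show ?thesis .
      qed
    qed simp
    finally show ?thesis .
  qed
  show ?thesis
    by (rule exI[of _ "6 / a"]) (use a * in auto)
qed

section \<open>Integrals of the kernel\<close>

lemma annuli_cover_up:
  assumes "0 < (t::real)" "t < norm (h::'a::euclidean_space)"
  shows "\<exists>j. h \<in> annulus (4 ^ j * t)"
proof -
  define P where "P = (\<lambda>j::nat. norm h \<le> 4 * (4 ^ j * t))"
  obtain n where n: "norm h / t < 4 ^ n" using real_arch_pow[of "4::real"] by auto
  have "norm h < 4 ^ n * t" using n assms(1) by (simp add: divide_less_eq)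
  moreover have "0 < 4 ^ n * t" using assms(1) by simp
  ultimately have "P n" unfolding P_def by linarith
  then have P: "P (LEAST j. P j)" by (rule LeastI)
  show ?thesis
  proof (cases "(LEAST j. P j) = 0")
    case True
    then have "P 0" using P by simp
    then show ?thesis using assms by (intro exI[of _ 0]) (simp add: P_def annulus_def)
  next
    case False
    then obtain i where i: "(LEAST j. P j) = Suc i" using not0_implies_Suc by blast
    then have "\<not> P i" by (metis lessI not_less_Least)
    then have "4 ^ Suc i * t < norm h" by (simp add: P_def)
    then show ?thesis using P i by (intro exI[of _ "Suc i"]) (simp add: P_def annulus_def)
  qed
qed

lemma annuli_cover_down:
  assumes "0 < (t::real)" "norm (h::'a::euclidean_space) \<le> t" "h \<noteq> 0"
  shows "\<exists>j. h \<in> annulus (t / 4 ^ Suc j)"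
proof -
  define P where "P = (\<lambda>j::nat. t / 4 ^ Suc j < norm h)"
  obtain n where n: "t / norm h < 4 ^ n" using real_arch_pow[of "4::real"] by auto
  have "t < 4 ^ n * norm h" using n assms by (simp add: divide_less_eq)
  also have "\<dots> \<le> 4 ^ Suc n * norm h" using assms by simp
  finally have "P n" unfolding P_def using assms by (simp add: divide_less_eq mult.commute)
  then have P: "P (LEAST j. P j)" by (rule LeastI)
  show ?thesis
  proof (cases "(LEAST j. P j) = 0")
    case True
    then have "P 0" using P by simp
    then show ?thesis using assms by (intro exI[of _ 0]) (simp add: P_def annulus_def)
  next
    case False
    then obtain i where i: "(LEAST j. P j) = Suc i" using not0_implies_Suc by blast
    then have "\<not> P i" by (metis lessI not_less_Least)
    then have "norm h \<le> t / 4 ^ Suc i" by (simp add: P_def)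
    then show ?thesis using P i by (intro exI[of _ "Suc i"]) (simp add: P_def annulus_def)
  qed
qed

lemma nn_integral_annulus_le:
  fixes F :: "'a::euclidean_space \<Rightarrow> ennreal"
  assumes s: "0 < s" "s < 1" and \<rho>: "0 < \<rho>" and c: "0 \<le> c"
    and F: "\<And>k. k \<in> annulus \<rho> \<Longrightarrow> F k \<le> ennreal c * frac_kernel s k"
  shows "(\<integral>\<^sup>+k. F k * indicator (annulus \<rho>) k \<partial>lborel)
     \<le> ennreal (unit_ball_vol (real DIM('a)) * 4 ^ DIM('a) * c * \<rho> powr - s)"
proof -
  let ?N = "DIM('a)"
  define \<omega> where "\<omega> = unit_ball_vol (real ?N)"
  have \<omega>: "0 < \<omega>" by (simp add: \<omega>_def)
  have "(\<integral>\<^sup>+k. F k * indicator (annulus \<rho>) k \<partial>lborel)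
     \<le> (\<integral>\<^sup>+k. ennreal (c * \<rho> powr - (real ?N + s)) * indicator (cball 0 (4 * \<rho>)) (k::'a) \<partial>lborel)"
  proof (rule nn_integral_mono)
    fix k :: 'a
    show "F k * indicator (annulus \<rho>) k \<le> ennreal (c * \<rho> powr - (real ?N + s)) * indicator (cball 0 (4 * \<rho>)) k"
    proof (cases "k \<in> annulus \<rho>")
      case True
      then have k: "\<rho> \<le> norm k" "k \<in> cball 0 (4 * \<rho>)" by (auto simp: annulus_def)
      have "F k \<le> ennreal c * frac_kernel s k" by (rule F[OF True])
      also have "\<dots> \<le> ennreal c * ennreal (\<rho> powr - (real ?N + s))"
        by (intro mult_left_mono frac_kernel_upper s \<rho> k) simp
      also have "\<dots> = ennreal (c * \<rho> powr - (real ?N + s))" using c by (simp add: ennreal_mult)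
      finally show ?thesis using True k by simp
    qed simp
  qed
  also have "\<dots> = ennreal (c * \<rho> powr - (real ?N + s)) * emeasure lborel (cball (0::'a) (4 * \<rho>))"
    by (subst nn_integral_cmult_indicator) simp_all
  also have "\<dots> = ennreal (c * \<rho> powr - (real ?N + s) * (\<omega> * (4 * \<rho>) ^ ?N))"
    using \<rho> c \<omega> by (simp add: emeasure_ball_dim \<omega>_def[symmetric] ennreal_mult[symmetric])
  also have "c * \<rho> powr - (real ?N + s) * (\<omega> * (4 * \<rho>) ^ ?N) = \<omega> * 4 ^ ?N * c * \<rho> powr - s"
  proof -
    have "\<rho> powr - (real ?N + s) = \<rho> powr - s / \<rho> ^ ?N"
      using \<rho> by (simp add: powr_minus powr_add powr_realpow divide_inverse powr_diff)
    then show ?thesis using \<rho> by (simp add: power_mult_distrib)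
  qed
  finally show ?thesis by (simp add: \<omega>_def)
qed

text \<open>The annuli outside the ball of radius \<open>\<delta>\<close> use the bound 1 for the minimum and sum to \<open>1 / s\<close>; those inside
  use \<open>norm h / \<delta>\<close>, which weakens the singularity by one power, and sum to \<open>1 / (1 - s)\<close>.\<close>
lemma nn_integral_min_frac_kernel:
  "\<exists>C>0. \<forall>s\<in>{0<..<1}. \<forall>\<delta>>0.
     (\<integral>\<^sup>+h. ennreal (min 1 (norm h / \<delta>)) * frac_kernel s (h::'a::euclidean_space) \<partial>lborel)
       \<le> ennreal (C * \<delta> powr - s / (s * (1 - s)))"
proof -
  let ?N = "DIM('a)"
  define w where "w = unit_ball_vol (real ?N) * 4 ^ ?N"
  have w: "0 < w" by (simp add: w_def)
  have *: "(\<integral>\<^sup>+h. ennreal (min 1 (norm h / \<delta>)) * frac_kernel s (h::'a::euclidean_space) \<partial>lborel)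
       \<le> ennreal (8 * w * \<delta> powr - s / (s * (1 - s)))"
    if s: "0 < s" "s < 1" and \<delta>: "0 < \<delta>" for s \<delta>
  proof -
    define F where "F = (\<lambda>h::'a. ennreal (min 1 (norm h / \<delta>)) * frac_kernel s h)"
    have [measurable]: "F \<in> borel_measurable borel" unfolding F_def by measurable
    have s': "0 < 1 - s" "1 - s < 1" using s by auto
    have up: "(\<integral>\<^sup>+k. F k * indicator (annulus (4 ^ j * \<delta>)) k \<partial>lborel) \<le> ennreal (w * \<delta> powr - s * (4 powr - s) ^ j)" for j
    proof -
      have "(\<integral>\<^sup>+k. F k * indicator (annulus (4 ^ j * \<delta>)) k \<partial>lborel) \<le> ennreal (w * 1 * (4 ^ j * \<delta>) powr - s)"
        unfolding w_def
      proof (rule nn_integral_annulus_le[OF s])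
        show "F k \<le> ennreal 1 * frac_kernel s k" for k
          unfolding F_def by (intro mult_right_mono ennreal_leI) auto
      qed (use \<delta> in auto)
      also have "w * 1 * (4 ^ j * \<delta>) powr - s = w * \<delta> powr - s * (4 powr - s) ^ j"
        by (simp only: powr_mult four_pow_powr mult_ac mult_1_left)
      finally show ?thesis .
    qed
    have down: "(\<integral>\<^sup>+k. F k * indicator (annulus (\<delta> / 4 ^ Suc j)) k \<partial>lborel)
       \<le> ennreal (4 * w * \<delta> powr - s * (4 powr - (1 - s)) ^ j)" for j
    proof -
      have "(\<integral>\<^sup>+k. F k * indicator (annulus (\<delta> / 4 ^ Suc j)) k \<partial>lborel)
         \<le> ennreal (w * (1 / 4 ^ j) * (\<delta> / 4 ^ Suc j) powr - s)"
        unfolding w_def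
      proof (rule nn_integral_annulus_le[OF s])
        fix k :: 'a assume "k \<in> annulus (\<delta> / 4 ^ Suc j)"
        then have "norm k \<le> 4 * (\<delta> / 4 ^ Suc j)" by (simp only: annulus_def mem_Collect_eq)
        then have "norm k / \<delta> \<le> 1 / 4 ^ j" using \<delta> by (simp add: field_simps)
        then show "F k \<le> ennreal (1 / 4 ^ j) * frac_kernel s k"
          unfolding F_def by (intro mult_right_mono ennreal_leI) auto
      qed (use \<delta> in auto)
      also have "w * (1 / 4 ^ j) * (\<delta> / 4 ^ Suc j) powr - s = w * \<delta> powr - s * (4 powr s * (4 powr - (1 - s)) ^ j)"
      proof -
        have "(\<delta> / 4 ^ Suc j) powr - s = \<delta> powr - s / (4 ^ Suc j) powr - s" by (rule powr_divide)
        also have "(4 ^ Suc j) powr - s = inverse ((4 powr s) ^ Suc j)"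
          by (simp only: four_pow_powr powr_minus power_inverse)
        finally have e: "(\<delta> / 4 ^ Suc j) powr - s = \<delta> powr - s * (4 powr s) ^ Suc j"
          by (simp only: divide_inverse inverse_inverse_eq)
        have "4 powr - (1 - s) = 4 powr s / (4::real)" by (simp add: powr_diff)
        then have e2: "(4 powr - (1 - s)) ^ j = (4 powr s) ^ j / (4::real) ^ j"
          by (simp only: power_divide)
        show ?thesis unfolding e e2 by simp
      qed
      also have "ennreal \<dots> \<le> ennreal (4 * w * \<delta> powr - s * (4 powr - (1 - s)) ^ j)"
      proof (rule ennreal_leI)
        have "4 powr s \<le> (4::real)" using s powr_mono[of s 1 "4::real"] by simp
        then have "w * \<delta> powr - s * (4 powr s * (4 powr - (1 - s)) ^ j) \<le> w * \<delta> powr - s * (4 * (4 powr - (1 - s)) ^ j)"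
          using w by (intro mult_left_mono mult_right_mono) auto
        then show "w * \<delta> powr - s * (4 powr s * (4 powr - (1 - s)) ^ j) \<le> 4 * w * \<delta> powr - s * (4 powr - (1 - s)) ^ j"
          by (simp only: mult_ac)
      qed
      finally show ?thesis .
    qed
    have "(\<integral>\<^sup>+h. F h \<partial>lborel)
       \<le> (\<integral>\<^sup>+h. (\<Sum>j. F h * indicator (annulus (4 ^ j * \<delta>)) h) + (\<Sum>j. F h * indicator (annulus (\<delta> / 4 ^ Suc j)) h) \<partial>lborel)"
    proof (rule nn_integral_mono)
      fix h :: 'a
      show "F h \<le> (\<Sum>j. F h * indicator (annulus (4 ^ j * \<delta>)) h) + (\<Sum>j. F h * indicator (annulus (\<delta> / 4 ^ Suc j)) h)"
      proof (cases "h = 0")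
        case True
        then show ?thesis by (simp add: F_def frac_kernel_def)
      next
        case h: False
        show ?thesis
        proof (cases "\<delta> < norm h")
          case True
          obtain j where "h \<in> annulus (4 ^ j * \<delta>)" using annuli_cover_up[OF \<delta> True] by blast
          then have "F h = (\<Sum>i\<in>{j}. F h * indicator (annulus (4 ^ i * \<delta>)) h)" by simp
          also have "\<dots> \<le> (\<Sum>j. F h * indicator (annulus (4 ^ j * \<delta>)) h)"
            by (rule sum_le_suminf) auto
          finally show ?thesis by (rule order_trans) simp
        next
          case False
          then obtain j where "h \<in> annulus (\<delta> / 4 ^ Suc j)" using annuli_cover_down[OF \<delta> _ h] by auto
          then have "F h = (\<Sum>i\<in>{j}. F h * indicator (annulus (\<delta> / 4 ^ Suc i)) h)" by simp
          also have "\<dots> \<le> (\<Sum>j. F h * indicator (annulus (\<delta> / 4 ^ Suc j)) h)"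
            by (rule sum_le_suminf) auto
          finally show ?thesis by (rule order_trans) simp
        qed
      qed
    qed
    also have "\<dots> = (\<Sum>j. \<integral>\<^sup>+h. F h * indicator (annulus (4 ^ j * \<delta>)) h \<partial>lborel)
        + (\<Sum>j. \<integral>\<^sup>+h. F h * indicator (annulus (\<delta> / 4 ^ Suc j)) h \<partial>lborel)"
    proof -
      define A B where "A = (\<lambda>j (h::'a). F h * indicator (annulus (4 ^ j * \<delta>)) h)"
        and "B = (\<lambda>j (h::'a). F h * indicator (annulus (\<delta> / 4 ^ Suc j)) h)"
      have [measurable]: "A j \<in> borel_measurable borel" "B j \<in> borel_measurable borel" for j
        unfolding A_def B_def by measurable
      have "(\<integral>\<^sup>+h. (\<Sum>j. A j h) + (\<Sum>j. B j h) \<partial>lborel) = (\<integral>\<^sup>+h. (\<Sum>j. A j h) \<partial>lborel) + (\<integral>\<^sup>+h. (\<Sum>j. B j h) \<partial>lborel)"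
        by (rule nn_integral_add) measurable
      also have "\<dots> = (\<Sum>j. \<integral>\<^sup>+h. A j h \<partial>lborel) + (\<Sum>j. \<integral>\<^sup>+h. B j h \<partial>lborel)"
        by (subst (1 2) nn_integral_suminf) auto
      finally show ?thesis by (simp only: A_def B_def)
    qed
    also have "\<dots> \<le> (\<Sum>j. ennreal (w * \<delta> powr - s * (4 powr - s) ^ j)) + (\<Sum>j. ennreal (4 * w * \<delta> powr - s * (4 powr - (1 - s)) ^ j))"
      by (intro add_mono suminf_le up down) auto
    also have "\<dots> = ennreal (w * \<delta> powr - s / (1 - 4 powr - s)) + ennreal (4 * w * \<delta> powr - s / (1 - 4 powr - (1 - s)))"
      using suminf_geometric_powr[OF s, of "w * \<delta> powr - s"] suminf_geometric_powr[OF s', of "4 * w * \<delta> powr - s"] w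
      by (simp only: mult_nonneg_nonneg powr_ge_zero less_imp_le zero_le_numeral)
    also have "\<dots> \<le> ennreal (w * \<delta> powr - s / (s / 2)) + ennreal (4 * w * \<delta> powr - s / ((1 - s) / 2))"
      using four_powr_bounds[OF s] four_powr_bounds[OF s'] s w
      by (intro add_mono ennreal_leI divide_left_mono mult_pos_pos) auto
    also have "\<dots> = ennreal (w * \<delta> powr - s / (s / 2) + 4 * w * \<delta> powr - s / ((1 - s) / 2))"
      using s w by (intro ennreal_plus[symmetric]) auto
    also have "\<dots> \<le> ennreal (8 * w * \<delta> powr - s / (s * (1 - s)))"
    proof (rule ennreal_leI)
      define W where "W = w * \<delta> powr - s"
      have W: "0 \<le> W" using w by (simp add: W_def)
      have "W / (s / 2) + 4 * W / ((1 - s) / 2) = W * (2 * (1 - s) + 8 * s) / (s * (1 - s))"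
        using s by (simp add: field_simps)
      also have "\<dots> \<le> W * 8 / (s * (1 - s))"
        using s W by (intro divide_right_mono mult_left_mono) auto
      finally show "w * \<delta> powr - s / (s / 2) + 4 * w * \<delta> powr - s / ((1 - s) / 2) \<le> 8 * w * \<delta> powr - s / (s * (1 - s))"
        by (simp add: W_def mult_ac)
    qed
    finally show ?thesis by (simp only: F_def)
  qed
  show ?thesis
    by (rule exI[of _ "8 * w"]) (use w * in auto)
qed

section \<open>Smooth functions, convolution and mollifiers\<close>

lemma Ck_on_const: "Ck_on k S (\<lambda>x. c)"
  by (induction k arbitrary: c) (simp_all add: frechet_derivative_const)

lemma Ck_on_SucI:
  assumes "\<And>x. (f has_derivative f' x) (at x)" "\<And>v. Ck_on k UNIV (\<lambda>x. f' x v)"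
  shows "Ck_on (Suc k) UNIV f"
proof -
  have "frechet_derivative f (at x) = f' x" for x
    using frechet_derivative_at[OF assms(1)] by simp
  then show ?thesis using assms by (auto simp: differentiable_def)
qed

lemma Ck_on_Suc_D:
  assumes "Ck_on (Suc k) UNIV f"
  shows "(f has_derivative frechet_derivative f (at x)) (at x)" "Ck_on k UNIV (\<lambda>x. frechet_derivative f (at x) v)"
  using assms by (auto simp: frechet_derivative_works[symmetric])

lemma Ck_on_Suc_imp: "Ck_on (Suc k) UNIV f \<Longrightarrow> Ck_on k UNIV f"
proof (induction k arbitrary: f)
  case 0
  then show ?case
    by (auto intro!: continuous_at_imp_continuous_on differentiable_imp_continuous_within)
next
  case (Suc k)
  show ?case
    by (rule Ck_on_SucI[OF Ck_on_Suc_D(1)[OF Suc.prems]]) (intro Suc.IH Ck_on_Suc_D(2)[OF Suc.prems])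
qed

lemma Ck_on_mono: "Ck_on n UNIV f \<Longrightarrow> k \<le> n \<Longrightarrow> Ck_on k UNIV f"
  by (induction n arbitrary: f) (auto simp: le_Suc_eq simp del: Ck_on.simps dest: Ck_on_Suc_imp)

lemma Ck_on_subset: "Ck_on k UNIV f \<Longrightarrow> Ck_on k S f"
  by (induction k arbitrary: f) (auto intro: continuous_on_subset)

lemma Ck_on_add:
  assumes "Ck_on k UNIV f" "Ck_on k UNIV g"
  shows "Ck_on k UNIV (\<lambda>x. f x + g x)"
  using assms
proof (induction k arbitrary: f g)
  case 0
  then show ?case by (auto intro: continuous_intros)
next
  case (Suc k)
  show ?case
    by (rule Ck_on_SucI[OF has_derivative_add[OF Ck_on_Suc_D(1)[OF Suc.prems(1)] Ck_on_Suc_D(1)[OF Suc.prems(2)]]])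
       (intro Suc.IH Ck_on_Suc_D(2)[OF Suc.prems(1)] Ck_on_Suc_D(2)[OF Suc.prems(2)])
qed

lemma Ck_on_mult:
  assumes "Ck_on k UNIV f" "Ck_on k UNIV g"
  shows "Ck_on k UNIV (\<lambda>x. f x * g x)"
  using assms
proof (induction k arbitrary: f g)
  case 0
  then show ?case by (auto intro: continuous_intros)
next
  case (Suc k)
  show ?case
    by (rule Ck_on_SucI[OF has_derivative_mult[OF Ck_on_Suc_D(1)[OF Suc.prems(1)] Ck_on_Suc_D(1)[OF Suc.prems(2)]]])
       (rule Ck_on_add; rule Suc.IH,
        rule Ck_on_Suc_imp[OF Suc.prems(1)] Ck_on_Suc_D(2)[OF Suc.prems(1)],
        rule Ck_on_Suc_imp[OF Suc.prems(2)] Ck_on_Suc_D(2)[OF Suc.prems(2)])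
qed

lemma Ck_on_inner: "Ck_on k UNIV (\<lambda>x. x \<bullet> v)"
proof (cases k)
  case 0
  then show ?thesis by (auto intro: continuous_intros)
next
  case (Suc n)
  have "((\<lambda>x. x \<bullet> v) has_derivative (\<lambda>u. u \<bullet> v)) (at x)" for x
    by (auto intro!: derivative_eq_intros)
  from Ck_on_SucI[OF this Ck_on_const] Suc show ?thesis by simp
qed

text \<open>The functions \<open>exp (-1/t) / t^n\<close>, extended by 0 to the negative half line. The derivative of each is a
  combination of two others, so that one induction over the order of differentiability treats all of them.\<close>
definition exp_flat :: "nat \<Rightarrow> real \<Rightarrow> real" where
  "exp_flat n t = (if t \<le> 0 then 0 else exp (- 1 / t) / t ^ n)"

text \<open>Keeping one term of the exponential series of \<open>exp (1 / t)\<close> gives flatness of second order at 0, which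
  yields the derivative at 0.\<close>
lemma exp_flat_bound:
  assumes "0 < t"
  shows "exp_flat n t \<le> fact (n + 2) * t ^ 2"
proof -
  have "(1 / t) ^ (n + 2) / fact (n + 2) \<le> exp (1 / t)"
  proof -
    have "summable (\<lambda>m. (1 / t) ^ m / fact m)"
      using summable_exp[of "1 / t"] by (simp add: divide_inverse mult.commute)
    then have "(\<Sum>m\<in>{n + 2}. (1 / t) ^ m / fact m) \<le> (\<Sum>m. (1 / t) ^ m / fact m)"
      using assms by (intro sum_le_suminf) auto
    also have "\<dots> = exp (1 / t)" by (simp add: exp_def divide_inverse mult.commute)
    finally show ?thesis by simp
  qed
  moreover define u F T where "u = exp (1 / t)" and "F = (fact (n + 2) :: real)" and "T = t ^ (n + 2)"
  moreover have "0 < u" "0 < F" "0 < T" unfolding u_def F_def T_def using assms by (simp_all del: fact_Suc)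
  ultimately have "1 / T / F \<le> u" by (simp only: power_one_over)
  then have "1 / u \<le> F * T" using \<open>0 < u\<close> \<open>0 < F\<close> \<open>0 < T\<close> by (simp add: field_simps)
  then have "exp (- 1 / t) \<le> fact (n + 2) * t ^ (n + 2)"
    unfolding u_def F_def T_def by (simp only: exp_minus divide_inverse minus_mult_left[symmetric] mult_1_left)
  then show ?thesis using assms by (simp add: exp_flat_def divide_le_eq power2_eq_square mult_ac del: fact_Suc)
qed

lemma exp_flat_nonneg: "0 \<le> exp_flat n t"
  by (simp add: exp_flat_def)

lemma exp_flat_has_derivative:
  "(exp_flat n has_real_derivative (exp_flat (n + 2) t - real n * exp_flat (n + 1) t)) (at t)"
proof (cases "t = 0")
  case False
  show ?thesis
  proof (cases "t < 0")
    case True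
    have "((\<lambda>_. 0) has_real_derivative 0) (at t)" by simp
    then have "(exp_flat n has_real_derivative 0) (at t)"
      by (rule has_field_derivative_transform_within_open[of _ _ _ "{..<0}"]) (use True in \<open>auto simp: exp_flat_def\<close>)
    then show ?thesis using True by (simp add: exp_flat_def)
  next
    case f: False
    then have t: "0 < t" using False by simp
    have e: "((\<lambda>t. exp (- 1 / t)) has_real_derivative exp (- 1 / t) / t ^ 2) (at t)"
      using t by (auto intro!: derivative_eq_intros simp: power2_eq_square)
    have "((\<lambda>t. exp (- 1 / t) / t ^ n) has_real_derivative
        (exp (- 1 / t) / t ^ 2 * t ^ n - exp (- 1 / t) * (real n * t ^ (n - Suc 0))) / (t ^ n * t ^ n)) (at t)"
      by (rule DERIV_divide[OF e DERIV_pow]) (use t in simp)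
    also have "(exp (- 1 / t) / t ^ 2 * t ^ n - exp (- 1 / t) * (real n * t ^ (n - Suc 0))) / (t ^ n * t ^ n)
       = exp_flat (n + 2) t - real n * exp_flat (n + 1) t"
      using t by (cases n) (simp_all add: exp_flat_def field_simps power2_eq_square)
    finally have "((\<lambda>t. exp (- 1 / t) / t ^ n) has_real_derivative exp_flat (n + 2) t - real n * exp_flat (n + 1) t) (at t)" .
    then show ?thesis
      by (rule has_field_derivative_transform_within_open[of _ _ _ "{0<..}"]) (use t in \<open>auto simp: exp_flat_def\<close>)
  qed
next
  case True
  have "(exp_flat n has_real_derivative 0) (at 0)"
    unfolding has_field_derivative_iff
  proof (rule Lim_null_comparison)
    show "\<forall>\<^sub>F y in at 0. norm ((exp_flat n y - exp_flat n 0) / (y - 0)) \<le> fact (n + 2) * \<bar>y\<bar>"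
    proof (rule always_eventually, rule allI)
      fix y :: real
      show "norm ((exp_flat n y - exp_flat n 0) / (y - 0)) \<le> fact (n + 2) * \<bar>y\<bar>"
      proof (cases "0 < y")
        case True
        have "exp_flat n y / y \<le> fact (n + 2) * y ^ 2 / y"
          using exp_flat_bound[OF True, of n] True by (intro divide_right_mono) auto
        then show ?thesis using True exp_flat_nonneg[of n y]
          by (simp add: exp_flat_def[of n 0] power2_eq_square del: fact_Suc)
      next
        case False
        then show ?thesis by (simp add: exp_flat_def mult_le_0_iff del: fact_Suc)
      qed
    qed
    have "((\<lambda>y::real. fact (n + 2) * \<bar>y\<bar>) \<longlongrightarrow> fact (n + 2) * \<bar>0\<bar>) (at 0)"
      by (intro tendsto_intros)
    then show "((\<lambda>y::real. fact (n + 2) * \<bar>y\<bar>) \<longlongrightarrow> 0) (at 0)" by simp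
  qed
  then show ?thesis using True by (simp add: exp_flat_def)
qed

text \<open>The directional derivatives are products of linear functions with functions of the same form, hence the
  induction on \<open>k\<close> with \<open>n\<close> arbitrary. For \<open>c > 0\<close> the function vanishes off a ball of radius
  \<open>1 / sqrt c\<close>.\<close>
lemma Ck_on_exp_flat_ball:
  "Ck_on k UNIV (\<lambda>x::'a::euclidean_space. exp_flat n (1 - c * (x \<bullet> x)))"
proof (induction k arbitrary: n)
  case 0
  have "continuous_on UNIV (exp_flat n)"
    using exp_flat_has_derivative DERIV_isCont by (intro continuous_at_imp_continuous_on) blast
  then have "continuous_on UNIV (exp_flat n \<circ> (\<lambda>x::'a. 1 - c * (x \<bullet> x)))"
    by (intro continuous_on_compose) (auto intro!: continuous_intros intro: continuous_on_subset)
  then show ?case by (simp add: o_def)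
next
  case (Suc k)
  have d: "((\<lambda>x. exp_flat n (1 - c * (x \<bullet> x))) has_derivative
     (\<lambda>v. (exp_flat (n + 2) (1 - c * (x \<bullet> x)) + (- real n) * exp_flat (n + 1) (1 - c * (x \<bullet> x))) * ((- 2 * c) * (x \<bullet> v)))) (at x)" for x :: 'a
  proof -
    have a: "((\<lambda>x::'a. 1 - c * (x \<bullet> x)) has_derivative (\<lambda>v. - 2 * c * (x \<bullet> v))) (at x)"
      by (auto intro!: derivative_eq_intros simp: inner_commute)
    have "(exp_flat n has_derivative (*) (exp_flat (n + 2) (1 - c * (x \<bullet> x)) - real n * exp_flat (n + 1) (1 - c * (x \<bullet> x)))) (at (1 - c * (x \<bullet> x)))"
      using exp_flat_has_derivative has_field_derivative_def by blast
    from has_derivative_compose[OF a this] show ?thesis by (simp add: mult_ac)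
  qed
  show ?case
    by (rule Ck_on_SucI[OF d]) (intro Ck_on_mult Ck_on_add Ck_on_const Suc.IH Ck_on_inner)
qed

definition conv :: "('a::euclidean_space \<Rightarrow> real) \<Rightarrow> ('a \<Rightarrow> real) \<Rightarrow> 'a \<Rightarrow> real" where
  "conv \<rho> g x = (\<integral>y. \<rho> (x - y) * g y \<partial>lborel)"

lemma conv_integrable:
  fixes \<rho> :: "'a::euclidean_space \<Rightarrow> real"
  assumes "continuous_on UNIV \<rho>" "bounded (range \<rho>)" "integrable lborel g"
  shows "integrable lborel (\<lambda>y. \<rho> (x - y) * g y)"
proof -
  obtain B where B: "\<And>x. \<bar>\<rho> x\<bar> \<le> B" using assms(2) by (auto simp: bounded_iff)
  have [measurable]: "\<rho> \<in> borel_measurable borel" using assms(1) by (rule borel_measurable_continuous_onI)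
  have [measurable]: "g \<in> borel_measurable borel" using assms(3) borel_measurable_integrable by fastforce
  show ?thesis
  proof (rule Bochner_Integration.integrable_bound)
    show "integrable lborel (\<lambda>y. B * g y)" using assms(3) by simp
    show "AE y in lborel. norm (\<rho> (x - y) * g y) \<le> norm (B * g y)"
      using B abs_ge_zero order_trans by (intro AE_I2) (auto simp: abs_mult intro!: mult_right_mono order_trans[OF B abs_ge_self])
  qed measurable
qed

lemma has_derivative_zero_outside:
  fixes f :: "'a::euclidean_space \<Rightarrow> real"
  assumes "(f has_derivative f') (at z)" "\<And>x. norm x > R \<Longrightarrow> f x = 0" "norm z > R"
  shows "f' = (\<lambda>_. 0)"
proof -
  have "open {z::'a. norm z > R}" by (simp add: open_Collect_less continuous_on_norm_id)
  then have "((\<lambda>_. 0) has_derivative f') (at z)"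
    by (rule has_derivative_transform_within_open[OF assms(1)]) (use assms in auto)
  then show ?thesis using has_derivative_const has_derivative_unique by metis
qed

text \<open>The first-order Taylor remainder of \<open>\<rho>\<close> is small uniformly in the base point, because the derivative is
  continuous with compact support; integrating against \<open>g\<close> keeps it small.\<close>
lemma conv_has_derivative:
  fixes \<rho> :: "'a::euclidean_space \<Rightarrow> real"
  assumes c: "Ck_on 1 UNIV \<rho>" and supp: "\<And>x. norm x > R \<Longrightarrow> \<rho> x = 0" and g: "integrable lborel g"
  shows "(conv \<rho> g has_derivative (\<lambda>v. conv (\<lambda>x. frechet_derivative \<rho> (at x) v) g x)) (at x)"
proof -
  let ?D = "\<lambda>x v. frechet_derivative \<rho> (at x) v"
  have der: "(\<rho> has_derivative ?D z) (at z)" for z using Ck_on_Suc_D(1)[of 0 \<rho>] c by simp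
  have lin: "linear (?D z)" for z using der has_derivative_linear by blast
  have cD: "continuous_on UNIV (\<lambda>z. ?D z v)" for v using c by simp
  have c\<rho>: "continuous_on UNIV \<rho>" using Ck_on_Suc_imp[of 0 \<rho>] c by simp
  have D0: "?D z v = 0" if "norm z > R" for z v
  proof -
    have "?D z = (\<lambda>_. 0)" by (rule has_derivative_zero_outside[OF der supp that])
    then show ?thesis by simp
  qed
  have bdd: "bounded (range h)" if "continuous_on UNIV h" "\<And>z. norm z > R \<Longrightarrow> h z = 0" for h :: "'a \<Rightarrow> real"
  proof -
    have "compact (h ` cball 0 R)" by (intro compact_continuous_image continuous_on_subset[OF that(1)]) auto
    then have "bounded (insert 0 (h ` cball 0 R))" by (simp add: compact_imp_bounded)
    moreover have "range h \<subseteq> insert 0 (h ` cball 0 R)"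
      using that(2) by (auto simp: image_iff) (metis dist_0_norm linorder_not_less mem_cball)
    ultimately show ?thesis by (rule bounded_subset)
  qed
  have intD: "integrable lborel (\<lambda>y. ?D (x - y) v * g y)" for x v
    by (rule conv_integrable[OF cD bdd[OF cD D0] g])
  have int\<rho>: "integrable lborel (\<lambda>y. \<rho> (x - y) * g y)" for x
    by (rule conv_integrable[OF c\<rho> bdd[OF c\<rho> supp] g])
  define G where "G = (\<integral>y. \<bar>g y\<bar> \<partial>lborel)"
  have G: "0 \<le> G" unfolding G_def by simp
  have unif: "\<exists>d>0. \<forall>z h. norm h < d \<longrightarrow> \<bar>\<rho> (z + h) - \<rho> z - ?D z h\<bar> \<le> e * norm h" if e: "e > 0" for e
  proof -
    let ?e = "e / real DIM('a)"
    have e': "?e > 0" using e by simp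
    have "\<exists>d>0. \<forall>z w. norm (w - z) < d \<longrightarrow> \<bar>?D w b - ?D z b\<bar> < ?e" for b
    proof -
      have "uniformly_continuous_on (cball 0 (R + 1)) (\<lambda>z. ?D z b)"
        by (intro compact_uniformly_continuous continuous_on_subset[OF cD]) auto
      then obtain d where d: "d > 0" "\<And>z w. z \<in> cball 0 (R + 1) \<Longrightarrow> w \<in> cball 0 (R + 1) \<Longrightarrow> dist w z < d \<Longrightarrow> dist (?D w b) (?D z b) < ?e"
        using e' unfolding uniformly_continuous_on_def by metis
      show ?thesis
      proof (intro exI[of _ "min d 1"] conjI allI impI)
        show "0 < min d 1" using d by simp
        fix z w :: 'a assume zw: "norm (w - z) < min d 1"
        show "\<bar>?D w b - ?D z b\<bar> < ?e"
        proof (cases "z \<in> cball 0 (R + 1) \<and> w \<in> cball 0 (R + 1)")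
          case True
          then show ?thesis using d(2)[of z w] zw by (simp add: dist_norm)
        next
          case False
          then have "norm z > R" "norm w > R"
            using zw norm_triangle_ineq3[of w z] by (auto simp: abs_less_iff)
          then show ?thesis using D0 e' by simp
        qed
      qed
    qed
    then obtain d where d: "\<And>b. d b > 0" "\<And>b z w. norm (w - z) < d b \<Longrightarrow> \<bar>?D w b - ?D z b\<bar> < ?e" by metis
    \<comment> \<open>Uniform continuity holds for each directional derivative along the basis; finitely many suffice.\<close>
    define d0 where "d0 = Min (d ` Basis)"
    have d0: "d0 > 0" unfolding d0_def using d(1) by (subst Min_gr_iff) auto
    have d0le: "d0 \<le> d b" if "b \<in> Basis" for b unfolding d0_def using that by simp
    have dl: "\<bar>?D w v - ?D z v\<bar> \<le> e * norm v" if w: "norm (w - z) < d0" for w z v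
    proof -
      have "?D w v - ?D z v = (\<Sum>b\<in>Basis. (v \<bullet> b) * (?D w b - ?D z b))"
      proof -
        have "?D w v = (\<Sum>b\<in>Basis. (v \<bullet> b) * ?D w b)" for w
          using linear_sum[OF lin[of w], of "\<lambda>b. (v \<bullet> b) *\<^sub>R b" Basis] linear_scale[OF lin[of w]]
          by (simp add: euclidean_representation)
        then show ?thesis by (simp add: sum_subtractf right_diff_distrib)
      qed
      also have "\<bar>\<dots>\<bar> \<le> (\<Sum>b\<in>(Basis::'a set). norm v * ?e)"
      proof (rule sum_abs[THEN order_trans], rule sum_mono)
        fix b :: 'a assume b: "b \<in> Basis"
        have "\<bar>?D w b - ?D z b\<bar> \<le> ?e" using d(2)[of w z b] w d0le[OF b] by simp
        then show "\<bar>(v \<bullet> b) * (?D w b - ?D z b)\<bar> \<le> norm v * ?e"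
          unfolding abs_mult using Basis_le_norm[OF b, of v] by (intro mult_mono) auto
      qed
      also have "\<dots> = e * norm v" by simp
      finally show ?thesis .
    qed
    have "\<bar>\<rho> (z + h) - \<rho> z - ?D z h\<bar> \<le> e * norm h" if h: "norm h < d0" for z h
    proof -
      have "norm (\<rho> (z + h) - \<rho> z - ?D z (z + h - z)) \<le> norm (z + h - z) * e"
      proof (rule differentiable_bound_linearization[where S = "ball z d0" and f' = ?D])
        show "z + t *\<^sub>R (z + h - z) \<in> ball z d0" if "t \<in> {0..1}" for t
          using that h mult_left_le_one_le[of "norm h" t] by (simp add: dist_norm abs_of_nonneg)
        show "(\<rho> has_derivative ?D x) (at x within ball z d0)" for x
          by (rule has_derivative_at_withinI[OF der])
        show "onorm (?D x - ?D z) \<le> e" if "x \<in> ball z d0" for x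
          by (rule onorm_le) (use dl[of x z] that in \<open>simp add: dist_norm norm_minus_commute\<close>)
        show "z \<in> ball z d0" using d0 by simp
      qed
      then show ?thesis by (simp add: mult.commute)
    qed
    with d0 show ?thesis by blast
  qed
  show ?thesis
    unfolding has_derivative_at_alt
  proof (intro conjI allI impI)
    have "linear (\<lambda>v. conv (\<lambda>x. ?D x v) g x)"
    proof (rule linearI)
      show "conv (\<lambda>x. ?D x (v + w)) g x = conv (\<lambda>x. ?D x v) g x + conv (\<lambda>x. ?D x w) g x" for v w
        unfolding conv_def using intD by (simp add: linear_add[OF lin] distrib_right)
      show "conv (\<lambda>x. ?D x (r *\<^sub>R v)) g x = r *\<^sub>R conv (\<lambda>x. ?D x v) g x" for r v
        unfolding conv_def by (simp add: linear_scale[OF lin] mult.assoc)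
    qed
    then show "bounded_linear (\<lambda>v. conv (\<lambda>x. ?D x v) g x)" by (simp add: linear_conv_bounded_linear)
    fix e :: real assume e: "0 < e"
    have "0 < e / (G + 1)" using e G by simp
    from unif[OF this] obtain d where d: "d > 0" "\<And>z h. norm h < d \<Longrightarrow> \<bar>\<rho> (z + h) - \<rho> z - ?D z h\<bar> \<le> e / (G + 1) * norm h"
      by blast
    show "\<exists>d>0. \<forall>y. norm (y - x) < d \<longrightarrow> norm (conv \<rho> g y - conv \<rho> g x - conv (\<lambda>xa. ?D xa (y - x)) g x) \<le> e * norm (y - x)"
    proof (intro exI[of _ d] conjI allI impI)
      show "0 < d" by (rule d(1))
      fix y assume y: "norm (y - x) < d"
      have "conv \<rho> g y - conv \<rho> g x - conv (\<lambda>xa. ?D xa (y - x)) g x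
         = (\<integral>u. (\<rho> (y - u) - \<rho> (x - u) - ?D (x - u) (y - x)) * g u \<partial>lborel)"
        unfolding conv_def using int\<rho> intD by (simp add: left_diff_distrib)
      also have "norm \<dots> \<le> (\<integral>u. e / (G + 1) * norm (y - x) * \<bar>g u\<bar> \<partial>lborel)"
      proof (rule order_trans[OF integral_norm_bound integral_mono])
        have "integrable lborel (\<lambda>u. (\<rho> (y - u) - \<rho> (x - u) - ?D (x - u) (y - x)) * g u)"
          using int\<rho> intD by (simp add: left_diff_distrib)
        then show "integrable lborel (\<lambda>u. norm ((\<rho> (y - u) - \<rho> (x - u) - ?D (x - u) (y - x)) * g u))"
          by (rule integrable_norm)
        show "integrable lborel (\<lambda>u. e / (G + 1) * norm (y - x) * \<bar>g u\<bar>)" using g by simp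
        fix u
        have "\<bar>\<rho> ((x - u) + (y - x)) - \<rho> (x - u) - ?D (x - u) (y - x)\<bar> \<le> e / (G + 1) * norm (y - x)"
          by (rule d(2)[OF y])
        moreover have "(x - u) + (y - x) = y - u" by simp
        ultimately have "\<bar>\<rho> (y - u) - \<rho> (x - u) - ?D (x - u) (y - x)\<bar> \<le> e / (G + 1) * norm (y - x)"
          by (simp only:)
        then show "norm ((\<rho> (y - u) - \<rho> (x - u) - ?D (x - u) (y - x)) * g u) \<le> e / (G + 1) * norm (y - x) * \<bar>g u\<bar>"
          unfolding real_norm_def abs_mult by (rule mult_right_mono) simp
      qed
      also have "\<dots> = e * norm (y - x) * (G / (G + 1))" by (simp add: G_def)
      also have "\<dots> \<le> e * norm (y - x) * 1"
        using e G by (intro mult_left_mono) auto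
      finally show "norm (conv \<rho> g y - conv \<rho> g x - conv (\<lambda>xa. ?D xa (y - x)) g x) \<le> e * norm (y - x)" by simp
    qed
  qed
qed

text \<open>All derivatives fall on \<open>\<rho>\<close>. The loss of one order in the statement is what starts the induction, as
  \<open>conv_has_derivative\<close> asks for a continuously differentiable \<open>\<rho>\<close>.\<close>
lemma Ck_on_conv:
  fixes \<rho> :: "'a::euclidean_space \<Rightarrow> real"
  assumes "Ck_on (Suc k) UNIV \<rho>" "\<And>x. norm x > R \<Longrightarrow> \<rho> x = 0" "integrable lborel g"
  shows "Ck_on k UNIV (conv \<rho> g)"
  using assms(1,2)
proof (induction k arbitrary: \<rho>)
  case 0
  have "conv \<rho> g differentiable (at x)" for x
    using conv_has_derivative[where \<rho> = \<rho> and R = R and g = g and x = x, OF _ 0(2) assms(3)] 0(1)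
    unfolding differentiable_def One_nat_def by blast
  then show ?case
    by (auto intro!: continuous_at_imp_continuous_on differentiable_imp_continuous_within)
next
  case (Suc k)
  have C1: "Ck_on 1 UNIV \<rho>" by (rule Ck_on_mono[OF Suc.prems(1)]) simp
  show ?case
  proof (rule Ck_on_SucI[OF conv_has_derivative[OF C1 Suc.prems(2) assms(3)]])
    fix v
    show "Ck_on k UNIV (conv (\<lambda>x. frechet_derivative \<rho> (at x) v) g)"
    proof (rule Suc.IH)
      show "Ck_on (Suc k) UNIV (\<lambda>x. frechet_derivative \<rho> (at x) v)"
        by (rule Ck_on_Suc_D(2)[OF Suc.prems(1)])
      fix z :: 'a assume z: "R < norm z"
      have "frechet_derivative \<rho> (at z) = (\<lambda>_. 0)"
        by (rule has_derivative_zero_outside[OF Ck_on_Suc_D(1)[OF Suc.prems(1)] Suc.prems(2) z])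
      then show "frechet_derivative \<rho> (at z) v = 0" by simp
    qed
  qed
qed

definition mollifier :: "real \<Rightarrow> ('a::euclidean_space \<Rightarrow> real) \<Rightarrow> bool" where
  "mollifier e \<rho> \<longleftrightarrow> (\<forall>k. Ck_on k UNIV \<rho>) \<and> (\<forall>x. 0 \<le> \<rho> x) \<and> (\<forall>x. norm x > e \<longrightarrow> \<rho> x = 0)
     \<and> integrable lborel \<rho> \<and> (\<integral>x. \<rho> x \<partial>lborel) = 1"

lemma ex_mollifier:
  assumes "0 < e"
  shows "\<exists>\<rho>::'a::euclidean_space \<Rightarrow> real. mollifier e \<rho>"
proof -
  define b where "b = (\<lambda>x::'a. exp_flat 0 (1 - 1 / e\<^sup>2 * (x \<bullet> x)))"
  have Ck: "Ck_on k UNIV b" for k unfolding b_def by (rule Ck_on_exp_flat_ball)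
  have cb: "continuous_on UNIV b" using Ck[of 0] by simp
  have b0: "b x = 0" if "e < norm x" for x
  proof -
    have "e\<^sup>2 \<le> x \<bullet> x" using that assms by (simp add: power_mono flip: power2_norm_eq_inner)
    then show ?thesis using assms by (simp add: b_def exp_flat_def)
  qed
  have nonneg: "0 \<le> b x" for x by (simp add: b_def exp_flat_nonneg)
  have bpos: "exp (- 4 / 3) \<le> b x" if "norm x \<le> e / 2" for x
  proof -
    have "(norm x)\<^sup>2 \<le> (e / 2)\<^sup>2" using that by (intro power_mono) auto
    then have "x \<bullet> x \<le> 1 / 4 * e\<^sup>2" by (simp add: power2_norm_eq_inner power_divide)
    moreover have "0 < e\<^sup>2" using assms by simp
    ultimately have "(x \<bullet> x) / e\<^sup>2 \<le> 1 / 4" by (simp only: pos_divide_le_eq)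
    then have "1 / e\<^sup>2 * (x \<bullet> x) \<le> 1 / 4" by (simp only: times_divide_eq_left mult_1_left)
    then have t: "3 / 4 \<le> 1 - 1 / e\<^sup>2 * (x \<bullet> x)" by linarith
    define T where "T = 1 - 1 / e\<^sup>2 * (x \<bullet> x)"
    have "3 / 4 \<le> T" using t by (simp only: T_def)
    then have "exp (- 4 / 3) \<le> exp_flat 0 T" by (simp add: exp_flat_def divide_le_eq)
    then show ?thesis by (simp only: b_def T_def)
  qed
  have int: "integrable lborel b"
  proof -
    have "integrable lborel (\<lambda>x. indicator (cball 0 e) x *\<^sub>R b x)"
      by (rule borel_integrable_compact) (auto intro: continuous_on_subset[OF cb])
    moreover have "(\<lambda>x. indicator (cball 0 e) x *\<^sub>R b x) = b"
    proof
      fix x show "indicator (cball 0 e) x *\<^sub>R b x = b x"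
        using b0[of x] by (cases "norm x \<le> e") auto
    qed
    ultimately show ?thesis by (simp only:)
  qed
  have "0 < (\<integral>x. (exp (- 4 / 3) :: real) * indicator (cball (0::'a) (e / 2)) x \<partial>lborel)"
    using assms by (simp add: content_cball)
  also have "\<dots> \<le> (\<integral>x. b x \<partial>lborel)"
  proof (rule integral_mono[OF _ int])
    show "integrable lborel (\<lambda>x. exp (- 4 / 3) * indicat_real (cball (0::'a) (e / 2)) x)"
      by (intro integrable_mult_right integrable_real_indicator) (use assms in \<open>auto simp: emeasure_ball_dim\<close>)
    show "exp (- 4 / 3) * indicator (cball 0 (e / 2)) x \<le> b x" for x
      using bpos[of x] nonneg[of x] by (cases "norm x \<le> e / 2") auto
  qed
  finally have Z: "0 < (\<integral>x. b x \<partial>lborel)" .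
  define Z where "Z = (\<integral>x. b x \<partial>lborel)"
  have "Ck_on k UNIV (\<lambda>x. 1 / Z * b x)" for k by (intro Ck_on_mult Ck_on_const Ck)
  then have "mollifier e (\<lambda>x. 1 / Z * b x)"
    unfolding mollifier_def using Z nonneg b0 int by (simp add: Z_def[symmetric])
  then show ?thesis by blast
qed

lemma integral_reflect:
  fixes c :: "'a::euclidean_space" and f :: "'a \<Rightarrow> real"
  assumes [measurable]: "f \<in> borel_measurable borel"
  shows "(\<integral>x. f (c - x) \<partial>lborel) = (\<integral>x. f x \<partial>lborel)"
proof -
  have "(\<integral>x. f x \<partial>lborel) = (\<integral>x. f x \<partial>density (distr lborel borel (\<lambda>x::'a. c + (-1) *\<^sub>R x)) (\<lambda>_. \<bar>- 1 :: real\<bar> ^ DIM('a)))"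
    by (subst lborel_affine[of "-1" c]) simp_all
  also have "\<dots> = (\<integral>x. f (c - x) \<partial>lborel)"
    by (simp add: density_1 integral_distr)
  finally show ?thesis by simp
qed

context
  fixes \<rho> :: "'a::euclidean_space \<Rightarrow> real" and e :: real
  assumes moll: "mollifier e \<rho>"
begin

lemma mollifierD:
  "Ck_on k UNIV \<rho>" "0 \<le> \<rho> x" "norm x > e \<Longrightarrow> \<rho> x = 0" "integrable lborel \<rho>" "(\<integral>x. \<rho> x \<partial>lborel) = 1"
  using moll by (auto simp: mollifier_def)

lemma mollifier_measurable: "\<rho> \<in> borel_measurable borel"
  using mollifierD(1)[of 0] by (auto intro: borel_measurable_continuous_onI)

lemma mollifier_nn_integral: "(\<integral>\<^sup>+x. ennreal (\<rho> x) \<partial>lborel) = 1"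
  using nn_integral_eq_integral[OF mollifierD(4)] mollifierD(2,5) by simp

lemma smooth_conv: "integrable lborel g \<Longrightarrow> smooth_on UNIV (conv \<rho> g)"
  unfolding smooth_on_def using Ck_on_conv[OF mollifierD(1,3)] by blast

lemma conv_alt:
  assumes [measurable]: "g \<in> borel_measurable borel"
  shows "conv \<rho> g x = (\<integral>k. \<rho> k * g (x - k) \<partial>lborel)"
proof -
  note [measurable] = mollifier_measurable
  show ?thesis
    using integral_reflect[of "\<lambda>k. \<rho> k * g (x - k)" x] by (simp add: conv_def)
qed

lemma conv_integrable_bounded:
  assumes [measurable]: "g \<in> borel_measurable borel" and b: "\<And>x. \<bar>g x\<bar> \<le> B"
  shows "integrable lborel (\<lambda>k. \<rho> k * g (x - k))"
proof (rule Bochner_Integration.integrable_bound)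
  note [measurable] = mollifier_measurable
  show "(\<lambda>k. \<rho> k * g (x - k)) \<in> borel_measurable lborel" by measurable
  show "integrable lborel (\<lambda>k. B * \<rho> k)" using mollifierD(4) by simp
  show "AE k in lborel. norm (\<rho> k * g (x - k)) \<le> norm (B * \<rho> k)"
  proof (rule AE_I2)
    fix k
    have "\<bar>g (x - k)\<bar> \<le> \<bar>B\<bar>" using b[of "x - k"] by linarith
    from mult_left_mono[OF this mollifierD(2)[of k]]
    show "norm (\<rho> k * g (x - k)) \<le> norm (B * \<rho> k)"
      using mollifierD(2)[of k] by (simp add: abs_mult mult.commute)
  qed
qed

lemma conv_ge:
  assumes "g \<in> borel_measurable borel" "\<And>x. \<bar>g x\<bar> \<le> B" "\<And>y. dist x y \<le> e \<Longrightarrow> a \<le> g y"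
  shows "a \<le> conv \<rho> g x"
proof -
  have "a = (\<integral>k. \<rho> k * a \<partial>lborel)" using mollifierD(4,5) by simp
  also have "\<dots> \<le> (\<integral>k. \<rho> k * g (x - k) \<partial>lborel)"
  proof (rule integral_mono)
    show "\<rho> k * a \<le> \<rho> k * g (x - k)" for k
      using assms(3)[of "x - k"] mollifierD(2)[of k] mollifierD(3)[of k]
      by (cases "norm k \<le> e") (auto simp: dist_norm intro: mult_left_mono)
  qed (use mollifierD(4) conv_integrable_bounded[OF assms(1,2)] in auto)
  finally show ?thesis by (simp add: conv_alt[OF assms(1)])
qed

lemma conv_minus: "conv \<rho> (\<lambda>x. - g x) x = - conv \<rho> g x"
  by (simp add: conv_def)

lemma conv_le:
  assumes "g \<in> borel_measurable borel" "\<And>x. \<bar>g x\<bar> \<le> B" "\<And>y. dist x y \<le> e \<Longrightarrow> g y \<le> a"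
  shows "conv \<rho> g x \<le> a"
  using conv_ge[of "\<lambda>x. - g x" B x "- a"] assms by (simp add: conv_minus)

lemma conv_eq:
  assumes "g \<in> borel_measurable borel" "\<And>x. \<bar>g x\<bar> \<le> B" "\<And>y. dist x y \<le> e \<Longrightarrow> g y = a"
  shows "conv \<rho> g x = a"
  using conv_le[OF assms(1,2), of x a] conv_ge[OF assms(1,2), of x a] assms(3) by force

lemma conv_measurable:
  assumes "integrable lborel g"
  shows "conv \<rho> g \<in> borel_measurable borel"
  using smooth_conv[OF assms] by (auto simp: smooth_on_def intro!: borel_measurable_continuous_onI dest: spec[of _ 0])

text \<open>A convolution with a probability density is an average of translates, and translation does not change the
  modulus.\<close>
lemma l1_modulus_conv:
  assumes i: "integrable lborel g" and b: "\<And>x. \<bar>g x\<bar> \<le> B"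
  shows "l1_modulus (conv \<rho> g) h \<le> l1_modulus g h"
proof -
  note [measurable] = mollifier_measurable
  have [measurable]: "g \<in> borel_measurable borel" using i borel_measurable_integrable by fastforce
  note int = conv_integrable_bounded[OF \<open>g \<in> borel_measurable borel\<close> b]
  have "l1_modulus (conv \<rho> g) h \<le> (\<integral>\<^sup>+y. (\<integral>\<^sup>+k. ennreal (\<rho> k) * ennreal \<bar>g (y - k + h) - g (y - k)\<bar> \<partial>lborel) \<partial>lborel)"
    unfolding l1_modulus_def
  proof (rule nn_integral_mono)
    fix y
    have "conv \<rho> g (y + h) - conv \<rho> g y = (\<integral>k. \<rho> k * (g (y - k + h) - g (y - k)) \<partial>lborel)"
      using int[of "y + h"] int[of y] by (simp add: conv_alt right_diff_distrib algebra_simps)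
    also have "ennreal \<bar>\<dots>\<bar> \<le> (\<integral>\<^sup>+k. ennreal \<bar>\<rho> k * (g (y - k + h) - g (y - k))\<bar> \<partial>lborel)"
    proof -
      have "integrable lborel (\<lambda>k. \<rho> k * (g (y - k + h) - g (y - k)))"
        using int[of "y + h"] int[of y] by (simp add: right_diff_distrib algebra_simps)
      from integral_norm_bound_ennreal[OF this] show ?thesis by simp
    qed
    also have "\<dots> = (\<integral>\<^sup>+k. ennreal (\<rho> k) * ennreal \<bar>g (y - k + h) - g (y - k)\<bar> \<partial>lborel)"
      using mollifierD(2) by (simp add: abs_mult ennreal_mult)
    finally show "ennreal \<bar>conv \<rho> g (y + h) - conv \<rho> g y\<bar> \<le> \<dots>" .
  qed
  also have "\<dots> = (\<integral>\<^sup>+k. (\<integral>\<^sup>+y. ennreal (\<rho> k) * ennreal \<bar>g (y - k + h) - g (y - k)\<bar> \<partial>lborel) \<partial>lborel)"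
    by (rule nn_integral_swap) measurable
  also have "\<dots> = (\<integral>\<^sup>+k. ennreal (\<rho> k) * l1_modulus g h \<partial>lborel)"
  proof (rule nn_integral_cong)
    fix k
    have m: "(\<lambda>y. ennreal \<bar>g (y + h) - g y\<bar>) \<in> borel_measurable borel" by measurable
    have "(\<integral>\<^sup>+y. ennreal (\<rho> k) * ennreal \<bar>g (y - k + h) - g (y - k)\<bar> \<partial>lborel)
       = ennreal (\<rho> k) * (\<integral>\<^sup>+y. ennreal \<bar>g (y - k + h) - g (y - k)\<bar> \<partial>lborel)"
      by (rule nn_integral_cmult) measurable
    also have "(\<integral>\<^sup>+y. ennreal \<bar>g (y - k + h) - g (y - k)\<bar> \<partial>lborel) = l1_modulus g h"
      using nn_integral_translate[OF m, of "- k"] by (simp add: l1_modulus_def)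
    finally show "(\<integral>\<^sup>+y. ennreal (\<rho> k) * ennreal \<bar>g (y - k + h) - g (y - k)\<bar> \<partial>lborel) = ennreal (\<rho> k) * l1_modulus g h" .
  qed
  also have "\<dots> = l1_modulus g h"
    by (simp add: nn_integral_multc mollifier_nn_integral)
  finally show ?thesis .
qed

lemma gagliardo_conv:
  assumes "integrable lborel g" "\<And>x. \<bar>g x\<bar> \<le> B"
  shows "gagliardo s (conv \<rho> g) \<le> gagliardo s g"
proof -
  have "g \<in> borel_measurable borel" using assms(1) borel_measurable_integrable by fastforce
  then show ?thesis
    using conv_measurable[OF assms(1)]
    by (simp add: gagliardo_l1_modulus) (intro nn_integral_mono mult_right_mono l1_modulus_conv[OF assms], simp)
qed

lemma nn_integral_conv:
  assumes i: "integrable lborel g" and b: "\<And>x. \<bar>g x\<bar> \<le> B" and nn: "\<And>x. 0 \<le> g x"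
  shows "(\<integral>\<^sup>+x. ennreal (conv \<rho> g x) \<partial>lborel) = (\<integral>\<^sup>+x. ennreal (g x) \<partial>lborel)"
proof -
  note [measurable] = mollifier_measurable
  have [measurable]: "g \<in> borel_measurable borel" using i borel_measurable_integrable by fastforce
  note int = conv_integrable_bounded[OF \<open>g \<in> borel_measurable borel\<close> b]
  have "(\<integral>\<^sup>+x. ennreal (conv \<rho> g x) \<partial>lborel) = (\<integral>\<^sup>+x. (\<integral>\<^sup>+k. ennreal (\<rho> k) * ennreal (g (x - k)) \<partial>lborel) \<partial>lborel)"
    using mollifierD(2) nn
    by (intro nn_integral_cong) (simp add: conv_alt nn_integral_eq_integral[OF int, symmetric] ennreal_mult)
  also have "\<dots> = (\<integral>\<^sup>+k. (\<integral>\<^sup>+x. ennreal (\<rho> k) * ennreal (g (x - k)) \<partial>lborel) \<partial>lborel)"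
    by (rule nn_integral_swap) measurable
  also have "\<dots> = (\<integral>\<^sup>+k. ennreal (\<rho> k) * (\<integral>\<^sup>+x. ennreal (g x) \<partial>lborel) \<partial>lborel)"
  proof (rule nn_integral_cong)
    fix k
    have m: "(\<lambda>y. ennreal (g y)) \<in> borel_measurable borel" by measurable
    have "(\<integral>\<^sup>+x. ennreal (\<rho> k) * ennreal (g (x - k)) \<partial>lborel) = ennreal (\<rho> k) * (\<integral>\<^sup>+x. ennreal (g (x - k)) \<partial>lborel)"
      by (rule nn_integral_cmult) measurable
    also have "(\<integral>\<^sup>+x. ennreal (g (x - k)) \<partial>lborel) = (\<integral>\<^sup>+x. ennreal (g x) \<partial>lborel)"
      using nn_integral_translate[OF m, of "- k"] by simp
    finally show "(\<integral>\<^sup>+x. ennreal (\<rho> k) * ennreal (g (x - k)) \<partial>lborel) = ennreal (\<rho> k) * (\<integral>\<^sup>+x. ennreal (g x) \<partial>lborel)" .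
  qed
  also have "\<dots> = (\<integral>\<^sup>+x. ennreal (g x) \<partial>lborel)"
    by (simp add: nn_integral_multc mollifier_nn_integral)
  finally show ?thesis .
qed

end

section \<open>Cutoff functions and the capacity of a ball\<close>

definition cutoff :: "'a::euclidean_space \<Rightarrow> real \<Rightarrow> real \<Rightarrow> 'a \<Rightarrow> real" where
  "cutoff x0 a b x = max 0 (min 1 ((b - dist x x0) / (b - a)))"

lemma cutoff_range: "0 \<le> cutoff x0 a b x" "cutoff x0 a b x \<le> 1"
  by (auto simp: cutoff_def)

lemma cutoff_eq_1: "a < b \<Longrightarrow> dist x x0 \<le> a \<Longrightarrow> cutoff x0 a b x = 1"
  by (simp add: cutoff_def)

lemma cutoff_eq_0: "a < b \<Longrightarrow> b \<le> dist x x0 \<Longrightarrow> cutoff x0 a b x = 0"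
  using divide_nonpos_pos[of "b - dist x x0" "b - a"] by (simp add: cutoff_def)

lemma cutoff_measurable [measurable]: "cutoff x0 a b \<in> borel_measurable borel"
  unfolding cutoff_def[abs_def] by measurable

lemma cutoff_Lipschitz:
  assumes "a < b"
  shows "\<bar>cutoff x0 a b x - cutoff x0 a b y\<bar> \<le> min 1 (dist x y / (b - a))"
proof -
  have "\<bar>(b - dist x x0) / (b - a) - (b - dist y x0) / (b - a)\<bar> = \<bar>dist y x0 - dist x x0\<bar> / (b - a)"
    using assms by (simp add: diff_divide_distrib[symmetric])
  also have "\<dots> \<le> dist x y / (b - a)"
  proof (rule divide_right_mono)
    show "\<bar>dist y x0 - dist x x0\<bar> \<le> dist x y"
      using abs_dist_diff_le[of y x0 x] by (simp add: dist_commute)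
  qed (use assms in simp)
  finally have "\<bar>cutoff x0 a b x - cutoff x0 a b y\<bar> \<le> dist x y / (b - a)"
    unfolding cutoff_def by (auto simp: max_def min_def)
  moreover have "\<bar>cutoff x0 a b x - cutoff x0 a b y\<bar> \<le> 1"
    using cutoff_range[of x0 a b x] cutoff_range[of x0 a b y] by linarith
  ultimately show ?thesis by simp
qed

text \<open>The variation at a single point of a bounded Lipschitz function is at most the integral of
  \<open>min 1 (norm h / \<delta>)\<close> against the kernel, with \<open>\<delta>\<close> the length scale of the function. The factor
  \<open>M\<close> is kept apart since it will tend to 0 for the linear perturbations of level sets.\<close>
lemma variation_at_Lipschitz_le:
  "\<exists>C>0. \<forall>s\<in>{0<..<1}. \<forall>\<delta>>0. \<forall>M\<ge>0. \<forall>\<psi>::'a::euclidean_space \<Rightarrow> real. \<psi> \<in> borel_measurable borel \<longrightarrow>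
     (\<forall>x y. \<bar>\<psi> x - \<psi> y\<bar> \<le> M * min 1 (dist x y / \<delta>)) \<longrightarrow>
     (\<forall>x. variation_at s \<psi> x \<le> ennreal (M * (C * \<delta> powr - s / (s * (1 - s)))))"
proof -
  obtain C where C: "C > 0" and J0: "\<forall>s\<in>{0<..<1}. \<forall>\<delta>>0.
     (\<integral>\<^sup>+h. ennreal (min 1 (norm h / \<delta>)) * frac_kernel s (h::'a) \<partial>lborel) \<le> ennreal (C * \<delta> powr - s / (s * (1 - s)))"
    using nn_integral_min_frac_kernel[where 'a = 'a] by (elim exE conjE)
  note J = J0[rule_format]
  have "variation_at s \<psi> x \<le> ennreal (M * (C * \<delta> powr - s / (s * (1 - s))))"
    if s: "s \<in> {0<..<1}" and \<delta>: "\<delta> > 0" and M: "M \<ge> 0" and [measurable]: "\<psi> \<in> borel_measurable borel"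
      and L: "\<And>x y. \<bar>\<psi> x - \<psi> y\<bar> \<le> M * min 1 (dist x y / \<delta>)" for s \<delta> M x and \<psi> :: "'a \<Rightarrow> real"
  proof -
    have m: "(\<lambda>h. ennreal (M * min 1 (norm h / \<delta>)) * frac_kernel s (h::'a)) \<in> borel_measurable borel" by measurable
    have "variation_at s \<psi> x
       \<le> (\<integral>\<^sup>+y. ennreal (M * min 1 (norm (x - y) / \<delta>)) * frac_kernel s (x - y) \<partial>lborel)"
      by (intro nn_integral_mono mult_right_mono ennreal_leI) (use L in \<open>auto simp: dist_norm\<close>)
    also have "\<dots> = (\<integral>\<^sup>+h. ennreal (M * min 1 (norm h / \<delta>)) * frac_kernel s (h::'a) \<partial>lborel)"
      by (rule nn_integral_reflect[OF m])
    also have "\<dots> = (\<integral>\<^sup>+h. ennreal M * (ennreal (min 1 (norm h / \<delta>)) * frac_kernel s (h::'a)) \<partial>lborel)"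
      using M \<delta> by (intro nn_integral_cong) (simp add: ennreal_mult mult.assoc)
    also have "\<dots> = ennreal M * (\<integral>\<^sup>+h. ennreal (min 1 (norm h / \<delta>)) * frac_kernel s (h::'a) \<partial>lborel)"
      by (rule nn_integral_cmult) measurable
    also have "\<dots> \<le> ennreal M * ennreal (C * \<delta> powr - s / (s * (1 - s)))"
      by (intro mult_left_mono J s \<delta>) simp
    also have "\<dots> = ennreal (M * (C * \<delta> powr - s / (s * (1 - s))))"
      using M C s by (subst ennreal_mult) auto
    finally show ?thesis .
  qed
  then show ?thesis using C by (intro exI[of _ C] conjI ballI allI impI) auto
qed

text \<open>Product rules for differences come out asymmetric in the two points. Symmetry of the kernel allows one to
  spend \<open>A x y\<close> on one of the points and \<open>A y x\<close> on the other, which makes it possible to restrict the first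
  point to a bounded region.\<close>
lemma gagliardo_sym_le:
  fixes f :: "'a::euclidean_space \<Rightarrow> real"
  assumes A: "case_prod A \<in> borel_measurable (lborel \<Otimes>\<^sub>M lborel)"
    and le: "\<And>x y. ennreal \<bar>f x - f y\<bar> \<le> A x y + A y x"
  shows "gagliardo s f \<le> 2 * (\<integral>\<^sup>+x. (\<integral>\<^sup>+y. A x y * frac_kernel s (x - y) \<partial>lborel) \<partial>lborel)"
proof -
  have A1[measurable]: "(\<lambda>z. A (fst z) (snd z)) \<in> borel_measurable (lborel \<Otimes>\<^sub>M lborel)"
    using A by (simp add: case_prod_beta')
  have A2[measurable]: "(\<lambda>z. A (snd z) (fst z)) \<in> borel_measurable (lborel \<Otimes>\<^sub>M lborel)"
    using measurable_compose[OF measurable_pair_swap' A1] by (simp add: case_prod_beta')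
  have s1[measurable]: "A y \<in> borel_measurable borel" for y
    using measurable_compose[OF measurable_Pair1'[of y lborel lborel] A1] by simp
  have s2[measurable]: "(\<lambda>x. A x y) \<in> borel_measurable borel" for y
    using measurable_compose[OF measurable_Pair1'[of y lborel lborel] A2] by simp
  have m1: "(\<lambda>(y, x). A x y * frac_kernel s (x - y)) \<in> borel_measurable (lborel \<Otimes>\<^sub>M lborel)"
    "(\<lambda>(y, x). A y x * frac_kernel s (x - y)) \<in> borel_measurable (lborel \<Otimes>\<^sub>M lborel)"
    unfolding case_prod_beta' by measurable
  have "gagliardo s f \<le> (\<integral>\<^sup>+y. (\<integral>\<^sup>+x. A x y * frac_kernel s (x - y) + A y x * frac_kernel s (x - y) \<partial>lborel) \<partial>lborel)"
    unfolding gagliardo_frac_kernel distrib_right[symmetric]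
    by (intro nn_integral_mono mult_right_mono le) simp
  also have "\<dots> = (\<integral>\<^sup>+y. (\<integral>\<^sup>+x. A x y * frac_kernel s (x - y) \<partial>lborel) + (\<integral>\<^sup>+x. A y x * frac_kernel s (x - y) \<partial>lborel) \<partial>lborel)"
    by (intro nn_integral_cong nn_integral_add) measurable
  also have "\<dots> = (\<integral>\<^sup>+y. (\<integral>\<^sup>+x. A x y * frac_kernel s (x - y) \<partial>lborel) \<partial>lborel) + (\<integral>\<^sup>+y. (\<integral>\<^sup>+x. A y x * frac_kernel s (x - y) \<partial>lborel) \<partial>lborel)"
    using lborel.borel_measurable_nn_integral[OF m1(1)] lborel.borel_measurable_nn_integral[OF m1(2)]
    by (intro nn_integral_add) auto
  also have "(\<integral>\<^sup>+y. (\<integral>\<^sup>+x. A x y * frac_kernel s (x - y) \<partial>lborel) \<partial>lborel) = (\<integral>\<^sup>+x. (\<integral>\<^sup>+y. A x y * frac_kernel s (x - y) \<partial>lborel) \<partial>lborel)"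
    by (rule nn_integral_swap[OF m1(1)])
  also have "(\<integral>\<^sup>+y. (\<integral>\<^sup>+x. A y x * frac_kernel s (x - y) \<partial>lborel) \<partial>lborel) = (\<integral>\<^sup>+x. (\<integral>\<^sup>+y. A x y * frac_kernel s (x - y) \<partial>lborel) \<partial>lborel)"
    by (subst frac_kernel_minus) simp
  finally show ?thesis by (simp add: mult_2)
qed

text \<open>A pair of points contributes only if one of them lies in \<open>S\<close>, so the pointwise variation has to be integrated
  over \<open>S\<close> only.\<close>
lemma gagliardo_Lipschitz_le:
  "\<exists>C>0. \<forall>s\<in>{0<..<1}. \<forall>\<delta>>0. \<forall>M\<ge>0. \<forall>S. \<forall>\<psi>::'a::euclidean_space \<Rightarrow> real.
     \<psi> \<in> borel_measurable borel \<longrightarrow> S \<in> sets borel \<longrightarrow> (\<forall>x. x \<notin> S \<longrightarrow> \<psi> x = 0) \<longrightarrow>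
     (\<forall>x y. \<bar>\<psi> x - \<psi> y\<bar> \<le> M * min 1 (dist x y / \<delta>)) \<longrightarrow>
     gagliardo s \<psi> \<le> emeasure lborel S * ennreal (C * M * \<delta> powr - s / (s * (1 - s)))"
proof -
  obtain C where C: "C > 0" and K0: "\<forall>s\<in>{0<..<1}. \<forall>\<delta>>0. \<forall>M\<ge>0. \<forall>\<psi>::'a \<Rightarrow> real. \<psi> \<in> borel_measurable borel \<longrightarrow>
     (\<forall>x y. \<bar>\<psi> x - \<psi> y\<bar> \<le> M * min 1 (dist x y / \<delta>)) \<longrightarrow>
     (\<forall>x. variation_at s \<psi> x \<le> ennreal (M * (C * \<delta> powr - s / (s * (1 - s)))))"
    using variation_at_Lipschitz_le[where 'a = 'a] by (elim exE conjE)
  have "gagliardo s \<psi> \<le> emeasure lborel S * ennreal ((2 * C) * M * \<delta> powr - s / (s * (1 - s)))"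
    if s: "s \<in> {0<..<1}" and \<delta>: "\<delta> > 0" and M: "M \<ge> 0" and m[measurable]: "\<psi> \<in> borel_measurable borel" "S \<in> sets borel"
      and z: "\<forall>x. x \<notin> S \<longrightarrow> \<psi> x = 0" and L: "\<forall>x y. \<bar>\<psi> x - \<psi> y\<bar> \<le> M * min 1 (dist x y / \<delta>)"
    for s \<delta> M S and \<psi> :: "'a \<Rightarrow> real"
  proof -
    define k where "k = M * (C * \<delta> powr - s / (s * (1 - s)))"
    have k: "0 \<le> k" using C s M by (simp add: k_def)
    have "gagliardo s \<psi> \<le> 2 * (\<integral>\<^sup>+x. (\<integral>\<^sup>+y. (indicator S x * ennreal \<bar>\<psi> x - \<psi> y\<bar>) * frac_kernel s (x - y) \<partial>lborel) \<partial>lborel)"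
    proof (rule gagliardo_sym_le)
      fix x y
      show "ennreal \<bar>\<psi> x - \<psi> y\<bar> \<le> indicator S x * ennreal \<bar>\<psi> x - \<psi> y\<bar> + indicator S y * ennreal \<bar>\<psi> y - \<psi> x\<bar>"
        using z by (cases "x \<in> S"; cases "y \<in> S") (auto simp: abs_minus_commute)
    qed measurable
    also have "\<dots> = 2 * (\<integral>\<^sup>+x. indicator S x * variation_at s \<psi> x \<partial>lborel)"
      by (simp add: mult.assoc nn_integral_cmult)
    also have "\<dots> \<le> 2 * (\<integral>\<^sup>+x. indicator S x * ennreal k \<partial>lborel)"
      unfolding k_def using K0[rule_format, OF s \<delta> M m(1) L[rule_format]]
      by (intro mult_left_mono nn_integral_mono) auto
    also have "\<dots> = emeasure lborel S * (ennreal 2 * ennreal k)"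
    proof -
      have "(\<integral>\<^sup>+x. indicator S x * ennreal k \<partial>lborel) = emeasure lborel S * ennreal k"
        by (simp add: nn_integral_multc)
      then show ?thesis by (simp add: mult_ac)
    qed
    also have "ennreal 2 * ennreal k = ennreal (2 * k)" using k by (intro ennreal_mult[symmetric]) auto
    finally show ?thesis by (simp add: k_def mult_ac)
  qed
  then show ?thesis using C by (intro exI[of _ "2 * C"] conjI ballI allI impI) auto
qed

lemma gagliardo_cutoff_le:
  "\<exists>C>0. \<forall>s\<in>{0<..<1}. \<forall>a b. \<forall>x0::'a::euclidean_space. 0 \<le> a \<longrightarrow> a < b \<longrightarrow>
     gagliardo s (cutoff x0 a b) \<le> ennreal (C * b ^ DIM('a) * (b - a) powr - s / (s * (1 - s)))"
proof -
  obtain C where C: "C > 0" and L0: "\<forall>s\<in>{0<..<1}. \<forall>\<delta>>0. \<forall>M\<ge>0. \<forall>S. \<forall>\<psi>::'a \<Rightarrow> real.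
     \<psi> \<in> borel_measurable borel \<longrightarrow> S \<in> sets borel \<longrightarrow> (\<forall>x. x \<notin> S \<longrightarrow> \<psi> x = 0) \<longrightarrow>
     (\<forall>x y. \<bar>\<psi> x - \<psi> y\<bar> \<le> M * min 1 (dist x y / \<delta>)) \<longrightarrow>
     gagliardo s \<psi> \<le> emeasure lborel S * ennreal (C * M * \<delta> powr - s / (s * (1 - s)))"
    using gagliardo_Lipschitz_le[where 'a = 'a] by (elim exE conjE)
  define \<omega> where "\<omega> = unit_ball_vol (real DIM('a))"
  have \<omega>: "0 < \<omega>" by (simp add: \<omega>_def)
  have "gagliardo s (cutoff x0 a b) \<le> ennreal (\<omega> * C * b ^ DIM('a) * (b - a) powr - s / (s * (1 - s)))"
    if s: "s \<in> {0<..<1}" and ab: "0 \<le> a" "a < b" for s a b and x0 :: 'a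
  proof -
    have "gagliardo s (cutoff x0 a b) \<le> emeasure lborel (cball x0 b) * ennreal (C * 1 * (b - a) powr - s / (s * (1 - s)))"
    proof (rule L0[rule_format, OF s])
      show "cutoff x0 a b x = 0" if "x \<notin> cball x0 b" for x
        using that by (intro cutoff_eq_0[OF ab(2)]) (simp add: dist_commute)
      show "\<bar>cutoff x0 a b x - cutoff x0 a b y\<bar> \<le> 1 * min 1 (dist x y / (b - a))" for x y
        using cutoff_Lipschitz[OF ab(2), of x0 x y] by (simp only: mult_1_left)
    qed (use ab in auto)
    also have "\<dots> = ennreal (\<omega> * b ^ DIM('a)) * ennreal (C * (b - a) powr - s / (s * (1 - s)))"
      using ab by (simp add: emeasure_ball_dim \<omega>_def)
    also have "\<dots> = ennreal (\<omega> * C * b ^ DIM('a) * (b - a) powr - s / (s * (1 - s)))"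
      using \<omega> C ab s by (subst ennreal_mult[symmetric]) (auto simp: mult_ac)
    finally show ?thesis .
  qed
  then show ?thesis using \<omega> C by (intro exI[of _ "\<omega> * C"]) auto
qed

lemma compact_enlarge:
  fixes K :: "'a::euclidean_space set"
  assumes "compact K" "open U" "K \<subseteq> U"
  shows "\<exists>d>0. \<exists>K'. compact K' \<and> K' \<subseteq> U \<and> (\<forall>x\<in>K. \<forall>y. dist x y \<le> d \<longrightarrow> y \<in> K')"
proof -
  obtain e where e: "e > 0" "(\<Union>x\<in>K. cball x e) \<subseteq> U"
    using compact_subset_open_imp_cball_epsilon_subset[OF assms] by blast
  have "(\<Union>x\<in>K. cball x e) = {x + y | x y. x \<in> K \<and> y \<in> cball 0 e}"
    by (auto simp: dist_norm norm_minus_commute) (metis add.commute diff_add_cancel)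
  then have "compact (\<Union>x\<in>K. cball x e)" by (simp only: compact_sums[OF assms(1) compact_cball])
  with e show ?thesis by (intro exI[of _ e] conjI exI[of _ "\<Union>x\<in>K. cball x e"]) auto
qed

lemma integrable_bounded_compact:
  fixes g :: "'a::euclidean_space \<Rightarrow> real"
  assumes [measurable]: "g \<in> borel_measurable borel" and "\<And>x. \<bar>g x\<bar> \<le> B" "compact K" "\<And>x. x \<notin> K \<Longrightarrow> g x = 0"
  shows "integrable lborel g"
proof (rule Bochner_Integration.integrable_bound)
  show "integrable lborel (\<lambda>x. B * indicator K x)"
    using assms(3) by (intro integrable_mult_right integrable_real_indicator)
      (use emeasure_bounded_finite[OF compact_imp_bounded[OF assms(3)]] in \<open>auto simp: borel_compact\<close>)
  show "AE x in lborel. norm (g x) \<le> norm (B * indicator K x)"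
  proof (rule AE_I2)
    fix x show "norm (g x) \<le> norm (B * indicator K x)"
      using assms(2)[of x] assms(4)[of x] by (cases "x \<in> K") auto
  qed
qed simp

text \<open>Mollification at a scale below the distances involved turns \<open>v\<close> into an admissible test function and does not
  increase the seminorm. So competitors for the capacity may be chosen merely measurable.\<close>
lemma frac_cap_le_gagliardo:
  fixes v :: "'a::euclidean_space \<Rightarrow> real"
  assumes v: "v \<in> borel_measurable borel" "\<And>x. \<bar>v x\<bar> \<le> B"
    and K: "compact K" "K \<subseteq> U" "open U" "\<And>x. x \<notin> K \<Longrightarrow> v x = 0"
    and e: "0 < e" "\<And>x y. x \<in> \<Sigma> \<Longrightarrow> dist x y \<le> e \<Longrightarrow> 1 \<le> v y"
  shows "frac_cap s \<Sigma> U \<le> gagliardo s v"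
proof -
  obtain d K' where d: "d > 0" "compact K'" "K' \<subseteq> U" "\<And>x y. x \<in> K \<Longrightarrow> dist x y \<le> d \<Longrightarrow> y \<in> K'"
    using compact_enlarge[OF K(1,3,2)] by blast
  define m where "m = min d e"
  have m: "0 < m" "m \<le> d" "m \<le> e" using d e by (auto simp: m_def)
  obtain \<rho> :: "'a \<Rightarrow> real" where \<rho>: "mollifier m \<rho>" using ex_mollifier[OF m(1)] by blast
  have int: "integrable lborel v" by (rule integrable_bounded_compact[OF v K(1,4)])
  have z: "conv \<rho> v x = 0" if "x \<notin> K'" for x
  proof (rule conv_eq[OF \<rho> v])
    fix y assume "dist x y \<le> m"
    then have "y \<notin> K" using d(4)[of y x] that m by (auto simp: dist_commute)
    then show "v y = 0" by (rule K(4))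
  qed
  have sub: "closure {x. conv \<rho> v x \<noteq> 0} \<subseteq> K'"
    using z d(2) by (intro closure_minimal) (auto simp: compact_imp_closed)
  have "compact (closure {x. conv \<rho> v x \<noteq> 0})"
    using compact_Int_closed[OF d(2) closed_closure, of "{x. conv \<rho> v x \<noteq> 0}"] sub by (simp only: Int_absorb1)
  then have "conv \<rho> v \<in> test_functions U"
    unfolding test_functions_def mem_Collect_eq
    using smooth_conv[OF \<rho> int] sub d(3) by blast
  moreover have "1 \<le> conv \<rho> v x" if "x \<in> \<Sigma>" for x
    by (rule conv_ge[OF \<rho> v]) (use e(2)[OF that] m in auto)
  ultimately have "frac_cap s \<Sigma> U \<le> gagliardo s (conv \<rho> v)"
    unfolding frac_cap_def by (intro Inf_lower) auto
  also have "\<dots> \<le> gagliardo s v" by (rule gagliardo_conv[OF \<rho> int v(2)])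
  finally show ?thesis .
qed

lemma test_functions_continuous:
  "\<phi> \<in> test_functions U \<Longrightarrow> continuous_on UNIV \<phi>"
  unfolding test_functions_def smooth_on_def mem_Collect_eq by (metis Ck_on.simps(1))

lemma test_functions_measurable:
  "\<phi> \<in> test_functions U \<Longrightarrow> \<phi> \<in> borel_measurable borel"
  by (rule borel_measurable_continuous_onI[OF test_functions_continuous])

lemma test_functions_support:
  "\<phi> \<in> test_functions U \<Longrightarrow> x \<notin> closure {x. \<phi> x \<noteq> 0} \<Longrightarrow> \<phi> x = 0"
  using closure_subset[of "{x. \<phi> x \<noteq> 0}"] by auto

lemma test_functions_zero:
  assumes "\<phi> \<in> test_functions U" "x \<notin> U"
  shows "\<phi> x = 0"
proof (rule test_functions_support[OF assms(1)])
  show "x \<notin> closure {x. \<phi> x \<noteq> 0}" using assms unfolding test_functions_def by blast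
qed

text \<open>Translation by \<open>h\<close> with \<open>norm h = 3 r\<close> moves the closed ball of radius \<open>r\<close> out of the ball of radius \<open>2 r\<close>,
  so \<open>D \<phi> h\<close> is at least the volume of the ball.\<close>
lemma frac_cap_ball_lower:
  "\<exists>c>0. \<forall>s\<in>{0<..<1}. \<forall>r>0. \<forall>x0::'a::euclidean_space.
     ennreal (c * r powr (real DIM('a) - s) / (s * (1 - s))) \<le> frac_cap s (cball x0 r) (ball x0 (2 * r))"
proof -
  obtain C where C: "C > 0" and D0: "\<forall>s\<in>{0<..<1}. \<forall>f\<in>borel_measurable borel. \<forall>h::'a.
     l1_modulus f h \<le> ennreal (C * (s * (1 - s)) * norm h powr s) * gagliardo s f"
    using l1_modulus_le_gagliardo[where 'a = 'a] by (elim exE conjE)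
  note D = D0[rule_format]
  define \<omega> where "\<omega> = unit_ball_vol (real DIM('a))"
  have \<omega>: "0 < \<omega>" by (simp add: \<omega>_def)
  have main: "ennreal (\<omega> / (4 * C) * r powr (real DIM('a) - s) / (s * (1 - s))) \<le> gagliardo s \<phi>"
    if s: "s \<in> {0<..<1}" and r: "r > 0" and \<phi>: "\<phi> \<in> test_functions (ball x0 (2 * r))" and ge: "\<And>x. x \<in> cball x0 r \<Longrightarrow> 1 \<le> \<phi> x"
    for s r \<phi> and x0 :: 'a
  proof -
    obtain b :: 'a where b: "b \<in> Basis" using nonempty_Basis by blast
    define h where "h = (3 * r) *\<^sub>R b"
    have nh: "norm h = 3 * r" using b r by (simp add: h_def)
    have "ennreal (\<omega> * r ^ DIM('a)) = (\<integral>\<^sup>+x. indicator (cball x0 r) x \<partial>lborel)"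
      using r by (simp add: emeasure_ball_dim \<omega>_def)
    also have "\<dots> \<le> l1_modulus \<phi> h"
      unfolding l1_modulus_def
    proof (rule nn_integral_mono)
      fix x
      show "indicator (cball x0 r) x \<le> ennreal \<bar>\<phi> (x + h) - \<phi> x\<bar>"
      proof (cases "x \<in> cball x0 r")
        case True
        have "norm h \<le> norm (x0 - (x + h)) + norm (x0 - x)"
          using norm_triangle_ineq4[of "x0 - x" "x0 - (x + h)"] by simp
        then have "x + h \<notin> ball x0 (2 * r)" using True nh by (simp add: dist_norm)
        then have "\<phi> (x + h) = 0" by (rule test_functions_zero[OF \<phi>])
        then show ?thesis using ge[OF True] True
          by (simp add: ennreal_1[symmetric] ennreal_leI del: ennreal_1)
      qed simp
    qed
    also have "\<dots> \<le> ennreal (C * (s * (1 - s)) * norm h powr s) * gagliardo s \<phi>"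
      by (rule D[OF s test_functions_measurable[OF \<phi>]])
    finally have "ennreal (\<omega> * r ^ DIM('a)) \<le> ennreal (C * (s * (1 - s)) * (3 * r) powr s) * gagliardo s \<phi>"
      by (simp add: nh)
    also have "\<dots> \<le> ennreal (C * (s * (1 - s)) * (4 * r powr s)) * gagliardo s \<phi>"
    proof (intro mult_right_mono ennreal_leI mult_left_mono)
      have "3 powr s \<le> (3::real)" using s powr_mono[of s 1 "3::real"] by simp
      then show "(3 * r) powr s \<le> 4 * r powr s" using r by (simp add: powr_mult mult_right_mono)
    qed (use C s in auto)
    finally have fin: "ennreal (\<omega> * r ^ DIM('a)) \<le> ennreal (C * (s * (1 - s)) * (4 * r powr s)) * gagliardo s \<phi>" .
    define d where "d = C * (s * (1 - s)) * (4 * r powr s)"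
    have d: "0 < d" using C s r by (simp add: d_def)
    have "ennreal (1 / d) * ennreal (\<omega> * r ^ DIM('a)) \<le> ennreal (1 / d) * (ennreal d * gagliardo s \<phi>)"
      using fin by (intro mult_left_mono) (auto simp: d_def)
    also have "\<dots> = gagliardo s \<phi>" using d by (simp add: mult.assoc[symmetric] ennreal_mult[symmetric])
    also have "ennreal (1 / d) * ennreal (\<omega> * r ^ DIM('a)) = ennreal (\<omega> / (4 * C) * r powr (real DIM('a) - s) / (s * (1 - s)))"
    proof -
      have e: "r powr (real DIM('a) - s) = r ^ DIM('a) / r powr s" using r by (simp add: powr_diff powr_realpow)
      have "1 / d * (\<omega> * r ^ DIM('a)) = \<omega> / (4 * C) * r powr (real DIM('a) - s) / (s * (1 - s))"
        unfolding e d_def by (simp only: divide_inverse inverse_mult_distrib mult_1_left mult_ac)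
      then show ?thesis using d \<omega> r by (simp only: ennreal_mult[symmetric] zero_le_divide_1_iff less_imp_le mult_nonneg_nonneg zero_le_power)
    qed
    finally show ?thesis .
  qed
  show ?thesis
    by (rule exI[of _ "\<omega> / (4 * C)"])
       (use \<omega> C main in \<open>auto simp: frac_cap_def intro!: Inf_greatest\<close>)
qed

lemma frac_cap_ball_upper:
  "\<exists>C>0. \<forall>s\<in>{0<..<1}. \<forall>r>0. \<forall>x0::'a::euclidean_space.
     frac_cap s (cball x0 r) (ball x0 (2 * r)) \<le> ennreal (C * r powr (real DIM('a) - s) / (s * (1 - s)))"
proof -
  let ?N = "DIM('a)"
  obtain C where C: "C > 0" and G0: "\<forall>s\<in>{0<..<1}. \<forall>a b. \<forall>x0::'a. 0 \<le> a \<longrightarrow> a < b \<longrightarrow>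
     gagliardo s (cutoff x0 a b) \<le> ennreal (C * b ^ DIM('a) * (b - a) powr - s / (s * (1 - s)))"
    using gagliardo_cutoff_le[where 'a = 'a] by (elim exE conjE)
  have "frac_cap s (cball x0 r) (ball x0 (2 * r)) \<le> ennreal (2 * C * 2 ^ ?N * r powr (real ?N - s) / (s * (1 - s)))"
    if s: "s \<in> {0<..<1}" and r: "0 < r" for s r and x0 :: 'a
  proof -
    have ab: "5/4 * r < 7/4 * r" using r by simp
    have "frac_cap s (cball x0 r) (ball x0 (2 * r)) \<le> gagliardo s (cutoff x0 (5/4 * r) (7/4 * r))"
    proof (rule frac_cap_le_gagliardo[where K = "cball x0 (7/4 * r)" and e = "r / 4" and B = 1])
      show "\<bar>cutoff x0 (5/4 * r) (7/4 * r) x\<bar> \<le> 1" for x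
        using cutoff_range[of x0 "5/4 * r" "7/4 * r" x] by simp
      show "cball x0 (7/4 * r) \<subseteq> ball x0 (2 * r)" using r by auto
      show "cutoff x0 (5/4 * r) (7/4 * r) x = 0" if "x \<notin> cball x0 (7/4 * r)" for x
        using that by (intro cutoff_eq_0[OF ab]) (simp add: dist_commute)
      fix x y assume "x \<in> cball x0 r" and xy: "dist x y \<le> r / 4"
      then have "dist y x0 \<le> 5/4 * r" using dist_triangle[of y x0 x] by (simp add: dist_commute)
      then show "1 \<le> cutoff x0 (5/4 * r) (7/4 * r) y" using cutoff_eq_1[OF ab] by (metis order_refl)
    qed (use r in auto)
    also have "\<dots> \<le> ennreal (C * (7/4 * r) ^ ?N * (7/4 * r - 5/4 * r) powr - s / (s * (1 - s)))"
      using G0[rule_format, OF s _ ab] r by simp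
    also have "\<dots> \<le> ennreal (2 * C * 2 ^ ?N * r powr (real ?N - s) / (s * (1 - s)))"
    proof (intro ennreal_leI divide_right_mono)
      have "(7/4 * r - 5/4 * r) powr - s = (1/2) powr - s * r powr - s"
        using r by (subst powr_mult[symmetric]) simp
      also have "(1/2) powr - s = (2::real) powr s" by (simp add: powr_minus powr_divide)
      also have "2 powr s * r powr - s \<le> 2 * r powr - s"
        using s powr_mono[of s 1 "2::real"] by (intro mult_right_mono) auto
      finally have e: "(7/4 * r - 5/4 * r) powr - s \<le> 2 * r powr - s" .
      have "C * (7/4 * r) ^ ?N * (7/4 * r - 5/4 * r) powr - s \<le> C * (2 * r) ^ ?N * (2 * r powr - s)"
        using C r e by (intro mult_mono mult_left_mono power_mono) auto
      also have "\<dots> = 2 * C * 2 ^ ?N * (r ^ ?N * r powr - s)" by (simp add: power_mult_distrib)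
      also have "r ^ ?N * r powr - s = r powr (real ?N - s)"
        using r by (simp add: powr_diff powr_realpow powr_minus divide_inverse)
      finally show "C * (7/4 * r) ^ ?N * (7/4 * r - 5/4 * r) powr - s \<le> 2 * C * 2 ^ ?N * r powr (real ?N - s)" .
    qed (use s in auto)
    finally show ?thesis .
  qed
  then show ?thesis using C by (intro exI[of _ "2 * C * 2 ^ ?N"] conjI ballI allI impI) auto
qed

section \<open>The lower bound at a fixed radius\<close>

lemma ennreal_le_divideI:
  fixes a b c :: ennreal
  assumes "a * b \<le> c" "b \<noteq> 0" "b \<noteq> top"
  shows "a \<le> c / b"
  using divide_right_mono_ennreal[OF assms(1), of b] assms(2,3) by (simp add: ennreal_mult_divide_eq)

lemma emeasure_open_pos:
  fixes E :: "'a::euclidean_space set"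
  assumes "open E" "E \<noteq> {}"
  shows "0 < emeasure lborel E"
proof -
  obtain x e where e: "e > 0" "ball x e \<subseteq> E" using assms open_contains_ball by blast
  have "0 < emeasure lborel (ball x e)" using e by (simp add: emeasure_ball_dim)
  also have "\<dots> \<le> emeasure lborel E" using e assms by (intro emeasure_mono) auto
  finally show ?thesis .
qed

text \<open>The product rule for \<open>\<eta> (1 - 1\<^sub>E)\<close>, where \<open>\<eta>\<close> is the cutoff function. Evaluating the factor \<open>1 - 1\<^sub>E\<close> in
  front of the variation of \<open>\<eta>\<close> at the point in the doubled ball keeps the far part of the complement of \<open>E\<close>,
  which has infinite volume, out of the estimate.\<close>
lemma gagliardo_cutoff_complement_le:
  fixes E :: "'a::euclidean_space set"
  assumes E[measurable]: "E \<in> sets borel" and r: "0 < r" and k: "0 \<le> k"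
    and K: "\<And>x. variation_at s (cutoff x0 (5/4 * r) (7/4 * r)) x \<le> ennreal k"
  shows "gagliardo s (\<lambda>x. cutoff x0 (5/4 * r) (7/4 * r) x * (1 - indicat_real E x))
    \<le> 2 * (\<integral>\<^sup>+x. indicator (cball 0 (2 * r)) (x - x0) * (ennreal (1 - indicat_real E x) * ennreal k
         + (\<integral>\<^sup>+y. ennreal \<bar>indicat_real E y - indicat_real E x\<bar> * frac_kernel s (y - x) \<partial>lborel)) \<partial>lborel)"
proof -
  define c where "c = cutoff x0 (5/4 * r) (7/4 * r)"
  define f where "f = indicat_real E"
  define Z :: "'a set" where "Z = cball 0 (2 * r)"
  have [measurable]: "Z \<in> sets borel" by (simp add: Z_def)
  have [measurable]: "c \<in> borel_measurable borel" unfolding c_def by (rule cutoff_measurable)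
  have [measurable]: "f \<in> borel_measurable borel" unfolding f_def by measurable
  have c0: "c x = 0" if "x - x0 \<notin> Z" for x
    unfolding c_def using that r by (intro cutoff_eq_0) (auto simp: Z_def dist_norm norm_minus_commute)
  have c1: "0 \<le> c x" "c x \<le> 1" for x unfolding c_def by (rule cutoff_range)+
  have f1: "0 \<le> f x" "f x \<le> 1" for x unfolding f_def by auto
  have pt: "\<bar>c x * (1 - f x) - c y * (1 - f y)\<bar> \<le> (1 - f x) * \<bar>c x - c y\<bar> + \<bar>f x - f y\<bar>" for x y
  proof -
    have "c x * (1 - f x) - c y * (1 - f y) = (1 - f x) * (c x - c y) + c y * (f y - f x)"
      by (simp add: algebra_simps)
    also have "\<bar>\<dots>\<bar> \<le> \<bar>(1 - f x) * (c x - c y)\<bar> + \<bar>c y * (f y - f x)\<bar>" by (rule abs_triangle_ineq)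
    also have "\<dots> \<le> (1 - f x) * \<bar>c x - c y\<bar> + 1 * \<bar>f y - f x\<bar>"
      unfolding abs_mult using c1[of y] f1[of x] by (intro add_mono mult_mono) auto
    finally show ?thesis by (simp add: abs_minus_commute)
  qed
  define A where "A = (\<lambda>x y. indicator Z (x - x0) * (ennreal (1 - f x) * ennreal \<bar>c x - c y\<bar> + ennreal \<bar>f y - f x\<bar>))"
  have "gagliardo s (\<lambda>x. c x * (1 - f x)) \<le> 2 * (\<integral>\<^sup>+x. (\<integral>\<^sup>+y. A x y * frac_kernel s (x - y) \<partial>lborel) \<partial>lborel)"
  proof (rule gagliardo_sym_le)
    show "case_prod A \<in> borel_measurable (lborel \<Otimes>\<^sub>M lborel)" unfolding A_def by measurable
    fix x y
    have *: "ennreal \<bar>c x * (1 - f x) - c y * (1 - f y)\<bar> \<le> A x y" if "x - x0 \<in> Z" for x y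
    proof -
      have "ennreal \<bar>c x * (1 - f x) - c y * (1 - f y)\<bar> \<le> ennreal ((1 - f x) * \<bar>c x - c y\<bar> + \<bar>f x - f y\<bar>)"
        by (rule ennreal_leI[OF pt])
      also have "\<dots> = A x y"
        unfolding A_def using that f1[of x] by (simp add: ennreal_plus ennreal_mult abs_minus_commute)
      finally show ?thesis .
    qed
    show "ennreal \<bar>c x * (1 - f x) - c y * (1 - f y)\<bar> \<le> A x y + A y x"
    proof (cases "x - x0 \<in> Z")
      case True
      show ?thesis by (rule order_trans[OF *[OF True]]) simp
    next
      case x: False
      show ?thesis
      proof (cases "y - x0 \<in> Z")
        case True
        show ?thesis
          by (subst abs_minus_commute, rule order_trans[OF *[OF True]]) simp
      next
        case False
        then show ?thesis using c0[OF x] c0[OF False] by simp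
      qed
    qed
  qed
  also have "\<dots> \<le> 2 * (\<integral>\<^sup>+x. indicator Z (x - x0) * (ennreal (1 - f x) * ennreal k
         + (\<integral>\<^sup>+y. ennreal \<bar>f y - f x\<bar> * frac_kernel s (y - x) \<partial>lborel)) \<partial>lborel)"
  proof (intro mult_left_mono nn_integral_mono)
    fix x
    have "(\<integral>\<^sup>+y. A x y * frac_kernel s (x - y) \<partial>lborel)
       = (\<integral>\<^sup>+y. indicator Z (x - x0) * (ennreal (1 - f x) * (ennreal \<bar>c x - c y\<bar> * frac_kernel s (x - y)) + ennreal \<bar>f y - f x\<bar> * frac_kernel s (y - x)) \<partial>lborel)"
      unfolding A_def by (intro nn_integral_cong) (simp add: frac_kernel_minus[of s x] distrib_right mult.assoc)
    also have "\<dots> = indicator Z (x - x0) * (ennreal (1 - f x) * (\<integral>\<^sup>+y. ennreal \<bar>c x - c y\<bar> * frac_kernel s (x - y) \<partial>lborel)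
         + (\<integral>\<^sup>+y. ennreal \<bar>f y - f x\<bar> * frac_kernel s (y - x) \<partial>lborel))"
      by (simp add: nn_integral_cmult nn_integral_add)
    also have "\<dots> \<le> indicator Z (x - x0) * (ennreal (1 - f x) * ennreal k
         + (\<integral>\<^sup>+y. ennreal \<bar>f y - f x\<bar> * frac_kernel s (y - x) \<partial>lborel))"
      using K[of x] unfolding c_def by (intro mult_left_mono add_right_mono) auto
    finally show "(\<integral>\<^sup>+y. A x y * frac_kernel s (x - y) \<partial>lborel) \<le> \<dots>" .
  qed simp
  finally show ?thesis by (simp only: c_def f_def Z_def)
qed

text \<open>For a centre \<open>x0\<close> in \<open>E\<close> the indicator of the complement of \<open>E\<close> at \<open>x\<close> equals \<open>|1\<^sub>E x - 1\<^sub>E x0|\<close>. After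
  integration over \<open>x0\<close> and the substitution \<open>x = x0 + h\<close> it therefore becomes the modulus of \<open>1\<^sub>E\<close>, while the
  perimeter term, integrated over all centres, is counted with the volume of a ball as multiplicity.\<close>
lemma average_over_centres:
  fixes E :: "'a::euclidean_space set"
  assumes E[measurable]: "E \<in> sets borel" and r: "0 < r" and k: "0 \<le> k"
    and m: "\<And>h. norm h \<le> 2 * r \<Longrightarrow> l1_modulus (indicat_real E) h \<le> ennreal m * frac_perimeter s E"
    and L: "\<And>x0. L \<le> 2 * (\<integral>\<^sup>+x. indicator (cball 0 (2 * r)) (x - x0) * (ennreal (1 - indicat_real E x) * ennreal k
         + (\<integral>\<^sup>+y. ennreal \<bar>indicat_real E y - indicat_real E x\<bar> * frac_kernel s (y - x) \<partial>lborel)) \<partial>lborel)"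
  shows "L * emeasure lborel E \<le> 2 * (emeasure lborel (cball (0::'a) (2 * r)) * ((ennreal k * ennreal m + 1) * frac_perimeter s E))"
proof -
  define f where "f = indicat_real E"
  define Z :: "'a set" where "Z = cball 0 (2 * r)"
  define P where "P = frac_perimeter s E"
  define G where "G = (\<lambda>x. \<integral>\<^sup>+y. ennreal \<bar>f y - f x\<bar> * frac_kernel s (y - x) \<partial>lborel)"
  have [measurable]: "Z \<in> sets borel" by (simp add: Z_def)
  have [measurable]: "f \<in> borel_measurable borel" unfolding f_def by measurable
  have [measurable]: "G \<in> borel_measurable borel"
  proof -
    have "G \<in> borel_measurable lborel" unfolding G_def by measurable
    then show ?thesis by simp
  qed
  have GP: "(\<integral>\<^sup>+x. G x \<partial>lborel) = P" by (simp add: P_def frac_perimeter_def gagliardo_frac_kernel G_def f_def)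
  have "L * emeasure lborel E = (\<integral>\<^sup>+x0. L * indicator E x0 \<partial>lborel)"
    by (simp add: nn_integral_cmult_indicator)
  also have "\<dots> \<le> (\<integral>\<^sup>+x0. 2 * (\<integral>\<^sup>+x. ennreal k * (indicator Z (x - x0) * ennreal \<bar>f x - f x0\<bar>) + indicator Z (x - x0) * G x \<partial>lborel) \<partial>lborel)"
  proof (rule nn_integral_mono)
    fix x0
    show "L * indicator E x0 \<le> 2 * (\<integral>\<^sup>+x. ennreal k * (indicator Z (x - x0) * ennreal \<bar>f x - f x0\<bar>) + indicator Z (x - x0) * G x \<partial>lborel)"
    proof (cases "x0 \<in> E")
      case True
      have "L \<le> 2 * (\<integral>\<^sup>+x. indicator Z (x - x0) * (ennreal (1 - f x) * ennreal k + G x) \<partial>lborel)"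
        using L[of x0] by (simp only: f_def G_def Z_def)
      also have "\<dots> = 2 * (\<integral>\<^sup>+x. ennreal k * (indicator Z (x - x0) * ennreal \<bar>f x - f x0\<bar>) + indicator Z (x - x0) * G x \<partial>lborel)"
      proof (intro arg_cong[where f = "\<lambda>z. 2 * z"] nn_integral_cong)
        fix x
        have "\<bar>f x - f x0\<bar> = 1 - f x" using True by (auto simp: f_def indicator_def)
        then show "indicator Z (x - x0) * (ennreal (1 - f x) * ennreal k + G x)
          = ennreal k * (indicator Z (x - x0) * ennreal \<bar>f x - f x0\<bar>) + indicator Z (x - x0) * G x"
          by (simp add: distrib_left mult_ac)
      qed
      finally show ?thesis using True by simp
    qed simp
  qed
  also have "\<dots> = 2 * (\<integral>\<^sup>+x0. (\<integral>\<^sup>+x. ennreal k * (indicator Z (x - x0) * ennreal \<bar>f x - f x0\<bar>) + indicator Z (x - x0) * G x \<partial>lborel) \<partial>lborel)"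
    by (rule nn_integral_cmult) measurable
  also have "(\<integral>\<^sup>+x0. (\<integral>\<^sup>+x. ennreal k * (indicator Z (x - x0) * ennreal \<bar>f x - f x0\<bar>) + indicator Z (x - x0) * G x \<partial>lborel) \<partial>lborel)
    = (\<integral>\<^sup>+x0. ennreal k * (\<integral>\<^sup>+x. indicator Z (x - x0) * ennreal \<bar>f x - f x0\<bar> \<partial>lborel) + (\<integral>\<^sup>+x. indicator Z (x - x0) * G x \<partial>lborel) \<partial>lborel)"
    by (intro nn_integral_cong) (simp add: nn_integral_add nn_integral_cmult)
  also have "\<dots> = ennreal k * (\<integral>\<^sup>+x0. (\<integral>\<^sup>+x. indicator Z (x - x0) * ennreal \<bar>f x - f x0\<bar> \<partial>lborel) \<partial>lborel)
      + (\<integral>\<^sup>+x0. (\<integral>\<^sup>+x. indicator Z (x - x0) * G x \<partial>lborel) \<partial>lborel)"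
    by (subst nn_integral_add) (auto simp: nn_integral_cmult)
  also have "(\<integral>\<^sup>+x0. (\<integral>\<^sup>+x. indicator Z (x - x0) * G x \<partial>lborel) \<partial>lborel) = emeasure lborel Z * P"
  proof -
    have mZ: "indicator Z \<in> borel_measurable borel" by measurable
    have "(\<integral>\<^sup>+x0. (\<integral>\<^sup>+x. indicator Z (x - x0) * G x \<partial>lborel) \<partial>lborel) = (\<integral>\<^sup>+x. (\<integral>\<^sup>+x0. indicator Z (x - x0) * G x \<partial>lborel) \<partial>lborel)"
      by (rule nn_integral_swap) measurable
    also have "\<dots> = (\<integral>\<^sup>+x. emeasure lborel Z * G x \<partial>lborel)"
      using nn_integral_reflect[OF mZ] by (simp add: nn_integral_multc)
    finally show ?thesis by (simp add: nn_integral_cmult GP)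
  qed
  also have "(\<integral>\<^sup>+x0. (\<integral>\<^sup>+x. indicator Z (x - x0) * ennreal \<bar>f x - f x0\<bar> \<partial>lborel) \<partial>lborel) \<le> emeasure lborel Z * (ennreal m * P)"
  proof -
    have "(\<integral>\<^sup>+x0. (\<integral>\<^sup>+x. indicator Z (x - x0) * ennreal \<bar>f x - f x0\<bar> \<partial>lborel) \<partial>lborel)
       = (\<integral>\<^sup>+x0. (\<integral>\<^sup>+h. indicator Z h * ennreal \<bar>f (x0 + h) - f x0\<bar> \<partial>lborel) \<partial>lborel)"
    proof (rule nn_integral_cong)
      fix x0
      have "(\<lambda>x. indicator Z (x - x0) * ennreal \<bar>f x - f x0\<bar>) \<in> borel_measurable borel" by measurable
      from nn_integral_translate[OF this, of x0]
      show "(\<integral>\<^sup>+x. indicator Z (x - x0) * ennreal \<bar>f x - f x0\<bar> \<partial>lborel) = (\<integral>\<^sup>+h. indicator Z h * ennreal \<bar>f (x0 + h) - f x0\<bar> \<partial>lborel)"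
        by (simp add: add.commute)
    qed
    also have "\<dots> = (\<integral>\<^sup>+h. (\<integral>\<^sup>+x0. indicator Z h * ennreal \<bar>f (x0 + h) - f x0\<bar> \<partial>lborel) \<partial>lborel)"
      by (rule nn_integral_swap) measurable
    also have "\<dots> = (\<integral>\<^sup>+h. indicator Z h * l1_modulus f h \<partial>lborel)"
      by (simp add: nn_integral_cmult l1_modulus_def)
    also have "\<dots> \<le> (\<integral>\<^sup>+h. (ennreal m * P) * indicator Z h \<partial>lborel)"
    proof (rule nn_integral_mono)
      fix h show "indicator Z h * l1_modulus f h \<le> ennreal m * P * indicator Z h"
        using m[of h] by (cases "h \<in> Z") (auto simp: Z_def f_def P_def)
    qed
    also have "\<dots> = emeasure lborel Z * (ennreal m * P)"
      by (subst nn_integral_cmult_indicator) (simp_all add: mult.commute)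
    finally show ?thesis .
  qed
  finally have "L * emeasure lborel E \<le> 2 * (ennreal k * (emeasure lborel Z * (ennreal m * P)) + emeasure lborel Z * P)"
    by (simp add: mult_left_mono add_right_mono)
  also have "\<dots> = 2 * (emeasure lborel Z * ((ennreal k * ennreal m + 1) * P))"
    by (simp add: distrib_left distrib_right mult_ac)
  finally show ?thesis by (simp only: Z_def P_def)
qed

text \<open>Negligibility fails at every centre, so the averaging argument applies with \<open>L\<close> equal to \<open>\<gamma>\<close> times the
  lower bound for the capacity of a ball. In the resulting inequality the factor \<open>1 / (s (1 - s))\<close> of the cutoff
  function cancels against the factor \<open>s (1 - s)\<close> of the modulus estimate.\<close>
lemma cheeger_lower_at_radius:
  "\<exists>c>0. \<forall>s\<in>{0<..<1}. \<forall>\<gamma>\<in>{0<..<1}. \<forall>r>0. \<forall>\<Omega>::'a::euclidean_space set. open \<Omega> \<longrightarrow>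
     (\<forall>x0. \<not> negligible_cap s \<gamma> x0 r (cball x0 r - \<Omega>)) \<longrightarrow>
     ennreal (c / (s * (1 - s)) * \<gamma> * r powr - s) \<le> cheeger s \<Omega>"
proof -
  let ?N = "DIM('a)"
  obtain c0 where c0: "c0 > 0" and cap0: "\<forall>s\<in>{0<..<1}. \<forall>r>0. \<forall>x0::'a.
     ennreal (c0 * r powr (real ?N - s) / (s * (1 - s))) \<le> frac_cap s (cball x0 r) (ball x0 (2 * r))"
    using frac_cap_ball_lower[where 'a = 'a] by (elim exE conjE)
  obtain C where C: "C > 0" and K0: "\<forall>s\<in>{0<..<1}. \<forall>\<delta>>0. \<forall>M\<ge>0. \<forall>\<psi>::'a \<Rightarrow> real. \<psi> \<in> borel_measurable borel \<longrightarrow>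
     (\<forall>x y. \<bar>\<psi> x - \<psi> y\<bar> \<le> M * min 1 (dist x y / \<delta>)) \<longrightarrow>
     (\<forall>x. variation_at s \<psi> x \<le> ennreal (M * (C * \<delta> powr - s / (s * (1 - s)))))"
    using variation_at_Lipschitz_le[where 'a = 'a] by (elim exE conjE)
  obtain C' where C': "C' > 0" and D0: "\<forall>s\<in>{0<..<1}. \<forall>f\<in>borel_measurable borel. \<forall>h::'a.
     l1_modulus f h \<le> ennreal (C' * (s * (1 - s)) * norm h powr s) * gagliardo s f"
    using l1_modulus_le_gagliardo[where 'a = 'a] by (elim exE conjE)
  define \<omega> where "\<omega> = unit_ball_vol (real ?N)"
  have \<omega>: "0 < \<omega>" by (simp add: \<omega>_def)
  \<comment> \<open>The denominator collects the volume of the doubled ball divided by \<open>r ^ N\<close>, the cutoff constant \<open>C\<close>, the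
    modulus constant \<open>C'\<close> and the factor \<open>4 powr s \<le> 4\<close> from the two length scales \<open>r / 2\<close> and \<open>2 r\<close>.\<close>
  define c where "c = c0 / (2 * \<omega> * 2 ^ ?N * (4 * C * C' + 1))"
  have c: "0 < c" unfolding c_def using c0 C C' \<omega> by (intro divide_pos_pos mult_pos_pos add_pos_pos) auto
  have main: "ennreal (c / (s * (1 - s)) * \<gamma> * r powr - s) \<le> frac_perimeter s E / emeasure lborel E"
    if s: "s \<in> {0<..<1}" and \<gamma>: "\<gamma> \<in> {0<..<1}" and r: "r > 0" and \<Omega>: "open \<Omega>"
      and nn: "\<And>x0. \<not> negligible_cap s \<gamma> x0 r (cball x0 r - \<Omega>)"
      and E: "E \<noteq> {}" "open E" "compact (closure E)" "closure E \<subseteq> \<Omega>"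
    for s \<gamma> r and \<Omega> E :: "'a set"
  proof -
    have Em: "E \<in> sets borel" using E(2) by simp
    define q where "q = s * (1 - s)"
    have q: "0 < q" "q \<le> 1" using s mult_le_one[of s "1 - s"] by (auto simp: q_def)
    obtain d K' where d: "d > 0" "K' \<subseteq> \<Omega>" "\<And>x y. x \<in> closure E \<Longrightarrow> dist x y \<le> d \<Longrightarrow> y \<in> K'"
      using compact_enlarge[OF E(3) \<Omega> E(4)] by blast
    define k where "k = C * (r / 2) powr - s / q"
    have k: "0 \<le> k" using C q by (simp add: k_def)
    define m where "m = C' * q * (2 * r) powr s"
    have m: "0 \<le> m" using C' q by (simp add: m_def)
    define L where "L = ennreal (\<gamma> * (c0 * r powr (real ?N - s) / q))"
    have "L * emeasure lborel E \<le> 2 * (emeasure lborel (cball (0::'a) (2 * r)) * ((ennreal k * ennreal m + 1) * frac_perimeter s E))"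
    proof (rule average_over_centres[OF Em r k])
      fix h :: 'a assume h: "norm h \<le> 2 * r"
      have "l1_modulus (indicat_real E) h \<le> ennreal (C' * (s * (1 - s)) * norm h powr s) * gagliardo s (indicat_real E)"
        using D0 s Em by simp
      also have "\<dots> \<le> ennreal m * frac_perimeter s E"
        unfolding frac_perimeter_def m_def q_def using C' s h q
        by (intro mult_right_mono ennreal_leI mult_left_mono powr_mono2) auto
      finally show "l1_modulus (indicat_real E) h \<le> ennreal m * frac_perimeter s E" .
    next
      fix x0 :: 'a
      let ?v = "\<lambda>x. cutoff x0 (5/4 * r) (7/4 * r) x * (1 - indicat_real E x)"
      have ab: "5/4 * r < 7/4 * r" using r by simp
      have "compact (cball x0 r - \<Omega>)" using \<Omega> by (intro compact_diff) auto
      then have "\<not> frac_cap s (cball x0 r - \<Omega>) (ball x0 (2 * r)) \<le> ennreal \<gamma> * frac_cap s (cball x0 r) (ball x0 (2 * r))"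
        using nn[of x0] by (auto simp: negligible_cap_def)
      then have lt: "ennreal \<gamma> * frac_cap s (cball x0 r) (ball x0 (2 * r)) \<le> frac_cap s (cball x0 r - \<Omega>) (ball x0 (2 * r))"
        by simp
      have "L = ennreal \<gamma> * ennreal (c0 * r powr (real ?N - s) / q)"
        unfolding L_def using \<gamma> c0 q by (intro ennreal_mult) auto
      also have "\<dots> \<le> ennreal \<gamma> * frac_cap s (cball x0 r) (ball x0 (2 * r))"
        unfolding q_def using cap0 s r by (intro mult_left_mono) auto
      also note lt
      also have "frac_cap s (cball x0 r - \<Omega>) (ball x0 (2 * r)) \<le> gagliardo s ?v"
      proof (rule frac_cap_le_gagliardo[where K = "cball x0 (7/4 * r)" and e = "min d (r / 4)" and B = 1])
        show "?v \<in> borel_measurable borel" using Em by measurable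
        show "\<bar>?v x\<bar> \<le> 1" for x
          using cutoff_range[of x0 "5/4 * r" "7/4 * r" x] by (auto simp: indicator_def)
        show "cball x0 (7/4 * r) \<subseteq> ball x0 (2 * r)" using r by auto
        show "?v x = 0" if "x \<notin> cball x0 (7/4 * r)" for x
          using cutoff_eq_0[OF ab, of x x0] that by (simp add: dist_commute)
        show "0 < min d (r / 4)" using d r by simp
        fix x y assume x: "x \<in> cball x0 r - \<Omega>" and xy: "dist x y \<le> min d (r / 4)"
        have "y \<notin> closure E" using d(2) d(3)[of y x] x xy by (auto simp: dist_commute)
        then have "y \<notin> E" using closure_subset by blast
        moreover have "dist y x0 \<le> 5/4 * r"
          using x xy dist_triangle[of y x0 x] by (simp add: dist_commute)
        then have "cutoff x0 (5/4 * r) (7/4 * r) y = 1" by (rule cutoff_eq_1[OF ab])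
        ultimately show "1 \<le> ?v y" by (simp only:) simp
      qed auto
      also have "\<dots> \<le> 2 * (\<integral>\<^sup>+x. indicator (cball 0 (2 * r)) (x - x0) * (ennreal (1 - indicat_real E x) * ennreal k
         + (\<integral>\<^sup>+y. ennreal \<bar>indicat_real E y - indicat_real E x\<bar> * frac_kernel s (y - x) \<partial>lborel)) \<partial>lborel)"
      proof (rule gagliardo_cutoff_complement_le[OF Em r k])
        fix x
        have Lip: "\<forall>x y. \<bar>cutoff x0 (5/4 * r) (7/4 * r) x - cutoff x0 (5/4 * r) (7/4 * r) y\<bar> \<le> 1 * min 1 (dist x y / (r / 2))"
        proof (intro allI)
          fix x y
          have "7/4 * r - 5/4 * r = r / 2" by simp
          then show "\<bar>cutoff x0 (5/4 * r) (7/4 * r) x - cutoff x0 (5/4 * r) (7/4 * r) y\<bar> \<le> 1 * min 1 (dist x y / (r / 2))"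
            using cutoff_Lipschitz[OF ab, of x0 x y] by (simp only: mult_1_left)
        qed
        have "variation_at s (cutoff x0 (5/4 * r) (7/4 * r)) x
          \<le> ennreal (1 * (C * (r / 2) powr - s / (s * (1 - s))))"
          using K0[rule_format, OF s _ _ cutoff_measurable Lip[rule_format], of x] r by simp
        then show "variation_at s (cutoff x0 (5/4 * r) (7/4 * r)) x \<le> ennreal k"
          by (simp add: k_def q_def)
      qed
      finally show "L \<le> 2 * (\<integral>\<^sup>+x. indicator (cball 0 (2 * r)) (x - x0) * (ennreal (1 - indicat_real E x) * ennreal k
         + (\<integral>\<^sup>+y. ennreal \<bar>indicat_real E y - indicat_real E x\<bar> * frac_kernel s (y - x) \<partial>lborel)) \<partial>lborel)" .
    qed
    also have "2 * (emeasure lborel (cball (0::'a) (2 * r)) * ((ennreal k * ennreal m + 1) * frac_perimeter s E))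
       = ennreal (2 * (\<omega> * (2 * r) ^ ?N) * (k * m + 1)) * frac_perimeter s E"
    proof -
      have "emeasure lborel (cball (0::'a) (2 * r)) = ennreal (\<omega> * (2 * r) ^ ?N)"
        using r by (simp add: emeasure_ball_dim \<omega>_def)
      moreover have "ennreal k * ennreal m + 1 = ennreal (k * m + 1)"
        using k m by (simp add: ennreal_mult ennreal_plus)
      ultimately show ?thesis
        using \<omega> r k m by (simp add: ennreal_mult mult.assoc)
    qed
    also have "\<dots> \<le> ennreal (2 * (\<omega> * (2 * r) ^ ?N) * (4 * C * C' + 1)) * frac_perimeter s E"
    proof (intro mult_right_mono ennreal_leI mult_left_mono add_mono)
      have e4: "(r / 2) powr - s * (2 * r) powr s = 4 powr s"
      proof -
        have "(2 * r) powr s = 4 powr s * (r / 2) powr s" using r by (subst powr_mult[symmetric]) simp_all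
        then show ?thesis using r by (simp add: powr_minus field_simps)
      qed
      have "k * m = C * C' * ((r / 2) powr - s * (2 * r) powr s)"
        using q by (simp add: k_def m_def field_simps)
      also have "\<dots> \<le> C * C' * 4"
        unfolding e4 using C C' s powr_mono[of s 1 "4::real"] by (intro mult_left_mono) auto
      finally show "k * m \<le> 4 * C * C'" by simp
    qed (use \<omega> r in auto)
    finally have fin: "L * emeasure lborel E \<le> ennreal (2 * (\<omega> * (2 * r) ^ ?N) * (4 * C * C' + 1)) * frac_perimeter s E" .
    define B where "B = 2 * (\<omega> * (2 * r) ^ ?N) * (4 * C * C' + 1)"
    have B: "0 < B" unfolding B_def using \<omega> r C C' by (intro mult_pos_pos add_pos_pos) auto
    have "ennreal (c / (s * (1 - s)) * \<gamma> * r powr - s) = ennreal (1 / B) * L"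
    proof -
      have "r powr (real ?N - s) = r ^ ?N * r powr - s" using r by (simp add: powr_diff powr_realpow powr_minus divide_inverse)
      then have "c / (s * (1 - s)) * \<gamma> * r powr - s = 1 / B * (\<gamma> * (c0 * r powr (real ?N - s) / q))"
        using r q \<omega> C C' unfolding B_def c_def q_def[symmetric] power_mult_distrib
        by (simp only: divide_inverse inverse_mult_distrib mult_1_left mult_ac) simp
      then show ?thesis unfolding L_def using B \<gamma> c0 q by (simp only: ennreal_mult[symmetric] zero_le_divide_1_iff less_imp_le) (subst ennreal_mult, auto)
    qed
    then have "ennreal (c / (s * (1 - s)) * \<gamma> * r powr - s) * emeasure lborel E = ennreal (1 / B) * (L * emeasure lborel E)"
      by (simp add: mult.assoc)
    also have "\<dots> \<le> ennreal (1 / B) * (ennreal B * frac_perimeter s E)"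
      using fin unfolding B_def by (intro mult_left_mono) auto
    also have "\<dots> = frac_perimeter s E"
      using B by (simp add: mult.assoc[symmetric] ennreal_mult[symmetric])
    finally show ?thesis
    proof (rule ennreal_le_divideI)
      show "emeasure lborel E \<noteq> 0" using emeasure_open_pos[OF E(2,1)] by simp
      show "emeasure lborel E \<noteq> top"
        using emeasure_bounded_finite[of E] bounded_subset[OF compact_imp_bounded[OF E(3)] closure_subset] by auto
    qed
  qed
  show ?thesis
  proof (intro exI[of _ c] conjI ballI allI impI)
    fix s \<gamma> r :: real and \<Omega> :: "'a set"
    assume *: "s \<in> {0<..<1}" "\<gamma> \<in> {0<..<1}" "0 < r" "open \<Omega>" "\<forall>x0. \<not> negligible_cap s \<gamma> x0 r (cball x0 r - \<Omega>)"
    show "ennreal (c / (s * (1 - s)) * \<gamma> * r powr - s) \<le> cheeger s \<Omega>"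
      unfolding cheeger_def
    proof (rule Inf_greatest, elim CollectE exE conjE)
      fix z E assume E: "z = frac_perimeter s E / emeasure lborel E" "E \<noteq> {}" "open E" "compact (closure E)" "closure E \<subseteq> \<Omega>"
      show "ennreal (c / (s * (1 - s)) * \<gamma> * r powr - s) \<le> z"
        unfolding E(1) by (rule main[OF *(1-4) *(5)[rule_format] E(2-5)])
    qed
  qed (rule c)
qed

section \<open>Coarea formula, generic level sets and the Cheeger constant of functions\<close>

text \<open>Integrate \<open>|f x - f y| = \<integral> |1(f x > t) - 1(f y > t)| dt\<close> against the kernel.\<close>
lemma coarea_gagliardo:
  fixes f :: "'a::euclidean_space \<Rightarrow> real"
  assumes [measurable]: "f \<in> borel_measurable borel"
  shows "(\<integral>\<^sup>+t. frac_perimeter s {x. t < f x} \<partial>lborel) = gagliardo s f"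
proof -
  define J where "J = (\<lambda>t z. if t < f z then 1 else 0 :: real)"
  have [measurable]: "(\<lambda>w. J (fst w) (snd w)) \<in> borel_measurable (lborel \<Otimes>\<^sub>M lborel)"
    unfolding J_def by measurable
  have Jm: "(\<lambda>w. J (a w) (b w)) \<in> borel_measurable M" if "a \<in> borel_measurable M" "b \<in> borel_measurable M" for a b and M :: "'c measure"
  proof -
    have [measurable]: "a \<in> borel_measurable M" "b \<in> borel_measurable M" by fact+
    show ?thesis unfolding J_def by measurable
  qed
  note [measurable] = Jm
  have len: "(\<integral>\<^sup>+t. ennreal \<bar>J t x - J t y\<bar> \<partial>lborel) = ennreal \<bar>f x - f y\<bar>" for x y
  proof -
    have "ennreal \<bar>J t x - J t y\<bar> = indicator {min (f x) (f y)..<max (f x) (f y)} t" for t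
      by (auto simp: J_def indicator_def min_def max_def)
    then have "(\<integral>\<^sup>+t. ennreal \<bar>J t x - J t y\<bar> \<partial>lborel) = emeasure lborel {min (f x) (f y)..<max (f x) (f y)}"
      by simp
    also have "\<dots> = ennreal (max (f x) (f y) - min (f x) (f y))" by simp
    also have "max (f x) (f y) - min (f x) (f y) = \<bar>f x - f y\<bar>" by auto
    finally show ?thesis .
  qed
  have "(\<integral>\<^sup>+t. frac_perimeter s {x. t < f x} \<partial>lborel)
    = (\<integral>\<^sup>+t. (\<integral>\<^sup>+y. (\<integral>\<^sup>+x. ennreal \<bar>J t x - J t y\<bar> * frac_kernel s (x - y) \<partial>lborel) \<partial>lborel) \<partial>lborel)"
  proof -
    have "indicat_real {x. t < f x} z = J t z" for t z by (simp add: J_def)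
    then show ?thesis by (simp only: frac_perimeter_def gagliardo_frac_kernel)
  qed
  also have "\<dots> = (\<integral>\<^sup>+y. (\<integral>\<^sup>+t. (\<integral>\<^sup>+x. ennreal \<bar>J t x - J t y\<bar> * frac_kernel s (x - y) \<partial>lborel) \<partial>lborel) \<partial>lborel)"
    by (rule nn_integral_swap) measurable
  also have "\<dots> = (\<integral>\<^sup>+y. (\<integral>\<^sup>+x. (\<integral>\<^sup>+t. ennreal \<bar>J t x - J t y\<bar> * frac_kernel s (x - y) \<partial>lborel) \<partial>lborel) \<partial>lborel)"
    by (intro nn_integral_cong nn_integral_swap) measurable
  also have "\<dots> = gagliardo s f"
    unfolding gagliardo_frac_kernel by (intro nn_integral_cong) (simp add: nn_integral_multc len)
  finally show ?thesis .
qed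

lemma layer_cake:
  fixes f :: "'a::euclidean_space \<Rightarrow> real"
  assumes [measurable]: "f \<in> borel_measurable borel"
  shows "(\<integral>\<^sup>+t. emeasure lborel {x. t < f x} * indicator {\<delta><..} t \<partial>lborel) = (\<integral>\<^sup>+x. ennreal (f x - \<delta>) \<partial>lborel)"
proof -
  define J where "J = (\<lambda>t z. if \<delta> < t \<and> t < f z then 1 else 0 :: ennreal)"
  have "(\<integral>\<^sup>+t. emeasure lborel {x. t < f x} * indicator {\<delta><..} t \<partial>lborel) = (\<integral>\<^sup>+t. (\<integral>\<^sup>+x. J t x \<partial>lborel) \<partial>lborel)"
  proof (rule nn_integral_cong)
    fix t
    show "emeasure lborel {x. t < f x} * indicator {\<delta><..} t = (\<integral>\<^sup>+x. J t x \<partial>lborel)"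
    proof (cases "\<delta> < t")
      case True
      then have "J t x = indicator {x. t < f x} x" for x by (simp add: J_def)
      then show ?thesis using True by simp
    qed (simp add: J_def)
  qed
  also have "\<dots> = (\<integral>\<^sup>+x. (\<integral>\<^sup>+t. J t x \<partial>lborel) \<partial>lborel)"
    unfolding J_def by (rule nn_integral_swap) measurable
  also have "\<dots> = (\<integral>\<^sup>+x. ennreal (f x - \<delta>) \<partial>lborel)"
  proof (rule nn_integral_cong)
    fix x
    have "J t x = indicator {\<delta><..<f x} t" for t by (simp add: J_def)
    then have "(\<integral>\<^sup>+t. J t x \<partial>lborel) = emeasure lborel {\<delta><..<f x}" by simp
    also have "\<dots> = ennreal (f x - \<delta>)" by (cases "\<delta> \<le> f x") (auto simp: ennreal_neg)
    finally show "(\<integral>\<^sup>+t. J t x \<partial>lborel) = ennreal (f x - \<delta>)" .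
  qed
  finally show ?thesis .
qed

text \<open>A linear function, cut off far away so that it is integrable and has finite seminorm.\<close>
definition tilt :: "real \<Rightarrow> 'a::euclidean_space \<Rightarrow> 'a \<Rightarrow> real" where
  "tilt R a x = cutoff 0 (R + 1) (R + 2) x * (a \<bullet> x)"

lemma tilt_measurable [measurable]: "tilt R a \<in> borel_measurable borel"
  unfolding tilt_def[abs_def] by measurable

lemma tilt_outside: "R + 2 \<le> norm x \<Longrightarrow> tilt R a x = 0"
  by (simp add: tilt_def cutoff_eq_0 dist_norm)

lemma tilt_bound:
  assumes "0 \<le> R"
  shows "\<bar>tilt R a x\<bar> \<le> norm a * (R + 2)"
proof (cases "norm x \<le> R + 2")
  case True
  have "\<bar>tilt R a x\<bar> \<le> 1 * (norm a * norm x)"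
    unfolding tilt_def abs_mult using cutoff_range[of 0 "R + 1" "R + 2" x] Cauchy_Schwarz_ineq2[of a x]
    by (intro mult_mono) auto
  also have "\<dots> \<le> norm a * (R + 2)" using True by (simp add: mult_left_mono)
  finally show ?thesis .
qed (use assms in \<open>simp add: tilt_outside\<close>)

lemma tilt_Lipschitz:
  assumes "0 \<le> R"
  shows "\<bar>tilt R a x - tilt R a y\<bar> \<le> norm a * (2 * (R + 4)) * min 1 (dist x y / 1)"
proof -
  let ?l = "cutoff 0 (R + 1) (R + 2)"
  have b: "\<bar>tilt R a x - tilt R a y\<bar> \<le> norm a * (2 * (R + 4))"
  proof -
    have "\<bar>tilt R a x - tilt R a y\<bar> \<le> norm a * (R + 2) + norm a * (R + 2)"
      using tilt_bound[OF assms, of a x] tilt_bound[OF assms, of a y] by linarith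
    also have "\<dots> = norm a * (2 * (R + 2))" by (simp add: algebra_simps)
    also have "\<dots> \<le> norm a * (2 * (R + 4))" by (intro mult_left_mono) auto
    finally show ?thesis .
  qed
  have "\<bar>tilt R a x - tilt R a y\<bar> \<le> norm a * (2 * (R + 4)) * dist x y"
  proof (cases "norm x \<le> R + 3")
    case True
    have "tilt R a x - tilt R a y = (?l x - ?l y) * (a \<bullet> x) + ?l y * (a \<bullet> (x - y))"
      by (simp add: tilt_def algebra_simps)
    also have "\<bar>\<dots>\<bar> \<le> \<bar>?l x - ?l y\<bar> * \<bar>a \<bullet> x\<bar> + \<bar>?l y\<bar> * \<bar>a \<bullet> (x - y)\<bar>"
      unfolding abs_mult[symmetric] by (rule abs_triangle_ineq)
    also have "\<dots> \<le> dist x y * (norm a * (R + 3)) + 1 * (norm a * dist x y)"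
    proof (intro add_mono mult_mono)
      show "\<bar>?l x - ?l y\<bar> \<le> dist x y" using cutoff_Lipschitz[of "R + 1" "R + 2" 0 x y] by simp
      show "\<bar>a \<bullet> x\<bar> \<le> norm a * (R + 3)"
        using Cauchy_Schwarz_ineq2[of a x] mult_left_mono[OF True, of "norm a"] by simp
      show "\<bar>?l y\<bar> \<le> 1" using cutoff_range[of 0 "R + 1" "R + 2" y] by simp
      show "\<bar>a \<bullet> (x - y)\<bar> \<le> norm a * dist x y" using Cauchy_Schwarz_ineq2[of a "x - y"] by (simp add: dist_norm)
    qed (use assms in auto)
    also have "\<dots> = norm a * (R + 4) * dist x y" by (simp add: algebra_simps)
    also have "\<dots> \<le> norm a * (2 * (R + 4)) * dist x y" using assms by (intro mult_right_mono mult_left_mono) auto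
    finally show ?thesis .
  next
    case x: False
    then have tx: "tilt R a x = 0" by (intro tilt_outside) simp
    show ?thesis
    proof (cases "norm y \<le> R + 2")
      case True
      have d: "1 \<le> dist x y" using x True norm_triangle_ineq2[of x y] by (simp add: dist_norm)
      have "norm a * (2 * (R + 4)) * 1 \<le> norm a * (2 * (R + 4)) * dist x y"
        using d assms by (intro mult_left_mono) auto
      then show ?thesis using b by simp
    next
      case False
      then show ?thesis using tx assms tilt_outside[of R y a] by simp
    qed
  qed
  with b show ?thesis by (simp add: min_def)
qed

text \<open>The mollified tilt is affine on the ball of radius \<open>R\<close>. The shift by the centre of mass of \<open>\<rho>\<close> does not depend
  on \<open>a\<close>, which allows it to be absorbed into the map whose image is the set of bad pairs.\<close>
lemma conv_tilt:
  fixes \<rho> :: "'a::euclidean_space \<Rightarrow> real"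
  assumes \<rho>: "mollifier e \<rho>" and e: "e \<le> 1" and x: "norm x \<le> R"
  shows "conv \<rho> (tilt R a) x = a \<bullet> (x - (\<integral>k. \<rho> k *\<^sub>R k \<partial>lborel))"
proof -
  have [measurable]: "\<rho> \<in> borel_measurable borel" by (rule mollifier_measurable[OF \<rho>])
  have int: "integrable lborel (\<lambda>k. \<rho> k *\<^sub>R k)"
  proof (rule Bochner_Integration.integrable_bound)
    show "integrable lborel \<rho>" by (rule mollifierD(4)[OF \<rho>])
    show "AE k in lborel. norm (\<rho> k *\<^sub>R k) \<le> norm (\<rho> k)"
    proof (rule AE_I2)
      fix k show "norm (\<rho> k *\<^sub>R k) \<le> norm (\<rho> k)"
        using mollifierD(3)[OF \<rho>, of k] e mult_left_le[of "norm k" "\<bar>\<rho> k\<bar>"] by (cases "norm k \<le> e") auto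
    qed
  qed measurable
  have "conv \<rho> (tilt R a) x = (\<integral>k. \<rho> k * tilt R a (x - k) \<partial>lborel)"
    by (rule conv_alt[OF \<rho>]) measurable
  also have "\<dots> = (\<integral>k. (a \<bullet> x) * \<rho> k - a \<bullet> (\<rho> k *\<^sub>R k) \<partial>lborel)"
  proof (rule Bochner_Integration.integral_cong[OF refl])
    fix k
    show "\<rho> k * tilt R a (x - k) = (a \<bullet> x) * \<rho> k - a \<bullet> (\<rho> k *\<^sub>R k)"
    proof (cases "norm k \<le> e")
      case True
      have "norm (x - k) \<le> R + 1" using True e x norm_triangle_ineq4[of x k] by linarith
      then have "tilt R a (x - k) = a \<bullet> (x - k)" by (simp add: tilt_def cutoff_eq_1 dist_norm)
      then show ?thesis by (simp only: inner_diff_right inner_scaleR_right right_diff_distrib mult.commute)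
    next
      case False
      then show ?thesis using mollifierD(3)[OF \<rho>, of k] by simp
    qed
  qed
  also have "\<dots> = (\<integral>k. (a \<bullet> x) * \<rho> k \<partial>lborel) - (\<integral>k. a \<bullet> (\<rho> k *\<^sub>R k) \<partial>lborel)"
    using mollifierD(4)[OF \<rho>] integrable_inner_right[OF int]
    by (intro Bochner_Integration.integral_diff) auto
  also have "(\<integral>k. a \<bullet> (\<rho> k *\<^sub>R k) \<partial>lborel) = a \<bullet> (\<integral>k. \<rho> k *\<^sub>R k \<partial>lborel)"
    using int by (rule integral_inner_right)
  also have "(\<integral>k. (a \<bullet> x) * \<rho> k \<partial>lborel) = a \<bullet> x"
    using mollifierD(5)[OF \<rho>] by simp
  finally show ?thesis by (simp add: inner_diff_right)
qed

text \<open>If \<open>t\<close> is the value of \<open>x \<mapsto> f x - a \<bullet> (x - c)\<close> at a critical point \<open>x\<close>, then \<open>a\<close> is the gradient of \<open>f\<close> at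
  \<open>x\<close> and \<open>t\<close> is determined by \<open>x\<close>. So the bad pairs \<open>(a, t)\<close> form the image of a differentiable map into a
  space of one dimension more, which is a null set; Fubini's theorem gives the claim.\<close>
lemma AE_regular_tilt:
  fixes f :: "'a::euclidean_space \<Rightarrow> real" and c :: 'a
  assumes f: "Ck_on 2 UNIV f"
  shows "AE a in lborel. AE t in (lborel :: real measure). \<forall>x. (\<forall>v. frechet_derivative f (at x) v = a \<bullet> v) \<longrightarrow> t \<noteq> f x - a \<bullet> (x - c)"
proof -
  define G where "G = (\<lambda>x. \<Sum>b\<in>Basis. frechet_derivative f (at x) b *\<^sub>R b)"
  define H where "H = (\<lambda>x. (G x, f x - G x \<bullet> (x - c)))"
  have f1: "Ck_on (Suc (Suc 0)) UNIV f" using f by (simp add: numeral_2_eq_2)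
  have fd: "f differentiable (at x)" for x using f1 by simp
  have Gd: "G differentiable (at x)" for x
    unfolding G_def
  proof (intro differentiable_sum differentiable_scaleR differentiable_const finite_Basis ballI)
    fix b :: 'a
    have "Ck_on (Suc 0) UNIV (\<lambda>x. frechet_derivative f (at x) b)" by (rule Ck_on_Suc_D(2)[OF f1])
    then show "(\<lambda>x. frechet_derivative f (at x) b) differentiable at x" by simp
  qed
  have Hd: "H differentiable (at x)" for x
  proof -
    obtain f' G' where "(f has_derivative f') (at x)" "(G has_derivative G') (at x)"
      using fd[of x] Gd[of x] unfolding differentiable_def by blast
    note d = this
    have "((\<lambda>x. G x \<bullet> (x - c)) has_derivative (\<lambda>h. G x \<bullet> h + G' h \<bullet> (x - c))) (at x)"
      using has_derivative_inner[OF d(2) has_derivative_diff[OF has_derivative_ident has_derivative_const[of c]]] by simp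
    from has_derivative_Pair[OF d(2) has_derivative_diff[OF d(1) this]]
    have "(H has_derivative (\<lambda>h. (G' h, f' h - (G x \<bullet> h + G' h \<bullet> (x - c))))) (at x)"
      unfolding H_def .
    then show ?thesis unfolding differentiable_def by blast
  qed
  have "negligible (H ` UNIV)"
  proof (rule negligible_differentiable_image_lowdim)
    show "H differentiable_on UNIV" unfolding differentiable_on_def using Hd by simp
  qed simp
  then have "H ` UNIV \<in> null_sets (completion lborel)" by (simp add: negligible_iff_null_sets)
  then obtain N where N: "N \<in> null_sets lborel" "H ` UNIV \<subseteq> N"
    unfolding null_sets_completion_iff2 by (elim bexE)
  have "AE z in (lborel :: 'a measure) \<Otimes>\<^sub>M (lborel :: real measure). z \<notin> N"
    unfolding lborel_prod by (rule AE_not_in[OF N(1)])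
  from lborel_pair.AE_pair[OF this]
  have "AE a in lborel. AE t in lborel. (a, t) \<notin> N" .
  then show ?thesis
  proof (rule eventually_mono)
    fix a assume "AE t in lborel. (a, t) \<notin> N"
    then show "AE t in lborel. \<forall>x. (\<forall>v. frechet_derivative f (at x) v = a \<bullet> v) \<longrightarrow> t \<noteq> f x - a \<bullet> (x - c)"
    proof (rule eventually_mono, intro allI impI notI)
      fix t x assume n: "(a, t) \<notin> N" and d: "\<forall>v. frechet_derivative f (at x) v = a \<bullet> v" and t: "t = f x - a \<bullet> (x - c)"
      have "G x = a" unfolding G_def using d by (simp add: euclidean_representation)
      then have "(a, t) = H x" using t by (simp add: H_def)
      then show False using n N(2) by blast
    qed
  qed
qed

text \<open>Near a boundary point the function \<open>t - f\<close> is the required defining function, on the open set where a fixed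
  directional derivative of \<open>f\<close> is nonzero.\<close>
lemma smooth_boundary_superlevel:
  fixes f :: "'a::euclidean_space \<Rightarrow> real"
  assumes f: "smooth_on UNIV f"
    and reg: "\<And>p. p \<in> closure {x. t < f x} \<Longrightarrow> f p = t \<Longrightarrow> \<exists>v. frechet_derivative f (at p) v \<noteq> 0"
  shows "smooth_boundary {x. t < f x}"
  unfolding smooth_boundary_def
proof (rule ballI)
  have Ck: "Ck_on k UNIV f" for k using f by (simp add: smooth_on_def)
  have cont: "continuous_on UNIV f" using Ck[of 0] by simp
  have der: "(f has_derivative frechet_derivative f (at x)) (at x)" for x by (rule Ck_on_Suc_D(1)[OF Ck])
  have cD: "continuous_on UNIV (\<lambda>x. frechet_derivative f (at x) v)" for v using Ck[of "Suc 0"] by simp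
  fix p assume p: "p \<in> frontier {x. t < f x}"
  have op: "open {x. t < f x}" using cont by (intro open_Collect_less) auto
  have pc: "p \<in> closure {x. t < f x}" and "\<not> t < f p"
    using p op by (auto simp: frontier_def interior_open)
  moreover have "closure {x. t < f x} \<subseteq> {x. t \<le> f x}"
    using cont by (intro closure_minimal closed_Collect_le) auto
  ultimately have "f p = t" by force
  then obtain v where v: "frechet_derivative f (at p) v \<noteq> 0" using reg[OF pc] by blast
  define U where "U = {x. frechet_derivative f (at x) v \<noteq> 0}"
  define g where "g = (\<lambda>x. t + (- 1) * f x)"
  have gd: "(g has_derivative (\<lambda>w. - frechet_derivative f (at x) w)) (at x)" for x
    unfolding g_def using der[of x] by (auto intro!: derivative_eq_intros)
  show "\<exists>U g. open U \<and> p \<in> U \<and> smooth_on U g \<and> (\<forall>x\<in>U. frechet_derivative g (at x) \<noteq> (\<lambda>v. 0)) \<and> {x. t < f x} \<inter> U = {x \<in> U. g x < 0}"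
  proof (intro exI conjI)
    show "open U" unfolding U_def using cD by (intro open_Collect_neq) auto
    show "p \<in> U" using v by (simp add: U_def)
    have "Ck_on k UNIV g" for k unfolding g_def by (intro Ck_on_add Ck_on_mult Ck_on_const Ck)
    then show "smooth_on U g" unfolding smooth_on_def using Ck_on_subset by blast
    show "\<forall>x\<in>U. frechet_derivative g (at x) \<noteq> (\<lambda>v. 0)"
    proof
      fix x assume x: "x \<in> U"
      have "frechet_derivative g (at x) = (\<lambda>w. - frechet_derivative f (at x) w)"
        using frechet_derivative_at[OF gd[of x]] by simp
      then have "frechet_derivative g (at x) v \<noteq> 0" using x by (simp add: U_def)
      then show "frechet_derivative g (at x) \<noteq> (\<lambda>v. 0)" by metis
    qed
    show "{x. t < f x} \<inter> U = {x \<in> U. g x < 0}" by (auto simp: g_def)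
  qed
qed

lemma cheeger_le_competitor:
  assumes "open E" "smooth_boundary E" "compact (closure E)" "closure E \<subseteq> \<Omega>"
  shows "cheeger s \<Omega> * emeasure lborel E \<le> frac_perimeter s E"
proof (cases "E = {}")
  case False
  have "cheeger s \<Omega> \<le> frac_perimeter s E / emeasure lborel E"
    unfolding cheeger_def using assms False by (intro Inf_lower) auto
  then have "cheeger s \<Omega> * emeasure lborel E \<le> frac_perimeter s E / emeasure lborel E * emeasure lborel E"
    by (rule mult_right_mono) simp
  also have "\<dots> = frac_perimeter s E * emeasure lborel E / emeasure lborel E"
    by (simp add: ennreal_times_divide mult.commute)
  also have "\<dots> = frac_perimeter s E"
  proof (rule ennreal_mult_divide_eq)
    show "emeasure lborel E \<noteq> 0" using emeasure_open_pos[OF assms(1) False] by simp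
    show "emeasure lborel E \<noteq> top"
      using emeasure_bounded_finite[of E] bounded_subset[OF compact_imp_bounded[OF assms(3)] closure_subset] by auto
  qed
  finally show ?thesis .
qed simp

lemma ennreal_le_eps:
  fixes X Y Z :: ennreal
  assumes "\<And>\<eta>. 0 < \<eta> \<Longrightarrow> X \<le> Y + ennreal \<eta> * Z" "Z \<noteq> top"
  shows "X \<le> Y"
proof (rule ennreal_le_epsilon)
  fix e :: real assume e: "0 < e"
  obtain z where z: "Z = ennreal z" "0 \<le> z" using assms(2) by (cases Z) auto
  have "X \<le> Y + ennreal (e / (z + 1)) * Z" using assms(1)[of "e / (z + 1)"] e z by simp
  also have "ennreal (e / (z + 1)) * Z = ennreal (e * (z / (z + 1)))"
    using z e by (simp add: ennreal_mult[symmetric])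
  also have "\<dots> \<le> ennreal e"
    using z e by (intro ennreal_leI mult_left_le) auto
  finally show "X \<le> Y + ennreal e" by (simp add: add_left_mono)
qed

text \<open>The superlevel sets of the mollification of \<open>g - tilt R a\<close> at levels above the supremum of the tilt are
  contained in \<open>K'\<close>, and almost all of them have smooth boundary. So they are competitors, and the coarea formula
  applies to these levels. Cutting off the low levels and removing the tilt each cost at most
  \<open>norm a * (R + 2)\<close> in the integrand.\<close>
lemma cheeger_tilted:
  fixes g :: "'a::euclidean_space \<Rightarrow> real"
  assumes g[measurable]: "g \<in> borel_measurable borel" and g01: "\<And>x. 0 \<le> g x" "\<And>x. g x \<le> 1"
    and \<rho>: "mollifier m \<rho>" and m: "m \<le> 1"
    and K: "compact K" "\<And>x. x \<notin> K \<Longrightarrow> g x = 0"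
    and K': "compact K'" "K' \<subseteq> \<Omega>" "\<And>x. x \<notin> K' \<Longrightarrow> conv \<rho> g x = 0" and R: "0 \<le> R" "K' \<subseteq> ball 0 R"
    and a: "AE t in lborel. \<forall>x. (\<forall>v. frechet_derivative (conv \<rho> g) (at x) v = a \<bullet> v) \<longrightarrow>
      t \<noteq> conv \<rho> g x - a \<bullet> (x - (\<integral>k. \<rho> k *\<^sub>R k \<partial>lborel))"
  shows "cheeger s \<Omega> * (\<integral>\<^sup>+x. ennreal (conv \<rho> g x - 2 * (norm a * (R + 2))) \<partial>lborel)
     \<le> gagliardo s g + gagliardo s (tilt R a)"
proof -
  define c where "c = (\<integral>k. \<rho> k *\<^sub>R k \<partial>lborel)"
  define \<delta> where "\<delta> = norm a * (R + 2)"
  define f0 where "f0 = conv \<rho> g"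
  define ga where "ga = (\<lambda>x. g x - tilt R a x)"
  define f where "f = conv \<rho> ga"
  have gb: "\<bar>g x\<bar> \<le> 1" for x using g01[of x] by simp
  have tb: "\<bar>tilt R a x\<bar> \<le> \<delta>" for x unfolding \<delta>_def by (rule tilt_bound[OF R(1)])
  have ig: "integrable lborel g" by (rule integrable_bounded_compact[OF g gb K])
  have it: "integrable lborel (tilt R a)"
    by (rule integrable_bounded_compact[OF tilt_measurable tb compact_cball[of 0 "R + 2"]]) (auto intro: tilt_outside)
  have iga: "integrable lborel ga" unfolding ga_def by (rule Bochner_Integration.integrable_diff[OF ig it])
  have gab: "\<bar>ga x\<bar> \<le> 1 + \<delta>" for x unfolding ga_def using gb[of x] tb[of x] by linarith
  have f_eq: "f x = f0 x - conv \<rho> (tilt R a) x" for x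
    unfolding f_def f0_def ga_def conv_alt[OF \<rho> g] conv_alt[OF \<rho> tilt_measurable]
    using conv_integrable_bounded[OF \<rho> g gb] conv_integrable_bounded[OF \<rho> tilt_measurable tb]
    by (subst conv_alt[OF \<rho>]) (simp_all add: right_diff_distrib)
  have ct: "\<bar>conv \<rho> (tilt R a) x\<bar> \<le> \<delta>" for x
    using conv_le[OF \<rho> tilt_measurable tb, of x \<delta>] conv_ge[OF \<rho> tilt_measurable tb, of x "- \<delta>"] tb abs_le_iff
    by (meson abs_le_D1 minus_le_iff abs_le_D2)
  have sf: "smooth_on UNIV f" unfolding f_def by (rule smooth_conv[OF \<rho> iga])
  have sf0: "smooth_on UNIV f0" unfolding f0_def by (rule smooth_conv[OF \<rho> ig])
  have fm[measurable]: "f \<in> borel_measurable borel" unfolding f_def by (rule conv_measurable[OF \<rho> iga])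
  have f0m[measurable]: "f0 \<in> borel_measurable borel" unfolding f0_def by (rule conv_measurable[OF \<rho> ig])
  have cont: "continuous_on UNIV f" using sf unfolding smooth_on_def by (metis Ck_on.simps(1))
  have sub: "{x. t < f x} \<subseteq> K'" if "\<delta> < t" for t
  proof
    fix x assume "x \<in> {x. t < f x}"
    then have "t < f0 x - conv \<rho> (tilt R a) x" by (simp add: f_eq)
    then have "f0 x \<noteq> 0" using ct[of x] that by linarith
    then show "x \<in> K'" using K'(3) by (auto simp: f0_def)
  qed
  have ad: "AE t in lborel. \<delta> < t \<longrightarrow> cheeger s \<Omega> * emeasure lborel {x. t < f x} \<le> frac_perimeter s {x. t < f x}"
  proof (rule eventually_mono[OF a], rule impI)
    fix t assume good: "\<forall>x. (\<forall>v. frechet_derivative (conv \<rho> g) (at x) v = a \<bullet> v) \<longrightarrow>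
      t \<noteq> conv \<rho> g x - a \<bullet> (x - (\<integral>k. \<rho> k *\<^sub>R k \<partial>lborel))" and t: "\<delta> < t"
    have cl: "closure {x. t < f x} \<subseteq> K'" using sub[OF t] K'(1) by (intro closure_minimal) (auto simp: compact_imp_closed)
    show "cheeger s \<Omega> * emeasure lborel {x. t < f x} \<le> frac_perimeter s {x. t < f x}"
    proof (rule cheeger_le_competitor)
      show "open {x. t < f x}" using cont by (intro open_Collect_less) auto
      show "compact (closure {x. t < f x})"
        using compact_Int_closed[OF K'(1) closed_closure, of "{x. t < f x}"] cl by (simp only: Int_absorb1)
      show "closure {x. t < f x} \<subseteq> \<Omega>" using cl K'(2) by blast
      show "smooth_boundary {x. t < f x}"
      proof (rule smooth_boundary_superlevel[OF sf], rule ccontr)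
        fix p assume p: "p \<in> closure {x. t < f x}" and fp: "f p = t" and "\<nexists>v. frechet_derivative f (at p) v \<noteq> 0"
        then have z: "frechet_derivative f (at p) v = 0" for v by blast
        have pR: "p \<in> ball 0 R" using p cl R(2) by blast
        have loc: "f x = f0 x - a \<bullet> (x - c)" if "x \<in> ball 0 R" for x
          using conv_tilt[OF \<rho> m, of x R a] that by (simp add: f_eq c_def)
        have d0: "(f0 has_derivative frechet_derivative f0 (at p)) (at p)"
          using sf0 unfolding smooth_on_def by (intro Ck_on_Suc_D(1)[of 0]) blast
        have "((\<lambda>x. f0 x - a \<bullet> (x - c)) has_derivative (\<lambda>v. frechet_derivative f0 (at p) v - a \<bullet> v)) (at p)"
          by (rule has_derivative_diff[OF d0]) (auto intro!: derivative_eq_intros)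
        then have "(f has_derivative (\<lambda>v. frechet_derivative f0 (at p) v - a \<bullet> v)) (at p)"
          by (rule has_derivative_transform_within_open[of _ _ _ _ "ball 0 R"]) (use pR loc in auto)
        from frechet_derivative_at[OF this]
        have "frechet_derivative f (at p) v = frechet_derivative f0 (at p) v - a \<bullet> v" for v by metis
        then have "\<forall>v. frechet_derivative f0 (at p) v = a \<bullet> v" using z by simp
        then have "t \<noteq> f0 p - a \<bullet> (p - c)" using good by (simp add: f0_def c_def)
        then show False using loc[OF pR] fp by simp
      qed
    qed
  qed
  have "cheeger s \<Omega> * (\<integral>\<^sup>+x. ennreal (f0 x - 2 * \<delta>) \<partial>lborel) \<le> cheeger s \<Omega> * (\<integral>\<^sup>+x. ennreal (f x - \<delta>) \<partial>lborel)"
  proof (intro mult_left_mono nn_integral_mono ennreal_leI)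
    fix x show "f0 x - 2 * \<delta> \<le> f x - \<delta>" using ct[of x] by (simp add: f_eq)
  qed simp
  also have "\<dots> = (\<integral>\<^sup>+t. cheeger s \<Omega> * (emeasure lborel {x. t < f x} * indicator {\<delta><..} t) \<partial>lborel)"
    unfolding layer_cake[OF fm, symmetric] by (rule nn_integral_cmult[symmetric]) measurable
  also have "\<dots> \<le> (\<integral>\<^sup>+t. frac_perimeter s {x. t < f x} \<partial>lborel)"
  proof (rule nn_integral_mono_AE, rule eventually_mono[OF ad])
    fix t assume "\<delta> < t \<longrightarrow> cheeger s \<Omega> * emeasure lborel {x. t < f x} \<le> frac_perimeter s {x. t < f x}"
    then show "cheeger s \<Omega> * (emeasure lborel {x. t < f x} * indicator {\<delta><..} t) \<le> frac_perimeter s {x. t < f x}"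
      by (cases "\<delta> < t") auto
  qed
  also have "\<dots> = gagliardo s f" by (rule coarea_gagliardo[OF fm])
  also have "\<dots> \<le> gagliardo s ga" unfolding f_def by (rule gagliardo_conv[OF \<rho> iga gab])
  also have "\<dots> \<le> gagliardo s g + gagliardo s (tilt R a)"
  proof (rule gagliardo_add)
    show "\<bar>ga x - ga y\<bar> \<le> \<bar>g x - g y\<bar> + \<bar>tilt R a x - tilt R a y\<bar>" for x y
      unfolding ga_def by linarith
    show "ga \<in> borel_measurable borel" unfolding ga_def by measurable
  qed measurable
  finally show ?thesis by (simp only: f0_def \<delta>_def)
qed

text \<open>Almost every \<open>a\<close> is admissible in \<open>cheeger_tilted\<close>, so there are admissible \<open>a\<close> of arbitrarily small norm;
  all error terms are proportional to \<open>norm a\<close> with finite factors. The case of an infinite Cheeger constant is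
  separate because an infinite constant cannot be multiplied into an error term.\<close>
lemma cheeger_le_function:
  fixes g :: "'a::euclidean_space \<Rightarrow> real"
  assumes s: "s \<in> {0<..<1}" and g[measurable]: "g \<in> borel_measurable borel" and g01: "\<And>x. 0 \<le> g x" "\<And>x. g x \<le> 1"
    and K: "compact K" "K \<subseteq> \<Omega>" "open \<Omega>" "\<And>x. x \<notin> K \<Longrightarrow> g x = 0"
  shows "cheeger s \<Omega> * (\<integral>\<^sup>+x. ennreal (g x) \<partial>lborel) \<le> gagliardo s g"
proof -
  obtain C where C: "C > 0" and L0: "\<forall>s\<in>{0<..<1}. \<forall>\<delta>>0. \<forall>M\<ge>0. \<forall>S. \<forall>\<psi>::'a::euclidean_space \<Rightarrow> real.
     \<psi> \<in> borel_measurable borel \<longrightarrow> S \<in> sets borel \<longrightarrow> (\<forall>x. x \<notin> S \<longrightarrow> \<psi> x = 0) \<longrightarrow>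
     (\<forall>x y. \<bar>\<psi> x - \<psi> y\<bar> \<le> M * min 1 (dist x y / \<delta>)) \<longrightarrow>
     gagliardo s \<psi> \<le> emeasure lborel S * ennreal (C * M * \<delta> powr - s / (s * (1 - s)))"
    using gagliardo_Lipschitz_le[where 'a = 'a] by (elim exE conjE)
  obtain d K' where d: "d > 0" "compact K'" "K' \<subseteq> \<Omega>" "\<And>x y. x \<in> K \<Longrightarrow> dist x y \<le> d \<Longrightarrow> y \<in> K'"
    using compact_enlarge[OF K(1,3,2)] by blast
  define m where "m = min d 1"
  have m: "0 < m" "m \<le> d" "m \<le> 1" using d by (auto simp: m_def)
  obtain \<rho> :: "'a \<Rightarrow> real" where \<rho>: "mollifier m \<rho>" using ex_mollifier[OF m(1)] by blast
  have gb: "\<bar>g x\<bar> \<le> 1" for x using g01[of x] by simp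
  have ig: "integrable lborel g" by (rule integrable_bounded_compact[OF g gb K(1,4)])
  have z: "conv \<rho> g x = 0" if "x \<notin> K'" for x
  proof (rule conv_eq[OF \<rho> g gb])
    fix y assume "dist x y \<le> m"
    then have "y \<notin> K" using d(4)[of y x] that m by (auto simp: dist_commute)
    then show "g y = 0" by (rule K(4))
  qed
  obtain R where R: "0 \<le> R" "K' \<subseteq> ball 0 R"
    using bounded_subset_ballD[OF compact_imp_bounded[OF d(2)], of 0] by (metis less_imp_le)
  define I where "I = (\<integral>\<^sup>+x. ennreal (g x) \<partial>lborel)"
  define h where "h = cheeger s \<Omega>"
  define G where "G = gagliardo s g"
  define VK where "VK = emeasure lborel K'"
  have VK: "VK \<noteq> top" using emeasure_compact_finite[OF d(2)] by (simp add: VK_def)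
  define T where "T = emeasure lborel (cball (0::'a) (R + 2)) * ennreal (C * (2 * (R + 4)) / (s * (1 - s)))"
  have T: "T \<noteq> top" unfolding T_def using R by (simp add: emeasure_ball_dim ennreal_mult_eq_top_iff)
  have mI: "I = (\<integral>\<^sup>+x. ennreal (conv \<rho> g x) \<partial>lborel)"
    unfolding I_def by (rule nn_integral_conv[OF \<rho> ig gb g01(1), symmetric])
  have cm[measurable]: "conv \<rho> g \<in> borel_measurable borel" by (rule conv_measurable[OF \<rho> ig])
  have step: "\<exists>J. I \<le> J + ennreal \<eta> * (ennreal (2 * (R + 2)) * VK) \<and> h * J \<le> G + ennreal \<eta> * T" if \<eta>: "0 < \<eta>" for \<eta>
  proof -
    have ck: "Ck_on 2 UNIV (conv \<rho> g)" using smooth_conv[OF \<rho> ig] by (simp only: smooth_on_def)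
    have "\<exists>a\<in>ball 0 \<eta>. AE t in lborel. \<forall>x. (\<forall>v. frechet_derivative (conv \<rho> g) (at x) v = a \<bullet> v) \<longrightarrow>
      t \<noteq> conv \<rho> g x - a \<bullet> (x - (\<integral>k. \<rho> k *\<^sub>R k \<partial>lborel))" (is "\<exists>a\<in>_. ?Q a")
    proof (rule ccontr)
      assume n: "\<not> (\<exists>a\<in>ball 0 \<eta>. ?Q a)"
      have "AE a in lborel. a \<notin> ball (0::'a) \<eta>"
        using AE_regular_tilt[OF ck, of "\<integral>k. \<rho> k *\<^sub>R k \<partial>lborel"]
      proof (rule eventually_mono)
        fix a assume "?Q a" then show "a \<notin> ball 0 \<eta>" using n by blast
      qed
      then have "ball (0::'a) \<eta> \<in> null_sets lborel"
        by (subst (asm) AE_iff_null_sets[symmetric]) auto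
      then have "emeasure lborel (ball (0::'a) \<eta>) = 0" by (rule null_setsD1)
      then show False using emeasure_open_pos[of "ball (0::'a) \<eta>"] \<eta> by simp
    qed
    then obtain a where a: "norm a < \<eta>" "?Q a" by auto
    define J where "J = (\<integral>\<^sup>+x. ennreal (conv \<rho> g x - 2 * (norm a * (R + 2))) \<partial>lborel)"
    have "h * J \<le> G + gagliardo s (tilt R a)"
      unfolding h_def J_def G_def
      by (rule cheeger_tilted[OF g g01 \<rho> m(3) K(1,4) d(2,3) z R a(2)])
    also have "gagliardo s (tilt R a) \<le> emeasure lborel (cball (0::'a) (R + 2)) * ennreal (C * (norm a * (2 * (R + 4))) * 1 powr - s / (s * (1 - s)))"
    proof (rule L0[rule_format, OF s])
      show "\<bar>tilt R a x - tilt R a y\<bar> \<le> norm a * (2 * (R + 4)) * min 1 (dist x y / 1)" for x y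
        by (rule tilt_Lipschitz[OF R(1)])
      show "tilt R a x = 0" if "x \<notin> cball 0 (R + 2)" for x using that by (intro tilt_outside) simp
    qed (use R in auto)
    also have "\<dots> = ennreal (norm a) * T"
    proof -
      have "C * (norm a * (2 * (R + 4))) * 1 powr - s / (s * (1 - s)) = norm a * (C * (2 * (R + 4)) / (s * (1 - s)))" by simp
      then show ?thesis unfolding T_def using C R s by (simp only:) (subst ennreal_mult, auto simp: mult_ac)
    qed
    also have "\<dots> \<le> ennreal \<eta> * T" using a by (intro mult_right_mono ennreal_leI) auto
    finally have 1: "h * J \<le> G + ennreal \<eta> * T" by (simp add: add_left_mono)
    have "I \<le> (\<integral>\<^sup>+x. ennreal (conv \<rho> g x - 2 * (norm a * (R + 2))) + ennreal (2 * (norm a * (R + 2))) * indicator K' x \<partial>lborel)"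
      unfolding mI
    proof (rule nn_integral_mono)
      fix x
      show "ennreal (conv \<rho> g x) \<le> ennreal (conv \<rho> g x - 2 * (norm a * (R + 2))) + ennreal (2 * (norm a * (R + 2))) * indicator K' x"
      proof (cases "x \<in> K'")
        case True
        define b where "b = 2 * (norm a * (R + 2))"
        have "0 \<le> b" using R by (simp add: b_def)
        have "ennreal (conv \<rho> g x) \<le> ennreal (conv \<rho> g x - b) + ennreal b"
        proof (cases "b \<le> conv \<rho> g x")
          case True
          then show ?thesis using \<open>0 \<le> b\<close> by (subst ennreal_plus[symmetric]) auto
        next
          case False
          then have "ennreal (conv \<rho> g x) \<le> ennreal b" by (intro ennreal_leI) simp
          then show ?thesis by (rule order_trans) simp
        qed
        then show ?thesis using True by (simp add: b_def)
      qed (simp add: z)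
    qed
    also have "\<dots> = J + ennreal (2 * (norm a * (R + 2))) * VK"
    proof -
      have [measurable]: "K' \<in> sets borel" by (rule borel_compact[OF d(2)])
      show ?thesis unfolding J_def VK_def
        by (subst nn_integral_add) (auto simp: nn_integral_cmult_indicator)
    qed
    also have "\<dots> \<le> J + ennreal \<eta> * (ennreal (2 * (R + 2)) * VK)"
    proof (rule add_left_mono)
      have "ennreal (2 * (norm a * (R + 2))) \<le> ennreal (\<eta> * (2 * (R + 2)))"
      proof (rule ennreal_leI)
        have "norm a * (2 * (R + 2)) \<le> \<eta> * (2 * (R + 2))" using a R by (intro mult_right_mono) auto
        then show "2 * (norm a * (R + 2)) \<le> \<eta> * (2 * (R + 2))" by (simp add: algebra_simps)
      qed
      also have "\<dots> = ennreal \<eta> * ennreal (2 * (R + 2))" using \<eta> R by (intro ennreal_mult) auto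
      finally have "ennreal (2 * (norm a * (R + 2))) * VK \<le> ennreal \<eta> * ennreal (2 * (R + 2)) * VK"
        by (rule mult_right_mono) simp
      then show "ennreal (2 * (norm a * (R + 2))) * VK \<le> ennreal \<eta> * (ennreal (2 * (R + 2)) * VK)"
        by (simp only: mult.assoc)
    qed
    finally show ?thesis using 1 by blast
  qed
  have "h * I \<le> G"
  proof (cases "G = top")
    case False
    show ?thesis
    proof (cases "h = top")
      case True
      have "I \<le> 0"
      proof (rule ennreal_le_eps[of _ _ "ennreal (2 * (R + 2)) * VK"])
        fix \<eta> :: real assume "0 < \<eta>"
        from step[OF this] obtain J where J: "I \<le> J + ennreal \<eta> * (ennreal (2 * (R + 2)) * VK)" "h * J \<le> G + ennreal \<eta> * T"
          by blast
        have "G + ennreal \<eta> * T \<noteq> top" using False T by (simp add: ennreal_mult_eq_top_iff)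
        then have "h * J \<noteq> top" using J(2) by (metis top.extremum_unique)
        then have "J = 0" using True by (simp add: ennreal_top_mult split: if_splits)
        then show "I \<le> 0 + ennreal \<eta> * (ennreal (2 * (R + 2)) * VK)" using J by simp
      qed (use VK in \<open>simp add: ennreal_mult_eq_top_iff\<close>)
      then show ?thesis by simp
    next
      case hf: False
      show ?thesis
      proof (rule ennreal_le_eps[of _ _ "T + h * (ennreal (2 * (R + 2)) * VK)"])
        fix \<eta> :: real assume "0 < \<eta>"
        from step[OF this] obtain J where J: "I \<le> J + ennreal \<eta> * (ennreal (2 * (R + 2)) * VK)" "h * J \<le> G + ennreal \<eta> * T"
          by blast
        have "h * I \<le> h * J + h * (ennreal \<eta> * (ennreal (2 * (R + 2)) * VK))"
          using mult_left_mono[OF J(1), of h] by (simp add: distrib_left)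
        also have "\<dots> \<le> (G + ennreal \<eta> * T) + h * (ennreal \<eta> * (ennreal (2 * (R + 2)) * VK))"
          by (rule add_right_mono[OF J(2)])
        also have "\<dots> = G + ennreal \<eta> * (T + h * (ennreal (2 * (R + 2)) * VK))"
          by (simp add: distrib_left mult_ac add_ac)
        finally show "h * I \<le> G + ennreal \<eta> * (T + h * (ennreal (2 * (R + 2)) * VK))" .
      qed (use VK T hf in \<open>simp add: ennreal_mult_eq_top_iff\<close>)
    qed
  qed simp
  then show ?thesis by (simp only: h_def I_def G_def)
qed

section \<open>Expanding maps and contraction of a ball\<close>

text \<open>The inverse of \<open>T\<close> maps a ball of radius \<open>\<rho>\<close> into one of radius \<open>\<rho> / m\<close>. Cover \<open>A\<close> by disjoint balls up to
  a null set (Vitali) and add up; the inverse is Lipschitz and maps null sets to null sets. Using balls on both sides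
  gives the sharp constant, which tends to 1 as \<open>m\<close> tends to 1.\<close>
lemma emeasure_vimage_expanding_open:
  fixes T :: "'a::euclidean_space \<Rightarrow> 'a"
  assumes m: "0 < m" and bij: "bij T" and exp: "\<And>x y. m * dist x y \<le> dist (T x) (T y)" and cont: "continuous_on UNIV T"
    and A: "open A"
  shows "emeasure lborel (T -` A) \<le> ennreal ((1 / m) ^ DIM('a)) * emeasure lborel A"
proof -
  let ?N = "DIM('a)"
  define S where "S = inv T"
  have TS: "T (S y) = y" for y unfolding S_def using bij by (simp add: bij_is_surj surj_f_inv_f)
  have ST: "S (T x) = x" for x unfolding S_def using bij by (simp add: bij_is_inj)
  have SL: "dist (S x) (S y) \<le> dist x y / m" for x y
    using exp[of "S x" "S y"] m by (simp add: TS pos_le_divide_eq mult.commute)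
  define I where "I = {(y, \<rho>). 0 < \<rho> \<and> cball y \<rho> \<subseteq> A}"
  have cov: "\<exists>i. i \<in> I \<and> x \<in> cball (fst i) (snd i) \<and> snd i < d" if "x \<in> A" "0 < d" for x d
  proof -
    have "\<exists>e>0. cball x e \<subseteq> A" by (rule A[unfolded open_contains_cball, rule_format, OF that(1)])
    then obtain e where e: "e > 0" "cball x e \<subseteq> A" by (elim exE conjE)
    have "cball x (min e (d / 2)) \<subseteq> A" by (rule order_trans[OF subset_cball e(2)]) simp
    then have "(x, min e (d / 2)) \<in> I" using e(1) that(2) by (simp add: I_def)
    then show ?thesis using e(1) that(2) by (intro exI[of _ "(x, min e (d / 2))"]) simp
  qed
  have I0: "0 < snd i" if "i \<in> I" for i using that by (auto simp: I_def)
  obtain C where C: "countable C" "C \<subseteq> I" "pairwise (\<lambda>i j. disjnt (cball (fst i) (snd i)) (cball (fst j) (snd j))) C"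
      "negligible (A - (\<Union>i\<in>C. cball (fst i) (snd i)))"
    by (rule Vitali_covering_theorem_cballs[of I snd A fst, OF I0 cov]; (assumption | (rule that; assumption)))
  have Cpos: "0 < snd i" "cball (fst i) (snd i) \<subseteq> A" if "i \<in> C" for i
  proof -
    have "i \<in> I" using that C(2) by blast
    then show "0 < snd i" "cball (fst i) (snd i) \<subseteq> A" by (simp_all add: I_def case_prod_beta)
  qed
  define u where "u = to_nat_on C"
  define B where "B = (\<lambda>n. if n \<in> u ` C then cball (fst (from_nat_into C n)) (snd (from_nat_into C n)) else {})"
  \<comment> \<open>\<open>B\<close> enumerates the disjoint balls of the covering and \<open>B'\<close> the balls containing their preimages; indices that
    do not occur give the empty set.\<close>
  define B' where "B' = (\<lambda>n. if n \<in> u ` C then cball (S (fst (from_nat_into C n))) (snd (from_nat_into C n) / m) else {})"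
  have un: "from_nat_into C (u i) = i" if "i \<in> C" for i unfolding u_def using C(1) that by simp
  have Bu: "B (u i) = cball (fst i) (snd i)" "B' (u i) = cball (S (fst i)) (snd i / m)" if "i \<in> C" for i
    using that by (auto simp: B_def B'_def un)
  have B0: "B n = {}" "B' n = {}" if "n \<notin> u ` C" for n using that by (auto simp: B_def B'_def)
  have Bm[measurable]: "B n \<in> sets borel" "B' n \<in> sets borel" for n by (auto simp: B_def B'_def)
  have disj: "disjoint_family B"
    unfolding disjoint_family_on_def
  proof (intro ballI impI)
    fix n k :: nat assume nk: "n \<noteq> k"
    show "B n \<inter> B k = {}"
    proof (cases "n \<in> u ` C \<and> k \<in> u ` C")
      case True
      then obtain i j where ij: "i \<in> C" "n = u i" "j \<in> C" "k = u j" by blast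
      then have "i \<noteq> j" using nk by blast
      then have "disjnt (cball (fst i) (snd i)) (cball (fst j) (snd j))" using C(3) ij by (auto simp: pairwise_def)
      then show ?thesis using ij Bu by (simp add: disjnt_def)
    qed (use B0 in auto)
  qed
  have le: "emeasure lborel (B' n) \<le> ennreal ((1 / m) ^ ?N) * emeasure lborel (B n)" for n
  proof (cases "n \<in> u ` C")
    case True
    then obtain i where i: "i \<in> C" "n = u i" by blast
    have "emeasure lborel (B' n) = ennreal (unit_ball_vol (real ?N) * (snd i / m) ^ ?N)"
      using i Bu Cpos[of i] m by (simp add: emeasure_ball_dim)
    also have "\<dots> = ennreal ((1 / m) ^ ?N * (unit_ball_vol (real ?N) * snd i ^ ?N))"
      by (simp add: power_divide)
    also have "\<dots> = ennreal ((1 / m) ^ ?N) * emeasure lborel (B n)"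
      using i Bu Cpos[of i] m by (simp add: emeasure_ball_dim ennreal_mult)
    finally show ?thesis by simp
  qed (use B0 in simp)
  have neg: "negligible (S ` (A - (\<Union>i\<in>C. cball (fst i) (snd i))))"
  proof (rule negligible_locally_Lipschitz_image)
    fix x assume "x \<in> A - (\<Union>i\<in>C. cball (fst i) (snd i))"
    show "\<exists>T B. open T \<and> x \<in> T \<and> (\<forall>y\<in>(A - (\<Union>i\<in>C. cball (fst i) (snd i))) \<inter> T. norm (S y - S x) \<le> B * norm (y - x))"
      using SL by (intro exI[of _ UNIV] exI[of _ "1 / m"]) (simp add: dist_norm)
  qed (use C(4) in auto)
  then obtain Z where Z: "Z \<in> null_sets lborel" "S ` (A - (\<Union>i\<in>C. cball (fst i) (snd i))) \<subseteq> Z"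
    unfolding negligible_iff_null_sets null_sets_completion_iff2 by (elim bexE)
  have "emeasure lborel (T -` A) \<le> emeasure lborel (\<Union>n. B' n)"
  proof (rule emeasure_mono_AE)
    have "AE x in lborel. x \<notin> Z" by (rule AE_not_in[OF Z(1)])
    then show "AE x in lborel. x \<in> T -` A \<longrightarrow> x \<in> (\<Union>n. B' n)"
    proof (rule eventually_mono)
      fix x assume x: "x \<notin> Z"
      show "x \<in> T -` A \<longrightarrow> x \<in> (\<Union>n. B' n)"
      proof
        assume "x \<in> T -` A"
        then have "T x \<in> A" by simp
        moreover have "T x \<notin> A - (\<Union>i\<in>C. cball (fst i) (snd i))" using x Z(2) ST by force
        ultimately obtain i where i: "i \<in> C" "T x \<in> cball (fst i) (snd i)" by blast
        have "dist (S (fst i)) x \<le> dist (fst i) (T x) / m" using SL[of "fst i" "T x"] by (simp add: ST)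
        also have "\<dots> \<le> snd i / m" using i(2) m by (intro divide_right_mono) auto
        finally have "x \<in> B' (u i)" using Bu[OF i(1)] by simp
        then show "x \<in> (\<Union>n. B' n)" by blast
      qed
    qed
  qed measurable
  also have "\<dots> \<le> (\<Sum>n. emeasure lborel (B' n))" by (rule emeasure_subadditive_countably) auto
  also have "\<dots> \<le> (\<Sum>n. ennreal ((1 / m) ^ ?N) * emeasure lborel (B n))" by (intro suminf_le le) auto
  also have "\<dots> = ennreal ((1 / m) ^ ?N) * (\<Sum>n. emeasure lborel (B n))" by simp
  also have "(\<Sum>n. emeasure lborel (B n)) = emeasure lborel (\<Union>n. B n)"
    using disj by (intro suminf_emeasure) auto
  also have "\<dots> \<le> emeasure lborel A"
  proof (rule emeasure_mono)
    show "(\<Union>n. B n) \<subseteq> A"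
    proof
      fix x assume "x \<in> (\<Union>n. B n)"
      then obtain n where n: "x \<in> B n" by blast
      then have "n \<in> u ` C" using B0 by blast
      then obtain i where "i \<in> C" "n = u i" by blast
      then show "x \<in> A" using n Bu Cpos by blast
    qed
  qed (use A in auto)
  finally show ?thesis by (simp add: mult_left_mono)
qed

text \<open>Outer regularity extends the volume estimate to Borel sets, so the image of Lebesgue measure under \<open>T\<close> is
  dominated by a multiple of Lebesgue measure.\<close>
lemma nn_integral_expanding_le:
  fixes T :: "'a::euclidean_space \<Rightarrow> 'a"
  assumes m: "0 < m" and bij: "bij T" and exp: "\<And>x y. m * dist x y \<le> dist (T x) (T y)" and cont: "continuous_on UNIV T"
    and f[measurable]: "f \<in> borel_measurable borel"
  shows "(\<integral>\<^sup>+x. f (T x) \<partial>lborel) \<le> ennreal ((1 / m) ^ DIM('a)) * (\<integral>\<^sup>+x. f x \<partial>lborel)"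
proof -
  define c where "c = ennreal ((1 / m) ^ DIM('a))"
  have [measurable]: "T \<in> borel_measurable borel" by (rule borel_measurable_continuous_onI[OF cont])
  have le: "emeasure lborel (T -` A) \<le> c * emeasure lborel A" if A: "A \<in> sets borel" for A
  proof (rule ennreal_le_epsilon)
    fix e :: real assume e: "0 < e"
    have e': "0 < m ^ DIM('a) * e" using e m by simp
    obtain U where U: "open U" "A \<subseteq> U" "emeasure lborel (U - A) < ennreal (m ^ DIM('a) * e)"
      by (rule outer_regular_lborel[OF A e'])
    have "emeasure lborel (T -` A) \<le> emeasure lborel (T -` U)"
    proof (rule emeasure_mono)
      show "T -` U \<in> sets lborel" using open_vimage[OF U(1) cont] by simp
    qed (use U in auto)
    also have "\<dots> \<le> c * emeasure lborel U"
      unfolding c_def by (rule emeasure_vimage_expanding_open[OF m bij exp cont U(1)])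
    also have "emeasure lborel U = emeasure lborel A + emeasure lborel (U - A)"
      using U A by (subst plus_emeasure) (auto simp: Un_absorb1)
    also have "c * \<dots> \<le> c * (emeasure lborel A + ennreal (m ^ DIM('a) * e))"
      using U(3) by (intro mult_left_mono add_left_mono) auto
    also have "\<dots> = c * emeasure lborel A + ennreal e"
      unfolding c_def using m e by (simp add: distrib_left ennreal_mult[symmetric] power_divide)
    finally show "emeasure lborel (T -` A) \<le> c * emeasure lborel A + ennreal e" .
  qed
  have "distr lborel borel T \<le> density lborel (\<lambda>_. c)"
    by (subst le_measure) (auto simp: emeasure_distr emeasure_density nn_integral_cmult_indicator le)
  then have "(\<integral>\<^sup>+x. f x \<partial>distr lborel borel T) \<le> (\<integral>\<^sup>+x. f x \<partial>density lborel (\<lambda>_. c))"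
    by (intro nn_integral_mono_measure) auto
  then show ?thesis
    by (simp add: nn_integral_distr nn_integral_density nn_integral_cmult c_def)
qed

text \<open>On the ball of radius \<open>5/4 r\<close> this is the dilation by \<open>1 - \<epsilon>\<close> about \<open>x0\<close>; off the ball of radius \<open>7/4 r\<close> it
  is the identity, so composition with it preserves compact support in the ball of radius \<open>2 r\<close>.\<close>
definition shrink :: "'a::euclidean_space \<Rightarrow> real \<Rightarrow> real \<Rightarrow> 'a \<Rightarrow> 'a" where
  "shrink x0 r \<epsilon> x = x - (\<epsilon> * cutoff x0 (5/4 * r) (7/4 * r) x) *\<^sub>R (x - x0)"

lemma radial_field_Lipschitz:
  fixes x0 :: "'a::euclidean_space"
  assumes r: "0 < r"
  defines "V \<equiv> (\<lambda>x. cutoff x0 (5/4 * r) (7/4 * r) x *\<^sub>R (x - x0))"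
  shows "dist (V x) (V y) \<le> 5 * dist x y"
proof -
  let ?c = "cutoff x0 (5/4 * r) (7/4 * r)"
  have ab: "5/4 * r < 7/4 * r" using r by simp
  have main: "norm (V x - V y) \<le> 5 * dist x y" if y: "dist y x0 \<le> 7/4 * r" for x y
  proof -
    have e: "V x - V y = ?c x *\<^sub>R (x - y) + (?c x - ?c y) *\<^sub>R (y - x0)"
      unfolding V_def by (simp add: algebra_simps)
    have 1: "norm (V x - V y) \<le> \<bar>?c x\<bar> * norm (x - y) + \<bar>?c x - ?c y\<bar> * norm (y - x0)"
      unfolding e
      using norm_triangle_ineq[of "?c x *\<^sub>R (x - y)" "(?c x - ?c y) *\<^sub>R (y - x0)"] by (simp only: norm_scaleR)
    have "\<bar>?c x\<bar> \<le> 1" using cutoff_range[of x0 "5/4 * r" "7/4 * r" x] by linarith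
    then have 2: "\<bar>?c x\<bar> * norm (x - y) \<le> 1 * norm (x - y)" by (rule mult_right_mono) simp
    have h: "7/4 * r - 5/4 * r = r / 2" by simp
    have "\<bar>?c x - ?c y\<bar> \<le> dist x y / (r / 2)"
      using cutoff_Lipschitz[OF ab, of x0 x y] unfolding h by (simp only: min.bounded_iff)
    then have 3: "\<bar>?c x - ?c y\<bar> * norm (y - x0) \<le> dist x y / (r / 2) * (7/4 * r)"
      using y r by (intro mult_mono) (auto simp: dist_norm)
    have 4: "dist x y / (r / 2) * (7/4 * r) = 7/2 * dist x y" using r by (simp add: field_simps)
    have "norm (V x - V y) \<le> 1 * norm (x - y) + 7/2 * dist x y"
      by (rule order_trans[OF 1 add_mono[OF 2 3[unfolded 4]]])
    also have "\<dots> \<le> 5 * dist x y" using zero_le_dist[of x y] by (simp add: dist_norm)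
    finally show ?thesis .
  qed
  show ?thesis
  proof (cases "dist y x0 \<le> 7/4 * r")
    case True
    then show ?thesis using main[of y x] by (simp add: dist_norm)
  next
    case y: False
    show ?thesis
    proof (cases "dist x x0 \<le> 7/4 * r")
      case True
      then show ?thesis using main[of x y] by (simp add: dist_norm norm_minus_commute)
    next
      case False
      then have "?c x = 0" by (intro cutoff_eq_0[OF ab]) linarith
      moreover have "?c y = 0" using y by (intro cutoff_eq_0[OF ab]) linarith
      ultimately show ?thesis unfolding V_def by (simp only: scaleR_zero_left dist_self) simp
    qed
  qed
qed

context
  fixes x0 :: "'a::euclidean_space" and r \<epsilon> :: real
  assumes r: "0 < r" and \<epsilon>: "0 < \<epsilon>" "5 * \<epsilon> < 1"
begin

lemma shrink_dist:
  "(1 - 5 * \<epsilon>) * dist x y \<le> dist (shrink x0 r \<epsilon> x) (shrink x0 r \<epsilon> y)"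
  "dist (shrink x0 r \<epsilon> x) (shrink x0 r \<epsilon> y) \<le> (1 + 5 * \<epsilon>) * dist x y"
proof -
  let ?V = "\<lambda>x. cutoff x0 (5/4 * r) (7/4 * r) x *\<^sub>R (x - x0)"
  define W where "W = \<epsilon> *\<^sub>R (?V x - ?V y)"
  have "shrink x0 r \<epsilon> x - shrink x0 r \<epsilon> y = (x - y) - W"
    by (simp add: shrink_def W_def algebra_simps)
  then have e: "dist (shrink x0 r \<epsilon> x) (shrink x0 r \<epsilon> y) = norm ((x - y) - W)" by (simp only: dist_norm)
  have "norm W = \<epsilon> * dist (?V x) (?V y)" using \<epsilon> by (simp only: W_def norm_scaleR dist_norm abs_of_pos)
  also have "\<dots> \<le> \<epsilon> * (5 * dist x y)"
    using radial_field_Lipschitz[OF r, of x0 x y] \<epsilon> by (intro mult_left_mono) auto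
  finally have W: "norm W \<le> 5 * \<epsilon> * dist x y" by simp
  show "(1 - 5 * \<epsilon>) * dist x y \<le> dist (shrink x0 r \<epsilon> x) (shrink x0 r \<epsilon> y)"
    using W norm_triangle_ineq2[of "x - y" W] unfolding e unfolding left_diff_distrib dist_norm by linarith
  show "dist (shrink x0 r \<epsilon> x) (shrink x0 r \<epsilon> y) \<le> (1 + 5 * \<epsilon>) * dist x y"
    using W norm_triangle_ineq4[of "x - y" W] unfolding e unfolding distrib_right dist_norm by linarith
qed

lemma shrink_continuous: "continuous_on UNIV (shrink x0 r \<epsilon>)"
  unfolding shrink_def cutoff_def by (intro continuous_intros) (use r in auto)

text \<open>Solving \<open>shrink x0 r \<epsilon> x = y\<close> is a fixed point problem for a contraction with factor \<open>5 \<epsilon>\<close>.\<close>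
lemma shrink_bij: "bij (shrink x0 r \<epsilon>)"
proof (rule bijI)
  show "inj (shrink x0 r \<epsilon>)"
  proof (rule injI)
    fix x y assume "shrink x0 r \<epsilon> x = shrink x0 r \<epsilon> y"
    then have "(1 - 5 * \<epsilon>) * dist x y \<le> 0" using shrink_dist(1)[of x y] by simp
    then show "x = y" using \<epsilon> by (simp add: mult_le_0_iff)
  qed
  show "surj (shrink x0 r \<epsilon>)"
    unfolding surj_def
  proof
    fix y
    let ?V = "\<lambda>x. cutoff x0 (5/4 * r) (7/4 * r) x *\<^sub>R (x - x0)"
    have "\<exists>!x\<in>UNIV. y + \<epsilon> *\<^sub>R ?V x = x"
    proof (rule Banach_fix[where c = "5 * \<epsilon>"])
      show "dist (y + \<epsilon> *\<^sub>R ?V x) (y + \<epsilon> *\<^sub>R ?V x') \<le> 5 * \<epsilon> * dist x x'" for x x'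
      proof -
        have "dist (y + \<epsilon> *\<^sub>R ?V x) (y + \<epsilon> *\<^sub>R ?V x') = \<epsilon> * dist (?V x) (?V x')"
          using \<epsilon> by (simp only: dist_norm add_diff_cancel_left scaleR_diff_right[symmetric] norm_scaleR abs_of_pos)
        also have "\<dots> \<le> \<epsilon> * (5 * dist x x')" using radial_field_Lipschitz[OF r, of x0 x x'] \<epsilon> by (intro mult_left_mono) auto
        finally show ?thesis by simp
      qed
    qed (use \<epsilon> in \<open>auto simp: complete_UNIV\<close>)
    then obtain x where x: "y + \<epsilon> *\<^sub>R ?V x = x" by blast
    have "shrink x0 r \<epsilon> x = x - \<epsilon> *\<^sub>R ?V x" by (simp only: shrink_def scaleR_scaleR)
    also have "\<dots> = y" using x by (metis add_diff_cancel_right')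
    finally show "\<exists>x. y = shrink x0 r \<epsilon> x" by metis
  qed
qed

lemma shrink_inner: "dist x x0 \<le> 5/4 * r \<Longrightarrow> dist (shrink x0 r \<epsilon> x) x0 = (1 - \<epsilon>) * dist x x0"
proof -
  assume x: "dist x x0 \<le> 5/4 * r"
  have "cutoff x0 (5/4 * r) (7/4 * r) x = 1" using r x by (intro cutoff_eq_1) auto
  then have "shrink x0 r \<epsilon> x - x0 = (1 - \<epsilon>) *\<^sub>R (x - x0)" by (simp add: shrink_def algebra_simps)
  then show ?thesis using \<epsilon> by (simp add: dist_norm)
qed

lemma shrink_outer: "7/4 * r \<le> dist x x0 \<Longrightarrow> shrink x0 r \<epsilon> x = x"
  using r cutoff_eq_0[of "5/4 * r" "7/4 * r" x x0] by (simp add: shrink_def)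

lemma shrink_measurable [measurable]: "shrink x0 r \<epsilon> \<in> borel_measurable borel"
  by (rule borel_measurable_continuous_onI[OF shrink_continuous])

text \<open>The map distorts distances by at most \<open>1 + 5 \<epsilon>\<close>, which is paid for by the kernel, and its inverse changes volume
  by at most \<open>(1 - 5 \<epsilon>) ^ -N\<close>, which is paid once for each of the two variables. The factor is independent of \<open>s\<close>
  and tends to 1 with \<open>\<epsilon>\<close>.\<close>
lemma gagliardo_shrink:
  assumes s: "0 < s" "s < 1" and v[measurable]: "v \<in> borel_measurable borel"
  shows "gagliardo s (\<lambda>x. v (shrink x0 r \<epsilon> x))
    \<le> ennreal ((1 + 5 * \<epsilon>) ^ (DIM('a) + 1) * ((1 / (1 - 5 * \<epsilon>)) ^ DIM('a)) ^ 2) * gagliardo s v"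
proof -
  let ?T = "shrink x0 r \<epsilon>" and ?N = "DIM('a)"
  define c where "c = (1 / (1 - 5 * \<epsilon>)) ^ ?N"
  define d where "d = (1 + 5 * \<epsilon>) ^ (?N + 1)"
  have cd: "0 \<le> c" "0 \<le> d" using \<epsilon> by (simp_all add: c_def d_def)
  have m: "0 < 1 - 5 * \<epsilon>" using \<epsilon> by simp
  have int: "(\<integral>\<^sup>+x. f (?T x) \<partial>lborel) \<le> ennreal c * (\<integral>\<^sup>+x. f x \<partial>lborel)" if "f \<in> borel_measurable borel" for f
    unfolding c_def by (rule nn_integral_expanding_le[OF m shrink_bij shrink_dist(1) shrink_continuous that])
  have k: "frac_kernel s (x - y) \<le> ennreal d * frac_kernel s (?T x - ?T y)" for x y
  proof (cases "x = y")
    case False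
    define q where "q = real ?N + s"
    have nz: "0 < norm (?T x - ?T y)"
      using False by (simp add: inj_eq[OF bij_is_inj[OF shrink_bij]])
    have "norm (?T x - ?T y) / (1 + 5 * \<epsilon>) \<le> norm (x - y)"
      using shrink_dist(2)[of x y] \<epsilon> by (simp add: dist_norm divide_le_eq mult.commute)
    then have "norm (x - y) powr - q \<le> (norm (?T x - ?T y) / (1 + 5 * \<epsilon>)) powr - q"
      using nz \<epsilon> s by (intro powr_mono2') (auto simp: q_def)
    also have "\<dots> = (1 + 5 * \<epsilon>) powr q * norm (?T x - ?T y) powr - q"
      unfolding powr_divide using \<epsilon> by (simp add: powr_minus divide_inverse)
    also have "\<dots> \<le> d * norm (?T x - ?T y) powr - q"
    proof (rule mult_right_mono)
      have "(1 + 5 * \<epsilon>) powr q \<le> (1 + 5 * \<epsilon>) powr real (?N + 1)"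
        using \<epsilon> s by (intro powr_mono) (auto simp: q_def)
      also have "\<dots> = d" unfolding d_def using \<epsilon> by (intro powr_realpow) simp
      finally show "(1 + 5 * \<epsilon>) powr q \<le> d" .
    qed simp
    finally show ?thesis unfolding frac_kernel_def q_def[symmetric] using cd by (simp add: ennreal_mult[symmetric])
  qed (simp add: frac_kernel_def)
  have "gagliardo s (\<lambda>x. v (?T x)) \<le> (\<integral>\<^sup>+y. (\<integral>\<^sup>+x. ennreal d * (ennreal \<bar>v (?T x) - v (?T y)\<bar> * frac_kernel s (?T x - ?T y)) \<partial>lborel) \<partial>lborel)"
    unfolding gagliardo_frac_kernel
  proof (intro nn_integral_mono)
    fix x y
    have "ennreal \<bar>v (?T x) - v (?T y)\<bar> * frac_kernel s (x - y) \<le> ennreal \<bar>v (?T x) - v (?T y)\<bar> * (ennreal d * frac_kernel s (?T x - ?T y))"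
      by (intro mult_left_mono k) simp
    then show "ennreal \<bar>v (?T x) - v (?T y)\<bar> * frac_kernel s (x - y) \<le> ennreal d * (ennreal \<bar>v (?T x) - v (?T y)\<bar> * frac_kernel s (?T x - ?T y))"
      by (simp only: mult_ac)
  qed
  also have "\<dots> = ennreal d * (\<integral>\<^sup>+y. (\<integral>\<^sup>+x. ennreal \<bar>v (?T x) - v (?T y)\<bar> * frac_kernel s (?T x - ?T y) \<partial>lborel) \<partial>lborel)"
    by (simp add: nn_integral_cmult)
  also have "\<dots> \<le> ennreal d * (\<integral>\<^sup>+y. ennreal c * (\<integral>\<^sup>+x. ennreal \<bar>v x - v (?T y)\<bar> * frac_kernel s (x - ?T y) \<partial>lborel) \<partial>lborel)"
    by (intro mult_left_mono nn_integral_mono int) auto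
  also have "\<dots> = ennreal d * (ennreal c * (\<integral>\<^sup>+y. (\<integral>\<^sup>+x. ennreal \<bar>v x - v (?T y)\<bar> * frac_kernel s (x - ?T y) \<partial>lborel) \<partial>lborel))"
    by (simp add: nn_integral_cmult)
  also have "\<dots> \<le> ennreal d * (ennreal c * (ennreal c * gagliardo s v))"
  proof (intro mult_left_mono)
    have "(\<lambda>y. \<integral>\<^sup>+x. ennreal \<bar>v x - v y\<bar> * frac_kernel s (x - y) \<partial>lborel) \<in> borel_measurable lborel" by measurable
    then show "(\<integral>\<^sup>+y. (\<integral>\<^sup>+x. ennreal \<bar>v x - v (?T y)\<bar> * frac_kernel s (x - ?T y) \<partial>lborel) \<partial>lborel) \<le> ennreal c * gagliardo s v"
      unfolding gagliardo_frac_kernel by (intro int) simp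
  qed auto
  also have "\<dots> = ennreal (d * c ^ 2) * gagliardo s v"
    using cd by (simp add: ennreal_mult power2_eq_square mult.assoc)
  finally show ?thesis by (simp only: c_def d_def)
qed

end

section \<open>The upper bound at a fixed radius\<close>

definition clamp01 :: "real \<Rightarrow> real" where "clamp01 t = max 0 (min 1 t)"

lemma clamp01_range: "0 \<le> clamp01 t" "clamp01 t \<le> 1"
  by (auto simp: clamp01_def)

lemma clamp01_diff: "\<bar>clamp01 t - clamp01 u\<bar> \<le> \<bar>t - u\<bar>"
  by (auto simp: clamp01_def max_def min_def)

lemma clamp01_measurable [measurable]: "f \<in> borel_measurable M \<Longrightarrow> (\<lambda>x. clamp01 (f x)) \<in> borel_measurable M"
  unfolding clamp01_def by (intro borel_measurable_max borel_measurable_min borel_measurable_const)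

text \<open>The function \<open>1 - (1 - \<psi>) (1 - p)\<close> raises \<open>p\<close> to the value 1 where \<open>\<psi> = 1\<close>. In the product rule the factor
  in front of the variation of \<open>p\<close> is at most 1, so the full seminorm of \<open>p\<close> enters with constant exactly 1; the rest
  is weighted by \<open>1 - p\<close>, evaluated at a point of the support of \<open>\<psi>\<close>.\<close>
lemma gagliardo_fill_le:
  fixes p \<psi> :: "'a::euclidean_space \<Rightarrow> real"
  assumes [measurable]: "p \<in> borel_measurable borel" "\<psi> \<in> borel_measurable borel" "S \<in> sets borel"
    and p: "\<And>x. 0 \<le> p x" "\<And>x. p x \<le> 1" and \<psi>: "\<And>x. 0 \<le> \<psi> x" "\<And>x. \<psi> x \<le> 1" "\<And>x. x \<notin> S \<Longrightarrow> \<psi> x = 0"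
    and K: "\<And>x. variation_at s \<psi> x \<le> k"
  shows "gagliardo s (\<lambda>x. 1 - (1 - \<psi> x) * (1 - p x)) \<le> gagliardo s p + 2 * ((\<integral>\<^sup>+x. indicator S x * ennreal (1 - p x) \<partial>lborel) * k)"
proof -
  define v where "v = (\<lambda>x. 1 - (1 - \<psi> x) * (1 - p x))"
  define A where "A = (\<lambda>x y. ennreal (1/2) * ennreal \<bar>p y - p x\<bar> + indicator S x * ennreal (1 - p x) * ennreal \<bar>\<psi> x - \<psi> y\<bar>)"
  have pt: "\<bar>v x - v y\<bar> \<le> \<bar>p x - p y\<bar> + (1 - p y) * \<bar>\<psi> x - \<psi> y\<bar>" for x y
  proof -
    have "v x - v y = (1 - \<psi> x) * (p x - p y) + (1 - p y) * (\<psi> x - \<psi> y)"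
      by (simp add: v_def algebra_simps)
    also have "\<bar>\<dots>\<bar> \<le> \<bar>1 - \<psi> x\<bar> * \<bar>p x - p y\<bar> + \<bar>1 - p y\<bar> * \<bar>\<psi> x - \<psi> y\<bar>"
      unfolding abs_mult[symmetric] by (rule abs_triangle_ineq)
    also have "\<dots> \<le> 1 * \<bar>p x - p y\<bar> + (1 - p y) * \<bar>\<psi> x - \<psi> y\<bar>"
      using p[of y] \<psi>(1,2)[of x] by (intro add_mono mult_right_mono) auto
    finally show ?thesis by simp
  qed
  have "gagliardo s v \<le> 2 * (\<integral>\<^sup>+x. (\<integral>\<^sup>+y. A x y * frac_kernel s (x - y) \<partial>lborel) \<partial>lborel)"
  proof (rule gagliardo_sym_le)
    show "case_prod A \<in> borel_measurable (lborel \<Otimes>\<^sub>M lborel)" unfolding A_def by measurable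
    fix x y
    have half: "ennreal (1/2) * ennreal t + ennreal (1/2) * ennreal t = ennreal t" if "0 \<le> t" for t
    proof -
      have "ennreal (1/2) * ennreal t = ennreal (1/2 * t)" using that by (intro ennreal_mult[symmetric]) auto
      then have "ennreal (1/2) * ennreal t + ennreal (1/2) * ennreal t = ennreal (1/2 * t + 1/2 * t)"
        using that by (simp only:) (intro ennreal_plus[symmetric], auto)
      then show ?thesis by simp
    qed
    have AA: "A x y + A y x = ennreal \<bar>p x - p y\<bar> + (indicator S x * ennreal (1 - p x) * ennreal \<bar>\<psi> x - \<psi> y\<bar>
       + indicator S y * ennreal (1 - p y) * ennreal \<bar>\<psi> x - \<psi> y\<bar>)"
    proof -
      have sw: "\<bar>p y - p x\<bar> = \<bar>p x - p y\<bar>" "\<bar>\<psi> y - \<psi> x\<bar> = \<bar>\<psi> x - \<psi> y\<bar>" by (rule abs_minus_commute)+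
      have ac: "(h + a) + (h + b) = (h + h) + (a + b)" for h a b :: ennreal by (simp only: add_ac)
      show ?thesis unfolding A_def sw ac half[OF abs_ge_zero] ..
    qed
    have le: "ennreal \<bar>v x - v y\<bar> \<le> ennreal \<bar>p x - p y\<bar> + ennreal (1 - p y) * ennreal \<bar>\<psi> x - \<psi> y\<bar>" for x y
      using ennreal_leI[OF pt[of x y]] p[of y] by (simp add: ennreal_plus ennreal_mult)
    show "ennreal \<bar>v x - v y\<bar> \<le> A x y + A y x"
    proof (cases "y \<in> S")
      case True
      have "ennreal \<bar>v x - v y\<bar> \<le> ennreal \<bar>p x - p y\<bar> + indicator S y * ennreal (1 - p y) * ennreal \<bar>\<psi> x - \<psi> y\<bar>"
        using le[of x y] True by simp
      also have "\<dots> \<le> A x y + A y x" unfolding AA by (intro add_left_mono) simp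
      finally show ?thesis .
    next
      case y: False
      show ?thesis
      proof (cases "x \<in> S")
        case True
        have "ennreal \<bar>v x - v y\<bar> \<le> ennreal \<bar>p x - p y\<bar> + indicator S x * ennreal (1 - p x) * ennreal \<bar>\<psi> x - \<psi> y\<bar>"
          using le[of y x] True by (simp add: abs_minus_commute)
        also have "\<dots> \<le> A x y + A y x" unfolding AA by (intro add_left_mono) simp
        finally show ?thesis .
      next
        case False
        then have "\<psi> x - \<psi> y = 0" using y \<psi>(3) by simp
        then have "ennreal \<bar>v x - v y\<bar> \<le> ennreal \<bar>p x - p y\<bar>" using le[of x y] by simp
        also have "\<dots> \<le> A x y + A y x" unfolding AA by simp
        finally show ?thesis .
      qed
    qed
  qed
  also have "(\<integral>\<^sup>+x. (\<integral>\<^sup>+y. A x y * frac_kernel s (x - y) \<partial>lborel) \<partial>lborel)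
     = (\<integral>\<^sup>+x. ennreal (1/2) * (\<integral>\<^sup>+y. ennreal \<bar>p y - p x\<bar> * frac_kernel s (y - x) \<partial>lborel)
        + indicator S x * ennreal (1 - p x) * variation_at s \<psi> x \<partial>lborel)"
  proof (rule nn_integral_cong)
    fix x
    have "(\<integral>\<^sup>+y. A x y * frac_kernel s (x - y) \<partial>lborel) = (\<integral>\<^sup>+y. ennreal (1/2) * (ennreal \<bar>p y - p x\<bar> * frac_kernel s (y - x))
        + (indicator S x * ennreal (1 - p x)) * (ennreal \<bar>\<psi> x - \<psi> y\<bar> * frac_kernel s (x - y)) \<partial>lborel)"
      unfolding A_def by (intro nn_integral_cong) (simp only: frac_kernel_minus[of s x] distrib_right mult.assoc)
    also have "\<dots> = (\<integral>\<^sup>+y. ennreal (1/2) * (ennreal \<bar>p y - p x\<bar> * frac_kernel s (y - x)) \<partial>lborel)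
        + (\<integral>\<^sup>+y. (indicator S x * ennreal (1 - p x)) * (ennreal \<bar>\<psi> x - \<psi> y\<bar> * frac_kernel s (x - y)) \<partial>lborel)"
      by (rule nn_integral_add) measurable
    also have "(\<integral>\<^sup>+y. ennreal (1/2) * (ennreal \<bar>p y - p x\<bar> * frac_kernel s (y - x)) \<partial>lborel) = ennreal (1/2) * (\<integral>\<^sup>+y. ennreal \<bar>p y - p x\<bar> * frac_kernel s (y - x) \<partial>lborel)"
      by (rule nn_integral_cmult) measurable
    also have "(\<integral>\<^sup>+y. (indicator S x * ennreal (1 - p x)) * (ennreal \<bar>\<psi> x - \<psi> y\<bar> * frac_kernel s (x - y)) \<partial>lborel)
       = (indicator S x * ennreal (1 - p x)) * variation_at s \<psi> x"
      by (rule nn_integral_cmult) measurable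
    finally show "(\<integral>\<^sup>+y. A x y * frac_kernel s (x - y) \<partial>lborel) = ennreal (1/2) * (\<integral>\<^sup>+y. ennreal \<bar>p y - p x\<bar> * frac_kernel s (y - x) \<partial>lborel)
        + indicator S x * ennreal (1 - p x) * variation_at s \<psi> x" .
  qed
  also have "\<dots> \<le> (\<integral>\<^sup>+x. ennreal (1/2) * (\<integral>\<^sup>+y. ennreal \<bar>p y - p x\<bar> * frac_kernel s (y - x) \<partial>lborel)
        + (indicator S x * ennreal (1 - p x)) * k \<partial>lborel)"
    by (intro nn_integral_mono add_left_mono mult_left_mono K) simp
  also have "\<dots> = (\<integral>\<^sup>+x. ennreal (1/2) * (\<integral>\<^sup>+y. ennreal \<bar>p y - p x\<bar> * frac_kernel s (y - x) \<partial>lborel) \<partial>lborel)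
        + (\<integral>\<^sup>+x. (indicator S x * ennreal (1 - p x)) * k \<partial>lborel)"
    by (rule nn_integral_add) measurable
  also have "(\<integral>\<^sup>+x. ennreal (1/2) * (\<integral>\<^sup>+y. ennreal \<bar>p y - p x\<bar> * frac_kernel s (y - x) \<partial>lborel) \<partial>lborel) = ennreal (1/2) * gagliardo s p"
    unfolding gagliardo_frac_kernel by (rule nn_integral_cmult) measurable
  also have "(\<integral>\<^sup>+x. (indicator S x * ennreal (1 - p x)) * k \<partial>lborel) = (\<integral>\<^sup>+x. indicator S x * ennreal (1 - p x) \<partial>lborel) * k"
    by (rule nn_integral_multc) measurable
  also have "2 * (ennreal (1/2) * gagliardo s p + (\<integral>\<^sup>+x. indicator S x * ennreal (1 - p x) \<partial>lborel) * k)
     = gagliardo s p + 2 * ((\<integral>\<^sup>+x. indicator S x * ennreal (1 - p x) \<partial>lborel) * k)"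
  proof -
    have "2 * (ennreal (1/2) * gagliardo s p) = (ennreal 2 * ennreal (1/2)) * gagliardo s p" by (simp only: mult.assoc ennreal_numeral)
    also have "ennreal 2 * ennreal (1/2) = 1" by (subst ennreal_mult[symmetric]) auto
    finally show ?thesis by (simp add: distrib_left)
  qed
  finally show ?thesis by (simp add: v_def mult_left_mono)
qed

text \<open>The filled function equals 1 only on the ball of radius \<open>(1 - \<epsilon> / 2) r\<close>; composed with \<open>shrink\<close>, which maps a
  neighbourhood of the ball of radius \<open>r\<close> into that ball, it becomes admissible for the capacity of the ball of
  radius \<open>r\<close>.\<close>
lemma frac_cap_fill_le:
  fixes \<phi> :: "'a::euclidean_space \<Rightarrow> real"
  assumes s: "0 < s" "s < 1" and r: "0 < r" and \<epsilon>: "0 < \<epsilon>" "5 * \<epsilon> < 1" and \<phi>: "\<phi> \<in> test_functions (ball x0 (2 * r))"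
    and K: "\<And>x. variation_at s (cutoff x0 ((1 - \<epsilon> / 2) * r) ((1 - \<epsilon> / 4) * r)) x \<le> k"
  shows "frac_cap s (cball x0 r) (ball x0 (2 * r)) \<le> ennreal ((1 + 5 * \<epsilon>) ^ (DIM('a) + 1) * ((1 / (1 - 5 * \<epsilon>)) ^ DIM('a)) ^ 2)
      * (gagliardo s \<phi> + 2 * ((\<integral>\<^sup>+x. indicator (cball x0 ((1 - \<epsilon> / 4) * r)) x * ennreal (1 - clamp01 (\<phi> x)) \<partial>lborel) * k))"
proof -
  define \<psi> where "\<psi> = cutoff x0 ((1 - \<epsilon> / 2) * r) ((1 - \<epsilon> / 4) * r)"
  define S where "S = cball x0 ((1 - \<epsilon> / 4) * r)"
  define p where "p = (\<lambda>x. clamp01 (\<phi> x))"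
  define v where "v = (\<lambda>x. 1 - (1 - \<psi> x) * (1 - p x))"
  define M where "M = ennreal ((1 + 5 * \<epsilon>) ^ (DIM('a) + 1) * ((1 / (1 - 5 * \<epsilon>)) ^ DIM('a)) ^ 2)"
  have ab: "(1 - \<epsilon> / 2) * r < (1 - \<epsilon> / 4) * r" using r \<epsilon> by (intro mult_strict_right_mono) auto
  have \<phi>m[measurable]: "\<phi> \<in> borel_measurable borel" by (rule test_functions_measurable[OF \<phi>])
  have pm[measurable]: "p \<in> borel_measurable borel" unfolding p_def by measurable
  have \<psi>m[measurable]: "\<psi> \<in> borel_measurable borel" unfolding \<psi>_def by measurable
  have Sm[measurable]: "S \<in> sets borel" unfolding S_def by simp
  have vm[measurable]: "v \<in> borel_measurable borel" unfolding v_def by measurable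
  have p01: "0 \<le> p x" "p x \<le> 1" for x unfolding p_def by (rule clamp01_range)+
  have \<psi>01: "0 \<le> \<psi> x" "\<psi> x \<le> 1" for x unfolding \<psi>_def by (rule cutoff_range)+
  have \<psi>0: "\<psi> x = 0" if "x \<notin> S" for x
    unfolding \<psi>_def using that by (intro cutoff_eq_0[OF ab]) (simp add: S_def dist_commute)
  define Kc where "Kc = closure {x. \<phi> x \<noteq> 0} \<union> cball x0 (7/4 * r)"
  have supp: "compact (closure {x. \<phi> x \<noteq> 0})" "closure {x. \<phi> x \<noteq> 0} \<subseteq> ball x0 (2 * r)"
    using \<phi> unfolding test_functions_def by blast+
  have "frac_cap s (cball x0 r) (ball x0 (2 * r)) \<le> gagliardo s (\<lambda>x. v (shrink x0 r \<epsilon> x))"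
  proof (rule frac_cap_le_gagliardo[where K = Kc and e = "\<epsilon> / 2 * r" and B = 1])
    show "(\<lambda>x. v (shrink x0 r \<epsilon> x)) \<in> borel_measurable borel"
      using shrink_measurable[OF r \<epsilon>, of x0] by measurable
    show "\<bar>v (shrink x0 r \<epsilon> x)\<bar> \<le> 1" for x
    proof -
      let ?y = "shrink x0 r \<epsilon> x"
      have "0 \<le> (1 - \<psi> ?y) * (1 - p ?y)" "(1 - \<psi> ?y) * (1 - p ?y) \<le> 1"
        using p01[of ?y] \<psi>01[of ?y] by (auto intro: mult_le_one)
      then show ?thesis by (simp add: v_def)
    qed
    show "compact Kc" unfolding Kc_def using supp(1) by (intro compact_Un) auto
    have "cball x0 (7/4 * r) \<subseteq> ball x0 (2 * r)" using r by auto
    then show "Kc \<subseteq> ball x0 (2 * r)" unfolding Kc_def using supp(2) by blast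
    show "v (shrink x0 r \<epsilon> x) = 0" if "x \<notin> Kc" for x
    proof -
      have "\<phi> x = 0" using that test_functions_support[OF \<phi>, of x] by (simp add: Kc_def)
      then have "p x = 0" by (simp add: p_def clamp01_def)
      have far: "7/4 * r \<le> dist x x0" using that by (simp add: Kc_def dist_commute)
      have "(1 - \<epsilon> / 4) * r \<le> 1 * r" using \<epsilon> r by (intro mult_right_mono) auto
      then have "\<psi> x = 0" unfolding \<psi>_def using far r by (intro cutoff_eq_0[OF ab]) linarith
      then show ?thesis using \<open>p x = 0\<close> shrink_outer[OF r \<epsilon> far] by (simp add: v_def)
    qed
    fix x y assume x: "x \<in> cball x0 r" and xy: "dist x y \<le> \<epsilon> / 2 * r"
    have dy: "dist y x0 \<le> (1 + \<epsilon> / 2) * r"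
      using x xy dist_triangle[of y x0 x] by (simp add: dist_commute distrib_right)
    have "(1 + \<epsilon> / 2) * r \<le> 5/4 * r" using \<epsilon> r by (intro mult_right_mono) auto
    then have "dist (shrink x0 r \<epsilon> y) x0 = (1 - \<epsilon>) * dist y x0" using dy by (intro shrink_inner[OF r \<epsilon>]) simp
    also have "\<dots> \<le> (1 - \<epsilon>) * ((1 + \<epsilon> / 2) * r)" using dy \<epsilon> by (intro mult_left_mono) auto
    also have "\<dots> \<le> (1 - \<epsilon> / 2) * r"
    proof -
      have "(1 - \<epsilon>) * (1 + \<epsilon> / 2) = 1 - \<epsilon> / 2 - \<epsilon> * \<epsilon> / 2" by (simp add: field_simps)
      also have "\<dots> \<le> 1 - \<epsilon> / 2" by simp
      finally show ?thesis using r mult_right_mono[of "(1 - \<epsilon>) * (1 + \<epsilon> / 2)" "1 - \<epsilon> / 2" r] by (simp add: mult.assoc)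
    qed
    finally have "\<psi> (shrink x0 r \<epsilon> y) = 1" unfolding \<psi>_def by (rule cutoff_eq_1[OF ab])
    then show "1 \<le> v (shrink x0 r \<epsilon> y)" by (simp add: v_def)
  qed (use r \<epsilon> in auto)
  also have "\<dots> \<le> M * gagliardo s v" unfolding M_def by (rule gagliardo_shrink[OF r \<epsilon> s vm])
  also have "\<dots> \<le> M * (gagliardo s \<phi> + 2 * ((\<integral>\<^sup>+x. indicator S x * ennreal (1 - p x) \<partial>lborel) * k))"
  proof (rule mult_left_mono)
    have "gagliardo s v \<le> gagliardo s p + 2 * ((\<integral>\<^sup>+x. indicator S x * ennreal (1 - p x) \<partial>lborel) * k)"
      unfolding v_def by (rule gagliardo_fill_le[OF pm \<psi>m Sm p01 \<psi>01 \<psi>0 K[folded \<psi>_def]])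
    also have "\<dots> \<le> gagliardo s \<phi> + 2 * ((\<integral>\<^sup>+x. indicator S x * ennreal (1 - p x) \<partial>lborel) * k)"
      unfolding p_def by (intro add_right_mono gagliardo_mono clamp01_diff)
    finally show "gagliardo s v \<le> gagliardo s \<phi> + 2 * ((\<integral>\<^sup>+x. indicator S x * ennreal (1 - p x) \<partial>lborel) * k)" .
  qed simp
  finally show ?thesis by (simp only: M_def S_def p_def)
qed

lemma ex_shrink_parameter:
  fixes a b :: real
  assumes "a < b"
  shows "\<exists>\<epsilon>>0. 5 * \<epsilon> < 1 \<and> (1 + 5 * \<epsilon>) ^ (n + 1) * ((1 / (1 - 5 * \<epsilon>)) ^ n) ^ 2 * a \<le> b"
proof -
  have "((\<lambda>\<epsilon>::real. (1 + 5 * \<epsilon>) ^ (n + 1) * ((1 / (1 - 5 * \<epsilon>)) ^ n) ^ 2 * a)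
      \<longlongrightarrow> (1 + 5 * 0) ^ (n + 1) * ((1 / (1 - 5 * 0)) ^ n) ^ 2 * a) (at_right 0)"
    by (intro tendsto_intros) auto
  then have "((\<lambda>\<epsilon>::real. (1 + 5 * \<epsilon>) ^ (n + 1) * ((1 / (1 - 5 * \<epsilon>)) ^ n) ^ 2 * a) \<longlongrightarrow> a) (at_right 0)" by simp
  from order_tendstoD(2)[OF this assms]
  have "\<forall>\<^sub>F \<epsilon> in at_right 0. (1 + 5 * \<epsilon>) ^ (n + 1) * ((1 / (1 - 5 * \<epsilon>)) ^ n) ^ 2 * a < b" .
  moreover have "\<forall>\<^sub>F \<epsilon>::real in at_right 0. \<epsilon> \<in> {0<..<1/5}"
    by (rule eventually_at_right_real) simp
  ultimately have "\<forall>\<^sub>F \<epsilon> in at_right 0. \<epsilon> \<in> {0<..<1/5} \<and> (1 + 5 * \<epsilon>) ^ (n + 1) * ((1 / (1 - 5 * \<epsilon>)) ^ n) ^ 2 * a < b"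
    by eventually_elim simp
  from eventually_happens'[OF _ this] obtain \<epsilon> where "\<epsilon> \<in> {0<..<1/5}"
    "(1 + 5 * \<epsilon>) ^ (n + 1) * ((1 / (1 - 5 * \<epsilon>)) ^ n) ^ 2 * a < b" by auto
  then show ?thesis by (intro exI[of _ \<epsilon>]) auto
qed

lemma ennreal_mult_le_imp_le:
  fixes X :: ennreal
  assumes "X * ennreal a \<le> ennreal b" "0 < a" "0 \<le> b"
  shows "X \<le> ennreal (b / a)"
  using ennreal_le_divideI[OF assms(1)] assms(2,3) by (simp add: divide_ennreal)

text \<open>Choose \<open>\<epsilon>\<close> so small that the distortion factor times \<open>\<gamma>\<close> is still below 1. By \<open>frac_cap_fill_le\<close> a fixed fraction
  of the capacity of the ball is then bounded by the mass term; both sides carry the same factor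
  \<open>r powr -s / (s (1 - s))\<close>, so \<open>\<delta>\<close> is independent of \<open>s\<close>.\<close>
lemma uncovered_mass_lower:
  assumes \<gamma>: "0 < \<gamma>" "\<gamma> < 1"
  shows "\<exists>\<epsilon>>0. 5 * \<epsilon> < 1 \<and> (\<exists>\<delta>>0. \<forall>s\<in>{0<..<1}. \<forall>r>0. \<forall>x0::'a::euclidean_space. \<forall>\<phi>\<in>test_functions (ball x0 (2 * r)).
     gagliardo s \<phi> \<le> ennreal \<gamma> * frac_cap s (cball x0 r) (ball x0 (2 * r)) \<longrightarrow>
     ennreal (\<delta> * r ^ DIM('a)) \<le> (\<integral>\<^sup>+x. indicator (cball x0 ((1 - \<epsilon> / 4) * r)) x * ennreal (1 - clamp01 (\<phi> x)) \<partial>lborel))"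
proof -
  let ?N = "DIM('a)"
  obtain c0 where c0: "c0 > 0" and cap0: "\<forall>s\<in>{0<..<1}. \<forall>r>0. \<forall>x0::'a.
     ennreal (c0 * r powr (real ?N - s) / (s * (1 - s))) \<le> frac_cap s (cball x0 r) (ball x0 (2 * r))"
    using frac_cap_ball_lower[where 'a = 'a] by (elim exE conjE)
  obtain Cu where Cu: "Cu > 0" and cap1: "\<forall>s\<in>{0<..<1}. \<forall>r>0. \<forall>x0::'a.
     frac_cap s (cball x0 r) (ball x0 (2 * r)) \<le> ennreal (Cu * r powr (real ?N - s) / (s * (1 - s)))"
    using frac_cap_ball_upper[where 'a = 'a] by (elim exE conjE)
  obtain C where C: "C > 0" and K0: "\<forall>s\<in>{0<..<1}. \<forall>\<delta>>0. \<forall>M\<ge>0. \<forall>\<psi>::'a \<Rightarrow> real. \<psi> \<in> borel_measurable borel \<longrightarrow>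
     (\<forall>x y. \<bar>\<psi> x - \<psi> y\<bar> \<le> M * min 1 (dist x y / \<delta>)) \<longrightarrow>
     (\<forall>x. variation_at s \<psi> x \<le> ennreal (M * (C * \<delta> powr - s / (s * (1 - s)))))"
    using variation_at_Lipschitz_le[where 'a = 'a] by (elim exE conjE)
  define \<gamma>' where "\<gamma>' = (1 + \<gamma>) / 2"
  have \<gamma>': "\<gamma> < \<gamma>'" "\<gamma>' < 1" using \<gamma> by (auto simp: \<gamma>'_def)
  obtain \<epsilon> where \<epsilon>: "0 < \<epsilon>" "5 * \<epsilon> < 1" and M\<gamma>: "(1 + 5 * \<epsilon>) ^ (?N + 1) * ((1 / (1 - 5 * \<epsilon>)) ^ ?N) ^ 2 * \<gamma> \<le> \<gamma>'"
    using ex_shrink_parameter[OF \<gamma>'(1), of ?N] by (elim exE conjE)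
  define M where "M = (1 + 5 * \<epsilon>) ^ (?N + 1) * ((1 / (1 - 5 * \<epsilon>)) ^ ?N) ^ 2"
  have M: "0 < M" unfolding M_def using \<epsilon> by (intro mult_pos_pos zero_less_power) auto
  define \<delta> where "\<delta> = (1 - \<gamma>') * c0 / (2 * M * C * (4 / \<epsilon>))"
  have \<delta>: "0 < \<delta>" unfolding \<delta>_def using \<gamma>' c0 M C \<epsilon> by simp
  have main: "ennreal (\<delta> * r ^ ?N) \<le> (\<integral>\<^sup>+x. indicator (cball x0 ((1 - \<epsilon> / 4) * r)) x * ennreal (1 - clamp01 (\<phi> x)) \<partial>lborel)"
    if s: "s \<in> {0<..<1}" and r: "r > 0" and \<phi>: "\<phi> \<in> test_functions (ball x0 (2 * r))"
      and le: "gagliardo s \<phi> \<le> ennreal \<gamma> * frac_cap s (cball x0 r) (ball x0 (2 * r))"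
    for s r \<phi> and x0 :: 'a
  proof -
    have s': "0 < s" "s < 1" using s by auto
    define z where "z = r powr - s / (s * (1 - s))"
    have z: "0 < z" using s' r by (simp add: z_def)
    have rz: "A * r powr (real ?N - s) / (s * (1 - s)) = A * r ^ ?N * z" for A
      using r by (simp add: z_def powr_diff powr_realpow powr_minus divide_inverse)
    define W where "W = (\<integral>\<^sup>+x. indicator (cball x0 ((1 - \<epsilon> / 4) * r)) x * ennreal (1 - clamp01 (\<phi> x)) \<partial>lborel)"
    define k where "k = C * (4 / \<epsilon>) * z"
    have k: "0 < k" using C \<epsilon> z by (simp add: k_def)
    obtain \<kappa> where \<kappa>: "frac_cap s (cball x0 r) (ball x0 (2 * r)) = ennreal \<kappa>" "0 \<le> \<kappa>" "c0 * r ^ ?N * z \<le> \<kappa>"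
    proof -
      have up: "frac_cap s (cball x0 r) (ball x0 (2 * r)) \<le> ennreal (Cu * r ^ ?N * z)"
        using cap1[rule_format, OF s r, of x0] by (simp only: rz)
      then obtain \<kappa> where k: "frac_cap s (cball x0 r) (ball x0 (2 * r)) = ennreal \<kappa>" "0 \<le> \<kappa>"
        by (cases "frac_cap s (cball x0 r) (ball x0 (2 * r))") (auto simp: top_unique)
      have "ennreal (c0 * r ^ ?N * z) \<le> ennreal \<kappa>"
        using cap0[rule_format, OF s r, of x0] by (simp only: rz k)
      then show ?thesis using that[OF k] k by (simp add: ennreal_le_iff)
    qed
    have Kb: "variation_at s (cutoff x0 ((1 - \<epsilon> / 2) * r) ((1 - \<epsilon> / 4) * r)) x \<le> ennreal k" for x
    proof -
      have ab: "(1 - \<epsilon> / 2) * r < (1 - \<epsilon> / 4) * r" using r \<epsilon> by (intro mult_strict_right_mono) auto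
      have w: "(1 - \<epsilon> / 4) * r - (1 - \<epsilon> / 2) * r = \<epsilon> / 4 * r" by (simp add: field_simps)
      have p: "0 < \<epsilon> / 4 * r" using \<epsilon> r by simp
      have "variation_at s (cutoff x0 ((1 - \<epsilon> / 2) * r) ((1 - \<epsilon> / 4) * r)) x
        \<le> ennreal (1 * (C * (\<epsilon> / 4 * r) powr - s / (s * (1 - s))))"
      proof (rule K0[rule_format, OF s p])
        show "\<bar>cutoff x0 ((1 - \<epsilon> / 2) * r) ((1 - \<epsilon> / 4) * r) x - cutoff x0 ((1 - \<epsilon> / 2) * r) ((1 - \<epsilon> / 4) * r) y\<bar> \<le> 1 * min 1 (dist x y / (\<epsilon> / 4 * r))" for x y
          using cutoff_Lipschitz[OF ab, of x0 x y] unfolding w mult_1_left .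
      qed (auto intro: cutoff_measurable)
      also have "\<dots> \<le> ennreal k"
      proof (rule ennreal_leI)
        have "(\<epsilon> / 4 * r) powr - s = (\<epsilon> / 4) powr - s * r powr - s" by (rule powr_mult)
        also have "(\<epsilon> / 4) powr - s = (4 / \<epsilon>) powr s"
          using \<epsilon> by (simp add: powr_minus_divide powr_divide)
        also have "(4 / \<epsilon>) powr s \<le> (4 / \<epsilon>) powr 1" using \<epsilon> s' by (intro powr_mono) auto
        also have "(4 / \<epsilon>) powr 1 = 4 / \<epsilon>" using \<epsilon> by simp
        finally have "(\<epsilon> / 4 * r) powr - s \<le> 4 / \<epsilon> * r powr - s" by (simp add: mult_right_mono)
        then have "C * (\<epsilon> / 4 * r) powr - s / (s * (1 - s)) \<le> C * (4 / \<epsilon> * r powr - s) / (s * (1 - s))"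
          using C s' by (intro divide_right_mono mult_left_mono) auto
        then show "1 * (C * (\<epsilon> / 4 * r) powr - s / (s * (1 - s))) \<le> k" by (simp add: k_def z_def)
      qed
      finally show ?thesis .
    qed
    have "W \<le> (\<integral>\<^sup>+x. indicator (cball x0 ((1 - \<epsilon> / 4) * r)) x \<partial>lborel)"
      unfolding W_def
    proof (rule nn_integral_mono)
      fix x
      have "ennreal (1 - clamp01 (\<phi> x)) \<le> 1" using clamp01_range[of "\<phi> x"] by (simp add: ennreal_le_1)
      then show "indicator (cball x0 ((1 - \<epsilon> / 4) * r)) x * ennreal (1 - clamp01 (\<phi> x)) \<le> indicator (cball x0 ((1 - \<epsilon> / 4) * r)) x"
        by (auto simp: indicator_def)
    qed
    also have "\<dots> < top" using emeasure_compact_finite[of "cball x0 ((1 - \<epsilon> / 4) * r)"] by simp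
    finally obtain w where w: "W = ennreal w" "0 \<le> w" by (cases W) auto
    have "ennreal \<kappa> \<le> ennreal M * (gagliardo s \<phi> + 2 * (W * ennreal k))"
      unfolding \<kappa>(1)[symmetric] M_def W_def by (rule frac_cap_fill_le[OF s' r \<epsilon> \<phi> Kb])
    also have "\<dots> \<le> ennreal M * (ennreal \<gamma> * ennreal \<kappa> + 2 * (W * ennreal k))"
      using le unfolding \<kappa>(1) by (intro mult_left_mono add_right_mono) auto
    also have "\<dots> = ennreal (M * (\<gamma> * \<kappa> + 2 * (w * k)))"
    proof -
      have "2 * (ennreal w * ennreal k) = ennreal (2 * (w * k))"
        using w k by (simp add: ennreal_mult)
      moreover have "ennreal \<gamma> * ennreal \<kappa> = ennreal (\<gamma> * \<kappa>)" using \<gamma> \<kappa> by (simp add: ennreal_mult)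
      ultimately show ?thesis using w k \<gamma> \<kappa> M by (simp add: ennreal_mult ennreal_plus)
    qed
    finally have "\<kappa> \<le> M * (\<gamma> * \<kappa> + 2 * (w * k))"
      using w k \<gamma> \<kappa> M by (simp add: ennreal_le_iff)
    also have "\<dots> = M * \<gamma> * \<kappa> + 2 * M * w * k" by (simp add: algebra_simps)
    also have "\<dots> \<le> \<gamma>' * \<kappa> + 2 * M * w * k"
      using M\<gamma> \<kappa> unfolding M_def[symmetric] by (intro add_right_mono mult_right_mono) auto
    finally have "(1 - \<gamma>') * \<kappa> \<le> 2 * M * w * k" by (simp add: algebra_simps)
    moreover have "(1 - \<gamma>') * (c0 * r ^ ?N * z) \<le> (1 - \<gamma>') * \<kappa>" using \<gamma>' \<kappa> by (intro mult_left_mono) auto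
    ultimately have "(1 - \<gamma>') * (c0 * r ^ ?N * z) \<le> 2 * M * w * k" by (rule order_trans[rotated])
    then have "((1 - \<gamma>') * c0 * r ^ ?N) * z \<le> (2 * M * w * C * (4 / \<epsilon>)) * z" by (simp add: k_def mult_ac)
    then have "(1 - \<gamma>') * c0 * r ^ ?N \<le> 2 * M * w * C * (4 / \<epsilon>)" using z by (rule mult_right_le_imp_le)
    moreover define B where "B = 2 * M * C * (4 / \<epsilon>)"
    moreover have "0 < B" unfolding B_def using M C \<epsilon> by simp
    ultimately have "(1 - \<gamma>') * c0 * r ^ ?N \<le> w * B" by (simp add: mult_ac)
    then have "\<delta> * r ^ ?N \<le> w" unfolding \<delta>_def B_def[symmetric] using \<open>0 < B\<close> by (simp add: pos_divide_le_eq)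
    then show ?thesis using w by (simp add: W_def ennreal_leI)
  qed
  show ?thesis
    using \<epsilon> \<delta> main by (intro exI[of _ \<epsilon>] conjI exI[of _ \<delta>] ballI allI impI)
qed

text \<open>The Cheeger quotient of \<open>u = \<psi> max 0 (1 - \<tau> - p)\<close> is estimated by \<open>cheeger_le_function\<close>. The loss \<open>\<tau>\<close> makes the
  support of \<open>u\<close> a compact subset of \<open>\<Omega>\<close>, since \<open>\<phi> \<ge> 1\<close> on the part of the ball outside \<open>\<Omega>\<close>.\<close>
lemma cheeger_upper_at_radius:
  assumes \<gamma>: "0 < \<gamma>" "\<gamma> < 1"
  shows "\<exists>C>0. \<forall>s\<in>{0<..<1}. \<forall>r>0. \<forall>\<Omega>::'a::euclidean_space set. \<forall>x0. open \<Omega> \<longrightarrow>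
     negligible_cap s \<gamma> x0 r (cball x0 r - \<Omega>) \<longrightarrow> cheeger s \<Omega> \<le> ennreal (C / (s * (1 - s)) * r powr - s)"
proof -
  let ?N = "DIM('a)"
  define \<gamma>' where "\<gamma>' = (1 + \<gamma>) / 2"
  have \<gamma>': "0 < \<gamma>'" "\<gamma> < \<gamma>'" "\<gamma>' < 1" using \<gamma> by (auto simp: \<gamma>'_def)
  obtain c0 where c0: "c0 > 0" and cap0: "\<forall>s\<in>{0<..<1}. \<forall>r>0. \<forall>x0::'a.
     ennreal (c0 * r powr (real ?N - s) / (s * (1 - s))) \<le> frac_cap s (cball x0 r) (ball x0 (2 * r))"
    using frac_cap_ball_lower[where 'a = 'a] by (elim exE conjE)
  obtain Cu where Cu: "Cu > 0" and cap1: "\<forall>s\<in>{0<..<1}. \<forall>r>0. \<forall>x0::'a.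
     frac_cap s (cball x0 r) (ball x0 (2 * r)) \<le> ennreal (Cu * r powr (real ?N - s) / (s * (1 - s)))"
    using frac_cap_ball_upper[where 'a = 'a] by (elim exE conjE)
  obtain C where C: "C > 0" and G0: "\<forall>s\<in>{0<..<1}. \<forall>a b. \<forall>x0::'a. 0 \<le> a \<longrightarrow> a < b \<longrightarrow>
     gagliardo s (cutoff x0 a b) \<le> ennreal (C * b ^ DIM('a) * (b - a) powr - s / (s * (1 - s)))"
    using gagliardo_cutoff_le[where 'a = 'a] by (elim exE conjE)
  obtain \<epsilon> \<delta> where \<epsilon>: "0 < \<epsilon>" "5 * \<epsilon> < 1" and \<delta>: "0 < \<delta>" and mass: "\<forall>s\<in>{0<..<1}. \<forall>r>0. \<forall>x0::'a. \<forall>\<phi>\<in>test_functions (ball x0 (2 * r)).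
     gagliardo s \<phi> \<le> ennreal \<gamma>' * frac_cap s (cball x0 r) (ball x0 (2 * r)) \<longrightarrow>
     ennreal (\<delta> * r ^ DIM('a)) \<le> (\<integral>\<^sup>+x. indicator (cball x0 ((1 - \<epsilon> / 4) * r)) x * ennreal (1 - clamp01 (\<phi> x)) \<partial>lborel)"
    using uncovered_mass_lower[OF \<gamma>'(1,3), where 'a = 'a] by (elim exE conjE)
  define \<omega> where "\<omega> = unit_ball_vol (real ?N)"
  have \<omega>: "0 < \<omega>" by (simp add: \<omega>_def)
  \<comment> \<open>With this choice the loss of \<open>\<tau>\<close> on a ball of radius \<open>r\<close> costs half of the mass \<open>\<delta> r ^ N\<close>.\<close>
  define \<tau> where "\<tau> = \<delta> / (2 * \<omega>)"
  have \<tau>: "0 < \<tau>" using \<delta> \<omega> by (simp add: \<tau>_def)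
  define B where "B = C * (4 / \<epsilon>) + Cu"
  have B: "0 < B" using C Cu \<epsilon> by (simp add: B_def add_pos_pos)
  have main: "cheeger s \<Omega> \<le> ennreal (2 * B / \<delta> / (s * (1 - s)) * r powr - s)"
    if s: "s \<in> {0<..<1}" and r: "r > 0" and \<Omega>: "open \<Omega>" and neg: "negligible_cap s \<gamma> x0 r (cball x0 r - \<Omega>)"
    for s r \<Omega> and x0 :: 'a
  proof -
    have s': "0 < s" "s < 1" using s by auto
    define z where "z = r powr - s / (s * (1 - s))"
    have z: "0 < z" using s' r by (simp add: z_def)
    have rz: "A * r powr (real ?N - s) / (s * (1 - s)) = A * r ^ ?N * z" for A
      using r by (simp add: z_def powr_diff powr_realpow powr_minus divide_inverse)
    have up: "frac_cap s (cball x0 r) (ball x0 (2 * r)) \<le> ennreal (Cu * r ^ ?N * z)"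
      using cap1[rule_format, OF s r, of x0] by (simp only: rz)
    have lo: "ennreal (c0 * r ^ ?N * z) \<le> frac_cap s (cball x0 r) (ball x0 (2 * r))"
      using cap0[rule_format, OF s r, of x0] by (simp only: rz)
    have "0 < c0 * r ^ ?N * z" using c0 r z by simp
    then have pos: "0 < frac_cap s (cball x0 r) (ball x0 (2 * r))" using lo by (metis ennreal_less_zero_iff less_le_trans)
    obtain \<kappa> where \<kappa>: "frac_cap s (cball x0 r) (ball x0 (2 * r)) = ennreal \<kappa>" "0 < \<kappa>"
      using up pos by (cases "frac_cap s (cball x0 r) (ball x0 (2 * r))") (auto simp: top_unique)
    have "frac_cap s (cball x0 r - \<Omega>) (ball x0 (2 * r)) \<le> ennreal \<gamma> * ennreal \<kappa>"
      using neg unfolding negligible_cap_def \<kappa>(1) by blast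
    also have "\<dots> < ennreal \<gamma>' * ennreal \<kappa>"
      using \<gamma> \<gamma>' \<kappa> by (simp add: ennreal_mult[symmetric] ennreal_less_iff)
    finally obtain \<phi> where \<phi>: "\<phi> \<in> test_functions (ball x0 (2 * r))" "\<And>x. x \<in> cball x0 r - \<Omega> \<Longrightarrow> 1 \<le> \<phi> x"
        "gagliardo s \<phi> < ennreal \<gamma>' * ennreal \<kappa>"
      unfolding frac_cap_def Inf_less_iff by blast
    have \<phi>m[measurable]: "\<phi> \<in> borel_measurable borel" by (rule test_functions_measurable[OF \<phi>(1)])
    define p where "p = (\<lambda>x. clamp01 (\<phi> x))"
    have pm[measurable]: "p \<in> borel_measurable borel" unfolding p_def by measurable
    have p01: "0 \<le> p x" "p x \<le> 1" for x unfolding p_def by (rule clamp01_range)+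
    define S where "S = cball x0 ((1 - \<epsilon> / 4) * r)"
    have Sm[measurable]: "S \<in> sets borel" unfolding S_def by simp
    define W where "W = (\<integral>\<^sup>+x. indicator S x * ennreal (1 - p x) \<partial>lborel)"
    have W: "ennreal (\<delta> * r ^ ?N) \<le> W"
      unfolding W_def S_def p_def
      by (rule mass[rule_format, OF s r \<phi>(1)]) (use \<phi>(3) \<kappa>(1) in simp)
    have ab: "(1 - \<epsilon> / 4) * r < r" using \<epsilon> r by simp
    have a0: "0 \<le> (1 - \<epsilon> / 4) * r" using \<epsilon> r by simp
    define \<psi> where "\<psi> = cutoff x0 ((1 - \<epsilon> / 4) * r) r"
    have \<psi>m[measurable]: "\<psi> \<in> borel_measurable borel" unfolding \<psi>_def by (rule cutoff_measurable)
    have \<psi>01: "0 \<le> \<psi> x" "\<psi> x \<le> 1" for x unfolding \<psi>_def by (rule cutoff_range)+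
    define t where "t = (\<lambda>x. max 0 (1 - \<tau> - p x))"
    have t01: "0 \<le> t x" "t x \<le> 1" for x using p01[of x] \<tau> by (auto simp: t_def)
    have tm[measurable]: "t \<in> borel_measurable borel" unfolding t_def by measurable
    define u where "u = (\<lambda>x. \<psi> x * t x)"
    have um[measurable]: "u \<in> borel_measurable borel" unfolding u_def by measurable
    define K where "K = cball x0 r \<inter> {x. \<phi> x \<le> 1 - \<tau>}"
    have CH: "cheeger s \<Omega> * (\<integral>\<^sup>+x. ennreal (u x) \<partial>lborel) \<le> gagliardo s u"
    proof (rule cheeger_le_function[OF s um _ _ _ _ \<Omega>])
      show "0 \<le> u x" "u x \<le> 1" for x unfolding u_def using \<psi>01[of x] t01[of x] by (auto intro: mult_le_one)
      have "closed {x. \<phi> x \<le> 1 - \<tau>}"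
        using test_functions_continuous[OF \<phi>(1)] by (intro closed_Collect_le) auto
      then show "compact K" unfolding K_def by (intro compact_Int_closed) auto
      show "K \<subseteq> \<Omega>"
      proof
        fix x assume x: "x \<in> K"
        show "x \<in> \<Omega>"
        proof (rule ccontr)
          assume "x \<notin> \<Omega>"
          then have "1 \<le> \<phi> x" using x by (intro \<phi>(2)) (simp add: K_def)
          then show False using x \<tau> by (simp add: K_def)
        qed
      qed
      show "u x = 0" if "x \<notin> K" for x
      proof (cases "x \<in> cball x0 r")
        case True
        then have "1 - \<tau> < \<phi> x" using that by (simp add: K_def)
        then have "t x = 0" using \<tau> by (auto simp: t_def p_def clamp01_def)
        then show ?thesis by (simp add: u_def)
      next
        case False
        then have "\<psi> x = 0" unfolding \<psi>_def by (intro cutoff_eq_0[OF ab]) (simp add: dist_commute)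
        then show ?thesis by (simp add: u_def)
      qed
    qed
    have mass_u: "ennreal (\<delta> / 2 * r ^ ?N) \<le> (\<integral>\<^sup>+x. ennreal (u x) \<partial>lborel)"
    proof -
      have "W \<le> (\<integral>\<^sup>+x. ennreal (u x) + ennreal \<tau> * indicator S x \<partial>lborel)"
        unfolding W_def
      proof (rule nn_integral_mono)
        fix x
        show "indicator S x * ennreal (1 - p x) \<le> ennreal (u x) + ennreal \<tau> * indicator S x"
        proof (cases "x \<in> S")
          case True
          then have "dist x x0 \<le> (1 - \<epsilon> / 4) * r" by (simp add: S_def dist_commute)
          then have "\<psi> x = 1" unfolding \<psi>_def by (rule cutoff_eq_1[OF ab])
          then have "u x = t x" by (simp add: u_def)
          moreover have "ennreal (1 - p x) \<le> ennreal (t x + \<tau>)" by (intro ennreal_leI) (simp add: t_def)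
          moreover have "ennreal (t x + \<tau>) = ennreal (t x) + ennreal \<tau>" using t01(1)[of x] \<tau> by (intro ennreal_plus) auto
          ultimately show ?thesis using True by simp
        qed simp
      qed
      also have "\<dots> = (\<integral>\<^sup>+x. ennreal (u x) \<partial>lborel) + ennreal \<tau> * emeasure lborel S"
        by (subst nn_integral_add) (auto simp: nn_integral_cmult_indicator)
      also have "\<dots> \<le> (\<integral>\<^sup>+x. ennreal (u x) \<partial>lborel) + ennreal (\<delta> / 2 * r ^ ?N)"
      proof (rule add_left_mono)
        have "emeasure lborel S \<le> emeasure lborel (cball x0 r)"
          unfolding S_def using ab by (intro emeasure_mono) auto
        also have "\<dots> = ennreal (\<omega> * r ^ ?N)" using r by (simp add: emeasure_ball_dim \<omega>_def)
        finally have "ennreal \<tau> * emeasure lborel S \<le> ennreal \<tau> * ennreal (\<omega> * r ^ ?N)" by (rule mult_left_mono) simp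
        also have "\<dots> = ennreal (\<delta> / 2 * r ^ ?N)"
          using \<tau> \<omega> r by (subst ennreal_mult[symmetric]) (auto simp: \<tau>_def)
        finally show "ennreal \<tau> * emeasure lborel S \<le> ennreal (\<delta> / 2 * r ^ ?N)" .
      qed
      finally have "ennreal (\<delta> * r ^ ?N) \<le> (\<integral>\<^sup>+x. ennreal (u x) \<partial>lborel) + ennreal (\<delta> / 2 * r ^ ?N)"
        using W by (rule order_trans[rotated])
      moreover have "ennreal (\<delta> * r ^ ?N) = ennreal (\<delta> / 2 * r ^ ?N) + ennreal (\<delta> / 2 * r ^ ?N)"
        using \<delta> r by (subst ennreal_plus[symmetric]) auto
      ultimately have "ennreal (\<delta> / 2 * r ^ ?N) + ennreal (\<delta> / 2 * r ^ ?N) \<le> ennreal (\<delta> / 2 * r ^ ?N) + (\<integral>\<^sup>+x. ennreal (u x) \<partial>lborel)"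
        by (simp add: add.commute)
      then show ?thesis by (rule ennreal_add_left_cancel_le[THEN iffD1, THEN disjE]) auto
    qed
    have gag_u: "gagliardo s u \<le> ennreal (B * r ^ ?N * z)"
    proof -
      have "gagliardo s u \<le> gagliardo s \<psi> + gagliardo s \<phi>"
      proof (rule gagliardo_add[OF um \<psi>m \<phi>m])
        fix x y
        have "u x - u y = t x * (\<psi> x - \<psi> y) + \<psi> y * (t x - t y)" by (simp add: u_def algebra_simps)
        also have "\<bar>\<dots>\<bar> \<le> \<bar>t x\<bar> * \<bar>\<psi> x - \<psi> y\<bar> + \<bar>\<psi> y\<bar> * \<bar>t x - t y\<bar>"
          unfolding abs_mult[symmetric] by (rule abs_triangle_ineq)
        also have "\<dots> \<le> 1 * \<bar>\<psi> x - \<psi> y\<bar> + 1 * \<bar>\<phi> x - \<phi> y\<bar>"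
        proof (intro add_mono mult_mono)
          have "\<bar>t x - t y\<bar> \<le> \<bar>p x - p y\<bar>" by (auto simp: t_def max_def)
          also have "\<dots> \<le> \<bar>\<phi> x - \<phi> y\<bar>" unfolding p_def by (rule clamp01_diff)
          finally show "\<bar>t x - t y\<bar> \<le> \<bar>\<phi> x - \<phi> y\<bar>" .
        qed (use t01[of x] \<psi>01[of y] in auto)
        finally show "\<bar>u x - u y\<bar> \<le> \<bar>\<psi> x - \<psi> y\<bar> + \<bar>\<phi> x - \<phi> y\<bar>" by simp
      qed
      also have "\<dots> \<le> ennreal (C * (4 / \<epsilon>) * r ^ ?N * z) + ennreal (Cu * r ^ ?N * z)"
      proof (rule add_mono)
        have "gagliardo s \<psi> \<le> ennreal (C * r ^ ?N * (r - (1 - \<epsilon> / 4) * r) powr - s / (s * (1 - s)))"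
          unfolding \<psi>_def by (rule G0[rule_format, OF s a0 ab])
        also have "\<dots> \<le> ennreal (C * (4 / \<epsilon>) * r ^ ?N * z)"
        proof (rule ennreal_leI)
          have "(r - (1 - \<epsilon> / 4) * r) powr - s = (\<epsilon> / 4 * r) powr - s" by (simp add: algebra_simps)
          also have "\<dots> = (\<epsilon> / 4) powr - s * r powr - s" by (rule powr_mult)
          also have "(\<epsilon> / 4) powr - s = (4 / \<epsilon>) powr s"
            using \<epsilon> by (simp add: powr_minus_divide powr_divide)
          also have "(4 / \<epsilon>) powr s \<le> (4 / \<epsilon>) powr 1" using \<epsilon> s' by (intro powr_mono) auto
          also have "(4 / \<epsilon>) powr 1 = 4 / \<epsilon>" using \<epsilon> by simp
          finally have "(r - (1 - \<epsilon> / 4) * r) powr - s \<le> 4 / \<epsilon> * r powr - s" by (simp add: mult_right_mono)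
          then have "C * r ^ ?N * (r - (1 - \<epsilon> / 4) * r) powr - s / (s * (1 - s)) \<le> C * r ^ ?N * (4 / \<epsilon> * r powr - s) / (s * (1 - s))"
            using C s' r by (intro divide_right_mono mult_left_mono) auto
          then show "C * r ^ ?N * (r - (1 - \<epsilon> / 4) * r) powr - s / (s * (1 - s)) \<le> C * (4 / \<epsilon>) * r ^ ?N * z"
            by (simp add: z_def mult_ac)
        qed
        finally show "gagliardo s \<psi> \<le> ennreal (C * (4 / \<epsilon>) * r ^ ?N * z)" .
        have "gagliardo s \<phi> \<le> ennreal \<gamma>' * ennreal \<kappa>" using \<phi>(3) by simp
        also have "\<dots> \<le> 1 * ennreal \<kappa>" using \<gamma>' by (intro mult_right_mono) (auto simp: ennreal_le_1)
        also have "\<dots> \<le> ennreal (Cu * r ^ ?N * z)" using up \<kappa>(1) by simp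
        finally show "gagliardo s \<phi> \<le> ennreal (Cu * r ^ ?N * z)" .
      qed
      also have "\<dots> = ennreal (B * r ^ ?N * z)"
        using C Cu \<epsilon> r z by (subst ennreal_plus[symmetric]) (auto simp: B_def distrib_right)
      finally show ?thesis .
    qed
    have "cheeger s \<Omega> * ennreal (\<delta> / 2 * r ^ ?N) \<le> cheeger s \<Omega> * (\<integral>\<^sup>+x. ennreal (u x) \<partial>lborel)"
      by (rule mult_left_mono[OF mass_u]) simp
    also have "\<dots> \<le> ennreal (B * r ^ ?N * z)" by (rule order_trans[OF CH gag_u])
    finally have "cheeger s \<Omega> \<le> ennreal (B * r ^ ?N * z / (\<delta> / 2 * r ^ ?N))"
      by (rule ennreal_mult_le_imp_le) (use \<delta> r B z in auto)
    also have "B * r ^ ?N * z / (\<delta> / 2 * r ^ ?N) = 2 * B / \<delta> / (s * (1 - s)) * r powr - s"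
      using r by (simp add: z_def mult_ac)
    finally show ?thesis .
  qed
  show ?thesis
    by (rule exI[of _ "2 * B / \<delta>"]) (use B \<delta> main in auto)
qed

section \<open>From fixed radii to the capacitary inradius\<close>

lemma ennreal_powr_inverse_pos:
  assumes "0 < \<rho>" "0 < s"
  shows "ennreal_powr (1 / ennreal \<rho>) s = ennreal (\<rho> powr - s)"
proof -
  have "1 / ennreal \<rho> = ennreal (1 / \<rho>)" using assms(1) by (subst divide_ennreal[symmetric]) auto
  moreover have "(1 / \<rho>) powr s = \<rho> powr - s" by (simp only: powr_divide powr_one_eq_one powr_minus_divide)
  ultimately show ?thesis using assms by (simp add: ennreal_powr_def)
qed

text \<open>The radii \<open>t > R\<close> decrease to \<open>R\<close>. For \<open>R = 0\<close> the bounds are unbounded and force \<open>h = \<infinity>\<close>, which is also the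
  value of the left-hand side.\<close>
lemma radius_bound_lower:
  fixes R h :: ennreal
  assumes A: "0 < A" and s: "0 < s" and le: "\<And>t. 0 < t \<Longrightarrow> R < ennreal t \<Longrightarrow> ennreal (A * t powr - s) \<le> h"
  shows "ennreal A * ennreal_powr (1 / R) s \<le> h"
proof (cases R)
  case top
  then show ?thesis by (simp add: ennreal_powr_def)
next
  case (real \<rho>)
  show ?thesis
  proof (cases "\<rho> = 0")
    case True
    have "h = top"
    proof (rule ccontr)
      assume "h \<noteq> top"
      then obtain H where H: "h = ennreal H" "0 \<le> H" by (cases h) auto
      define t where "t = ((H + 1) / A) powr (- 1 / s)"
      have "0 < (H + 1) / A" using H A by simp
      then have t: "0 < t" "(H + 1) / A \<le> t powr - s"
        using s H A by (simp_all add: t_def powr_powr)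
      have "H + 1 \<le> A * t powr - s" using t(2) A by (simp add: pos_divide_le_eq mult.commute)
      moreover have "A * t powr - s \<le> H" using le[OF t(1)] real True H t A by (simp add: ennreal_le_iff)
      ultimately show False by linarith
    qed
    then show ?thesis by simp
  next
    case False
    then have \<rho>: "0 < \<rho>" using real by simp
    have "ennreal (A * \<rho> powr - s) \<le> h"
    proof (rule tendsto_upperbound)
      show "((\<lambda>t. ennreal (A * t powr - s)) \<longlongrightarrow> ennreal (A * \<rho> powr - s)) (at_right \<rho>)"
        using \<rho> by (intro tendsto_ennrealI tendsto_intros) auto
      show "\<forall>\<^sub>F t in at_right \<rho>. ennreal (A * t powr - s) \<le> h"
        using eventually_at_right_less[of \<rho>]
        by eventually_elim (use real \<rho> le in \<open>auto simp: ennreal_less_iff\<close>)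
    qed simp
    then show ?thesis using \<rho> s A real by (simp add: ennreal_powr_inverse_pos ennreal_mult)
  qed
qed

lemma radius_bound_upper:
  fixes R h :: ennreal
  assumes C: "0 < C" and s: "0 < s" and le: "\<And>t. 0 < t \<Longrightarrow> ennreal t < R \<Longrightarrow> h \<le> ennreal (C * t powr - s)"
  shows "h \<le> ennreal C * ennreal_powr (1 / R) s"
proof (cases R)
  case top
  have "h \<le> 0"
  proof (rule tendsto_lowerbound)
    have "((\<lambda>t::real. C * t powr - s) \<longlongrightarrow> C * 0) at_top"
      using s by (intro tendsto_intros tendsto_neg_powr filterlim_ident) auto
    from tendsto_ennrealI[OF this] show "((\<lambda>t::real. ennreal (C * t powr - s)) \<longlongrightarrow> 0) at_top" by simp
    show "\<forall>\<^sub>F t in at_top. h \<le> ennreal (C * t powr - s)"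
      using eventually_gt_at_top[of "0::real"] by eventually_elim (use le top in auto)
  qed simp
  then show ?thesis by simp
next
  case (real \<rho>)
  show ?thesis
  proof (cases "\<rho> = 0")
    case True
    then show ?thesis using real C by (simp add: ennreal_powr_def ennreal_mult_top)
  next
    case False
    then have \<rho>: "0 < \<rho>" using real by simp
    have "h \<le> ennreal (C * \<rho> powr - s)"
    proof (rule tendsto_lowerbound)
      show "((\<lambda>t. ennreal (C * t powr - s)) \<longlongrightarrow> ennreal (C * \<rho> powr - s)) (at_left \<rho>)"
        using \<rho> by (intro tendsto_ennrealI tendsto_intros) auto
      show "\<forall>\<^sub>F t in at_left \<rho>. h \<le> ennreal (C * t powr - s)"
        using eventually_at_left_real[OF \<rho>]
        by eventually_elim (use real \<rho> le in \<open>auto simp: ennreal_less_iff\<close>)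
    qed simp
    then show ?thesis using \<rho> s C real by (simp add: ennreal_powr_inverse_pos ennreal_mult)
  qed
qed

lemma comparableI:
  assumes "((\<lambda>x. u x / v x) \<longlongrightarrow> l) F" "0 < l" "F \<noteq> bot"
  shows "comparable F u v"
proof -
  have t: "((\<lambda>x. ereal (u x / v x)) \<longlongrightarrow> ereal l) F" using assms(1) by (rule tendsto_ereal)
  have "Liminf F (\<lambda>x. ereal (u x / v x)) = ereal l" "Limsup F (\<lambda>x. ereal (u x / v x)) = ereal l"
    using lim_imp_Liminf[OF assms(3) t] lim_imp_Limsup[OF assms(3) t] by auto
  then show ?thesis using assms(2) by (simp add: comparable_def)
qed

lemma tendsto_div_s_times_one_minus_s:
  fixes c :: real
  shows "((\<lambda>s. s * (c / (s * (1 - s)))) \<longlongrightarrow> c) (at_right 0)"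
    and "((\<lambda>s. (1 - s) * (c / (s * (1 - s)))) \<longlongrightarrow> c) (at_left 1)"
proof -
  have "((\<lambda>s. c / (1 - s)) \<longlongrightarrow> c / (1 - 0)) (at_right 0)" by (intro tendsto_intros) auto
  moreover have "\<forall>\<^sub>F s in at_right 0. s * (c / (s * (1 - s))) = c / (1 - s)"
    using eventually_at_right_less[of "0::real"] by eventually_elim simp
  ultimately show "((\<lambda>s. s * (c / (s * (1 - s)))) \<longlongrightarrow> c) (at_right 0)"
    by (simp add: tendsto_cong)
  have "((\<lambda>s. c / s) \<longlongrightarrow> c / 1) (at_left 1)" by (intro tendsto_intros) auto
  moreover have "\<forall>\<^sub>F s in at_left 1. (1 - s) * (c / (s * (1 - s))) = c / s"
    using eventually_at_left_real[of "0::real" 1, simplified] by eventually_elim simp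
  ultimately show "((\<lambda>s. (1 - s) * (c / (s * (1 - s)))) \<longlongrightarrow> c) (at_left 1)"
    by (simp add: tendsto_cong)
qed

theorem corollary1p8:
  shows "\<exists>(\<sigma> :: real \<Rightarrow> real) (\<C> :: real \<Rightarrow> real \<Rightarrow> real).
    (\<forall>s\<in>{0<..<1}. 0 < \<sigma> s) \<and>
    (\<forall>s\<in>{0<..<1}. \<forall>\<gamma>\<in>{0<..<1}. 0 < \<C> s \<gamma>) \<and>
    (\<forall>s\<in>{0<..<1}. \<forall>\<gamma>\<in>{0<..<1}. \<forall>\<Omega> :: 'a::euclidean_space set. open \<Omega> \<longrightarrow>
       ennreal (\<sigma> s * \<gamma>) * ennreal_powr (1 / cap_inradius s \<gamma> \<Omega>) s \<le> cheeger s \<Omega> \<and>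
       cheeger s \<Omega> \<le> ennreal (\<C> s \<gamma>) * ennreal_powr (1 / cap_inradius s \<gamma> \<Omega>) s) \<and>
    comparable (at_right 0) \<sigma> (\<lambda>s. 1 / s) \<and>
    comparable (at_left 1) \<sigma> (\<lambda>s. 1 / (1 - s)) \<and>
    (\<forall>s\<in>{0<..<1}. filterlim (\<lambda>\<gamma>. \<C> s \<gamma>) at_top (at_left 1)) \<and>
    (\<forall>\<gamma>\<in>{0<..<1}. \<exists>L>0. ((\<lambda>s. s * \<C> s \<gamma>) \<longlongrightarrow> L) (at_right 0)) \<and>
    (\<forall>\<gamma>\<in>{0<..<1}. \<exists>L>0. ((\<lambda>s. (1 - s) * \<C> s \<gamma>) \<longlongrightarrow> L) (at_left 1)) \<and>
    (\<forall>s\<in>{0<..<1}. \<forall>\<gamma>\<in>{0<..<1}. \<forall>\<Omega> :: 'a set. open \<Omega> \<longrightarrow>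
       (0 < cheeger s \<Omega> \<longleftrightarrow> cap_inradius s \<gamma> \<Omega> < \<infinity>)) \<and>
    (\<forall>s\<in>{0<..<1}. \<forall>\<gamma>\<in>{0<..<1}. \<forall>\<gamma>'\<in>{0<..<1}. \<forall>\<Omega> :: 'a set. open \<Omega> \<longrightarrow>
       (cap_inradius s \<gamma> \<Omega> < \<infinity> \<longleftrightarrow> cap_inradius s \<gamma>' \<Omega> < \<infinity>))"
proof -
  obtain c where c: "c > 0" and low: "\<forall>s\<in>{0<..<1}. \<forall>\<gamma>\<in>{0<..<1}. \<forall>r>0. \<forall>\<Omega>::'a set. open \<Omega> \<longrightarrow>
     (\<forall>x0. \<not> negligible_cap s \<gamma> x0 r (cball x0 r - \<Omega>)) \<longrightarrow>
     ennreal (c / (s * (1 - s)) * \<gamma> * r powr - s) \<le> cheeger s \<Omega>"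
    using cheeger_lower_at_radius[where 'a = 'a] by (elim exE conjE)
  have "\<forall>\<gamma>\<in>{0<..<1}. \<exists>C>0. \<forall>s\<in>{0<..<1}. \<forall>r>0. \<forall>\<Omega>::'a set. \<forall>x0. open \<Omega> \<longrightarrow>
     negligible_cap s \<gamma> x0 r (cball x0 r - \<Omega>) \<longrightarrow> cheeger s \<Omega> \<le> ennreal (C / (s * (1 - s)) * r powr - s)"
    using cheeger_upper_at_radius[where 'a = 'a] by simp
  from bchoice[OF this] obtain D where D: "\<forall>\<gamma>\<in>{0<..<1}. D \<gamma> > 0 \<and> (\<forall>s\<in>{0<..<1}. \<forall>r>0. \<forall>\<Omega>::'a set. \<forall>x0. open \<Omega> \<longrightarrow>
     negligible_cap s \<gamma> x0 r (cball x0 r - \<Omega>) \<longrightarrow> cheeger s \<Omega> \<le> ennreal (D \<gamma> / (s * (1 - s)) * r powr - s))"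
    by (elim exE)
  \<comment> \<open>The second summand makes the constant diverge as \<open>\<gamma>\<close> tends to 1.\<close>
  define E where "E = (\<lambda>\<gamma>. \<bar>D \<gamma>\<bar> + 1 / (1 - \<gamma>))"
  have E: "0 < E \<gamma>" "D \<gamma> \<le> E \<gamma>" if "\<gamma> \<in> {0<..<1}" for \<gamma>
  proof -
    have "0 < 1 / (1 - \<gamma>)" using that by simp
    then show "0 < E \<gamma>" "D \<gamma> \<le> E \<gamma>" unfolding E_def by linarith+
  qed
  define \<sigma> where "\<sigma> = (\<lambda>s::real. c / (s * (1 - s)))"
  define \<C> where "\<C> = (\<lambda>s \<gamma>. E \<gamma> / (s * (1 - s)))"
  have \<sigma>: "0 < \<sigma> s" if "s \<in> {0<..<1}" for s using that c by (simp add: \<sigma>_def)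
  have \<C>: "0 < \<C> s \<gamma>" if "s \<in> {0<..<1}" "\<gamma> \<in> {0<..<1}" for s \<gamma> using that E by (simp add: \<C>_def)
  have lower: "ennreal (\<sigma> s * \<gamma>) * ennreal_powr (1 / cap_inradius s \<gamma> \<Omega>) s \<le> cheeger s \<Omega>"
    if s: "s \<in> {0<..<1}" and \<gamma>: "\<gamma> \<in> {0<..<1}" and \<Omega>: "open \<Omega>" for s \<gamma> and \<Omega> :: "'a set"
  proof (rule radius_bound_lower)
    fix t assume t: "0 < t" "cap_inradius s \<gamma> \<Omega> < ennreal t"
    have "\<not> negligible_cap s \<gamma> x0 t (cball x0 t - \<Omega>)" for x0
    proof
      assume "negligible_cap s \<gamma> x0 t (cball x0 t - \<Omega>)"
      then have "ennreal t \<le> cap_inradius s \<gamma> \<Omega>" unfolding cap_inradius_def using t(1) by (intro Sup_upper) auto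
      then show False using t(2) by simp
    qed
    then show "ennreal (\<sigma> s * \<gamma> * t powr - s) \<le> cheeger s \<Omega>"
      using low[rule_format, OF s \<gamma> t(1) \<Omega>] by (simp add: \<sigma>_def)
  qed (use s \<gamma> \<sigma>[OF s] in auto)
  have upper: "cheeger s \<Omega> \<le> ennreal (\<C> s \<gamma>) * ennreal_powr (1 / cap_inradius s \<gamma> \<Omega>) s"
    if s: "s \<in> {0<..<1}" and \<gamma>: "\<gamma> \<in> {0<..<1}" and \<Omega>: "open \<Omega>" for s \<gamma> and \<Omega> :: "'a set"
  proof (rule radius_bound_upper)
    fix t assume t: "0 < t" "ennreal t < cap_inradius s \<gamma> \<Omega>"
    then obtain r x0 where r: "0 < r" "ennreal t < ennreal r" "negligible_cap s \<gamma> x0 r (cball x0 r - \<Omega>)"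
      unfolding cap_inradius_def less_Sup_iff by blast
    have tr: "t < r" using r(2) t(1) by (simp add: ennreal_less_iff)
    have "cheeger s \<Omega> \<le> ennreal (D \<gamma> / (s * (1 - s)) * r powr - s)"
      using D[rule_format, OF \<gamma>] s r \<Omega> by blast
    also have "\<dots> \<le> ennreal (\<C> s \<gamma> * t powr - s)"
    proof (intro ennreal_leI mult_mono)
      show "D \<gamma> / (s * (1 - s)) \<le> \<C> s \<gamma>" unfolding \<C>_def using E(2)[OF \<gamma>] s by (intro divide_right_mono) auto
      show "r powr - s \<le> t powr - s" using tr t(1) s by (intro powr_mono2') auto
      show "0 \<le> \<C> s \<gamma>" using \<C>[OF s \<gamma>] by simp
    qed simp
    finally show "cheeger s \<Omega> \<le> ennreal (\<C> s \<gamma> * t powr - s)" .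
  qed (use s \<C>[OF s \<gamma>] in auto)
  have iff: "0 < cheeger s \<Omega> \<longleftrightarrow> cap_inradius s \<gamma> \<Omega> < \<infinity>"
    if s: "s \<in> {0<..<1}" and \<gamma>: "\<gamma> \<in> {0<..<1}" and \<Omega>: "open \<Omega>" for s \<gamma> and \<Omega> :: "'a set"
  proof (cases "cap_inradius s \<gamma> \<Omega>")
    case top
    then have "cheeger s \<Omega> \<le> 0" using upper[OF s \<gamma> \<Omega>] by (simp add: ennreal_powr_def)
    then show ?thesis using top by simp
  next
    case (real \<rho>)
    have "0 < ennreal_powr (1 / cap_inradius s \<gamma> \<Omega>) s"
      using real s ennreal_powr_inverse_pos[of \<rho> s] by (cases "\<rho> = 0") (auto simp: ennreal_powr_def)
    then have "0 < ennreal (\<sigma> s * \<gamma>) * ennreal_powr (1 / cap_inradius s \<gamma> \<Omega>) s"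
      using \<sigma>[OF s] \<gamma> by (simp add: ennreal_zero_less_mult_iff)
    then have "0 < cheeger s \<Omega>" using lower[OF s \<gamma> \<Omega>] by (rule less_le_trans)
    then show ?thesis using real by simp
  qed
  have cmp0: "comparable (at_right 0) \<sigma> (\<lambda>s. 1 / s)"
    by (rule comparableI[OF _ c]) (use tendsto_div_s_times_one_minus_s(1)[of c] in \<open>simp_all add: \<sigma>_def mult.commute\<close>)
  have cmp1: "comparable (at_left 1) \<sigma> (\<lambda>s. 1 / (1 - s))"
    by (rule comparableI[OF _ c]) (use tendsto_div_s_times_one_minus_s(2)[of c] in \<open>simp_all add: \<sigma>_def mult.commute\<close>)
  have div: "filterlim (\<lambda>\<gamma>. \<C> s \<gamma>) at_top (at_left 1)" if s: "s \<in> {0<..<1}" for s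
  proof (rule filterlim_at_top_mono)
    have "filterlim (\<lambda>\<gamma>::real. 1 - \<gamma>) (at_right 0) (at_left 1)"
      unfolding filterlim_at
    proof
      show "\<forall>\<^sub>F \<gamma>::real in at_left 1. 1 - \<gamma> \<in> {0<..} \<and> 1 - \<gamma> \<noteq> 0"
        using eventually_at_left_real[of 0 "1::real", simplified] by eventually_elim auto
      have "((\<lambda>\<gamma>::real. 1 - \<gamma>) \<longlongrightarrow> 1 - 1) (at_left 1)" by (intro tendsto_intros)
      then show "((\<lambda>\<gamma>::real. 1 - \<gamma>) \<longlongrightarrow> 0) (at_left 1)" by simp
    qed
    from filterlim_compose[OF filterlim_inverse_at_top_right this]
    show "filterlim (\<lambda>\<gamma>::real. inverse (1 - \<gamma>)) at_top (at_left 1)" .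
    show "\<forall>\<^sub>F \<gamma> in at_left 1. inverse (1 - \<gamma>) \<le> \<C> s \<gamma>"
      using eventually_at_left_real[of 0 "1::real", simplified]
    proof eventually_elim
      case (elim \<gamma>)
      then have \<gamma>: "\<gamma> \<in> {0<..<1}" by simp
      have q: "0 < s * (1 - s)" "s * (1 - s) \<le> 1" using s mult_le_one[of s "1 - s"] by auto
      have "inverse (1 - \<gamma>) \<le> E \<gamma>" by (simp add: E_def inverse_eq_divide)
      also have "E \<gamma> = E \<gamma> / 1" by simp
      also have "\<dots> \<le> E \<gamma> / (s * (1 - s))" using E(1)[OF \<gamma>] q by (intro divide_left_mono) auto
      finally show ?case by (simp add: \<C>_def)
    qed
  qed
  show ?thesis
  proof (intro exI[of _ \<sigma>] exI[of _ \<C>] conjI ballI allI impI)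
    show "comparable (at_right 0) \<sigma> (\<lambda>s. 1 / s)" by (rule cmp0)
    show "comparable (at_left 1) \<sigma> (\<lambda>s. 1 / (1 - s))" by (rule cmp1)
    show "\<exists>L>0. ((\<lambda>s. s * \<C> s \<gamma>) \<longlongrightarrow> L) (at_right 0)" if "\<gamma> \<in> {0<..<1}" for \<gamma>
      using tendsto_div_s_times_one_minus_s(1)[of "E \<gamma>"] E(1)[OF that] unfolding \<C>_def by blast
    show "\<exists>L>0. ((\<lambda>s. (1 - s) * \<C> s \<gamma>) \<longlongrightarrow> L) (at_left 1)" if "\<gamma> \<in> {0<..<1}" for \<gamma>
      using tendsto_div_s_times_one_minus_s(2)[of "E \<gamma>"] E(1)[OF that] unfolding \<C>_def by blast
    show "cap_inradius s \<gamma> \<Omega> < \<infinity> \<longleftrightarrow> cap_inradius s \<gamma>' \<Omega> < \<infinity>"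
      if "s \<in> {0<..<1}" "\<gamma> \<in> {0<..<1}" "\<gamma>' \<in> {0<..<1}" "open \<Omega>" for s \<gamma> \<gamma>' and \<Omega> :: "'a set"
      using iff[OF that(1,2,4)] iff[OF that(1,3,4)] by simp
  qed (fact \<sigma> \<C> lower upper iff div)+
qed

end
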